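(* For all integers $N\geqslant 3$, $$(\log N)^{\eta}\ll \mathcal V_N\leqslant \tfrac12\,\mathcal T_N\ll (\log N)^{\eta}(\log\log N)^3,$$ where the implied constants are absolute (the middle inequality $\mathcal V_N\leqslant\frac12\mathcal T_N$ is exact).
   Context: For an integer $N\geqslant 1$ and $\boldsymbol c=(c_n)_{1\leqslant n\leqslant N}\in(\mathbb R^+)^N$, where $\mathbb R^+=[0,\infty)$, put $\|\boldsymbol c\|_1=\sum_{n\leqslant N}|c_n|$ and let $(m,n)$ denote the greatest common divisor of $m,n$. Define $$\mathcal V_N:=N\inf_{\boldsymbol c\in(\mathbb R^+)^N,\ \|\boldsymbol c\|_1=1}\ \sum_{m,n\leqslant N}\frac{(m,n)}{m+n}c_mc_n,\qquad \mathcal T_N:=N\inf_{\boldsymbol c\in(\mathbb R^+)^N,\ \|\boldsymbol c\|_1=1}\ \sum_{m,n\leqslant N}\frac{(m,n)}{\sqrt{mn}}c_mc_n.$$ For $u\in(0,1]$ put $$y(u):=\tfrac12\big(-1+\sqrt{1+4u}\big),\quad f(u):=2u\log\{1+y(u)\}-y(u)^2,\quad Q(u):=u\log u-u+1.$$ Let $\beta\approx 0.48155$ be the solution in $(0,1]$ of $f(\beta)=Q(\beta)$, and set $\eta:=f(\beta)\approx 0.16656$. The notation $A\ll B$ means $A\leqslant KB$ for some constant $K>0$. *)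

theory Defs
  imports Complex_Main "HOL-Library.FuncSet"
begin

text \<open>Vectors in the nonnegative orthant of \<open>\<real>\<^sup>N\<close>, with coordinates \<open>1, \<dots>, N\<close> and 1-norm equal
  to 1, are encoded as extensional functions on \<^term>\<open>{1..N}\<close>.\<close>

definition simplex_vecs :: "nat \<Rightarrow> (nat \<Rightarrow> real) set" where
  "simplex_vecs N = {c \<in> {1..N} \<rightarrow>\<^sub>E {0..}. (\<Sum>n\<in>{1..N}. \<bar>c n\<bar>) = 1}"

definition V :: "nat \<Rightarrow> real" where
  "V N = real N * (INF c\<in>simplex_vecs N.
     \<Sum>m\<in>{1..N}. \<Sum>n\<in>{1..N}. real (gcd m n) / (real m + real n) * c m * c n)"

definition T :: "nat \<Rightarrow> real" where
  "T N = real N * (INF c\<in>simplex_vecs N.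
     \<Sum>m\<in>{1..N}. \<Sum>n\<in>{1..N}. real (gcd m n) / sqrt (real m * real n) * c m * c n)"

text \<open>The functions below are meant for arguments in \<^term>\<open>{0<..1::real}\<close> only.\<close>

definition yfun :: "real \<Rightarrow> real" where
  "yfun u = (- 1 + sqrt (1 + 4 * u)) / 2"

definition ffun :: "real \<Rightarrow> real" where
  "ffun u = 2 * u * ln (1 + yfun u) - (yfun u)\<^sup>2"

definition Qfun :: "real \<Rightarrow> real" where
  "Qfun u = u * ln u - u + 1"

definition beta :: real where
  "beta = (THE u. u \<in> {0<..1} \<and> ffun u = Qfun u)"

definition eta :: real where
  "eta = ffun beta"

text \<open>The infima range over nonempty sets that are bounded below, and the description of
  \<^const>\<open>beta\<close> is proper.\<close>

lemma simplex_vecs_nonempty: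
  assumes "N \<ge> 1"
  shows "simplex_vecs N \<noteq> {}"
proof -
  define c where "c = (\<lambda>n\<in>{1..N}. if n = 1 then 1 else (0::real))"
  have "(\<Sum>n\<in>{1..N}. \<bar>c n\<bar>) = (\<Sum>n\<in>{1..N}. if n = 1 then 1 else 0)"
    by (intro sum.cong) (auto simp: c_def)
  also have "\<dots> = 1" using assms by simp
  finally have "c \<in> simplex_vecs N" by (auto simp: simplex_vecs_def c_def)
  then show ?thesis by blast
qed

lemma bdd_below_V:
  "bdd_below ((\<lambda>c. \<Sum>m\<in>{1..N}. \<Sum>n\<in>{1..N}. real (gcd m n) / (real m + real n) * c m * c n)
     ` simplex_vecs N)"
  by (rule bdd_belowI2[where m = 0])
    (auto simp: simplex_vecs_def PiE_iff intro!: sum_nonneg mult_nonneg_nonneg divide_nonneg_nonneg)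

lemma bdd_below_T:
  "bdd_below ((\<lambda>c. \<Sum>m\<in>{1..N}. \<Sum>n\<in>{1..N}. real (gcd m n) / sqrt (real m * real n) * c m * c n)
     ` simplex_vecs N)"
  by (rule bdd_belowI2[where m = 0])
    (auto simp: simplex_vecs_def PiE_iff intro!: sum_nonneg mult_nonneg_nonneg divide_nonneg_nonneg)

lemma yfun_pos: "u > 0 \<Longrightarrow> yfun u > 0"
  by (simp add: yfun_def)

lemma yfun_eq:
  assumes "u > 0"
  shows "yfun u * (1 + yfun u) = u"
proof -
  have "sqrt (1 + 4 * u) * sqrt (1 + 4 * u) = 1 + 4 * u"
    using assms by simp
  then show ?thesis by (simp add: yfun_def field_simps)
qed

lemma ffun_minus_Qfun_deriv:
  assumes "u > 0"
  shows "((\<lambda>u. ffun u - Qfun u) has_real_derivative 2 * ln (1 + yfun u) - ln u) (at u)"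
proof -
  define D where "D = 1 / sqrt (1 + 4 * u)"
  have y: "(yfun has_real_derivative D) (at u)"
    unfolding yfun_def[abs_def] D_def using assms
    by (auto intro!: derivative_eq_intros simp: field_simps)
  have pos: "1 + yfun u > 0" using yfun_pos[OF assms] by simp
  have "((\<lambda>u. ffun u - Qfun u) has_real_derivative
      2 * ln (1 + yfun u) + 2 * u * (D / (1 + yfun u)) - 2 * yfun u * D - ln u) (at u)"
    unfolding ffun_def Qfun_def using assms pos
    by (auto intro!: derivative_eq_intros y simp: field_simps)
  moreover have "u / (1 + yfun u) = yfun u"
    using yfun_eq[OF assms] pos by (simp add: field_simps)
  then have "2 * u * (D / (1 + yfun u)) = 2 * yfun u * D"
    by (metis (no_types, lifting) mult.commute mult.left_commute times_divide_eq_right)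
  ultimately show ?thesis by simp
qed

lemma beta_ex1: "\<exists>!u. u \<in> {0<..1} \<and> ffun u = Qfun u"
proof -
  define g where "g = (\<lambda>u. ffun u - Qfun u)"
  have der: "(g has_real_derivative 2 * ln (1 + yfun u) - ln u) (at u)" if "u > 0" for u
    using ffun_minus_Qfun_deriv[OF that] by (simp add: g_def)
  have incr: "g a < g b" if "0 < a" "a < b" "b \<le> 1" for a b
  proof (rule DERIV_pos_imp_increasing[OF that(2)])
    fix x assume x: "a \<le> x" "x \<le> b"
    then have "x > 0" "ln x \<le> 0" using that by auto
    moreover have "ln (1 + yfun x) > 0" using yfun_pos[OF \<open>x > 0\<close>] by simp
    ultimately have "2 * ln (1 + yfun x) - ln x > 0" by linarith
    then show "\<exists>y. (g has_real_derivative y) (at x) \<and> y > 0"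
      using der[OF \<open>x > 0\<close>] by blast
  qed
  have "g (exp (- 2)) \<le> 0"
  proof -
    define u where "u = exp (- 2 :: real)"
    have u: "u > 0" by (simp add: u_def)
    have "exp (2::real) = exp 1 * exp 1" by (simp flip: exp_add)
    moreover have "exp (1::real) \<ge> 2" using exp_ge_add_one_self[of 1] by simp
    then have "exp 1 * exp 1 \<ge> 2 * (2::real)" by (intro mult_mono) auto
    ultimately have "u \<le> 1 / 4" by (simp add: u_def exp_minus field_simps)
    have y: "yfun u > 0" by (rule yfun_pos[OF u])
    have "yfun u * 1 \<le> yfun u * (1 + yfun u)" using y by (intro mult_left_mono) auto
    then have "yfun u \<le> 1 / 4" using yfun_eq[OF u] \<open>u \<le> 1 / 4\<close> by simp
    moreover have "ln (1 + yfun u) \<le> yfun u" using y by (intro ln_add_one_self_le_self) auto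
    ultimately have "u * ln (1 + yfun u) \<le> 1 / 4 * (1 / 4)"
      using u y \<open>u \<le> 1 / 4\<close> by (intro mult_mono) auto
    then have "ffun u \<le> 1 / 8"
      unfolding ffun_def using zero_le_power2[of "yfun u"] by linarith
    moreover have "ln u = - 2" by (simp add: u_def)
    then have "Qfun u \<ge> 1 / 4" unfolding Qfun_def using \<open>u \<le> 1 / 4\<close> by simp
    ultimately show ?thesis by (simp add: g_def u_def)
  qed
  moreover have "g 1 \<ge> 0"
  proof -
    have y: "yfun 1 > 0" "yfun 1 * (1 + yfun 1) = 1"
      using yfun_pos[of 1] yfun_eq[of 1] by auto
    have "ln (inverse (1 + yfun 1)) \<le> inverse (1 + yfun 1) - 1"
      using y by (intro ln_le_minus_one) auto
    moreover have "inverse (1 + yfun 1) = yfun 1"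
      using y by (simp add: field_simps)
    moreover have "ln (inverse (1 + yfun 1)) = - ln (1 + yfun 1)"
      by (rule ln_inverse)
    ultimately have "ln (1 + yfun 1) \<ge> 1 - yfun 1"
      by linarith
    moreover have "(yfun 1)\<^sup>2 = 1 - yfun 1" using y(2) by (simp add: power2_eq_square algebra_simps)
    moreover have "yfun 1 \<le> 1"
      using y by (smt (verit) mult_less_cancel_left2)
    ultimately show ?thesis by (simp add: g_def ffun_def Qfun_def)
  qed
  moreover have "\<forall>x. exp (- 2) \<le> x \<and> x \<le> 1 \<longrightarrow> isCont g x"
  proof (intro allI impI)
    fix x :: real assume "exp (- 2) \<le> x \<and> x \<le> 1"
    then have "x > 0" using exp_gt_zero[of "- 2 :: real"] by linarith
    then show "isCont g x" using der DERIV_isCont by blast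
  qed
  ultimately obtain u where "exp (- 2) \<le> u" "u \<le> 1" "g u = 0"
    using IVT[of g "exp (- 2)" 0 1] by auto
  then have u: "u \<in> {0<..1}" "g u = 0"
    using exp_gt_zero[of "- 2 :: real"] by (auto simp del: exp_gt_zero)
  show ?thesis
  proof (rule ex1I[of _ u])
    show "u \<in> {0<..1} \<and> ffun u = Qfun u" using u by (simp add: g_def)
  next
    fix v assume v: "v \<in> {0<..1} \<and> ffun v = Qfun v"
    then have "g v = 0" by (simp add: g_def)
    then show "v = u" using incr[of u v] incr[of v u] u v
      by (cases u v rule: linorder_cases) auto
  qed
qed

end

theory Submission
  imports Defs "HOL-Number_Theory.Number_Theory" "HOL-Analysis.Summation_Tests" "HOL-Analysis.Convex"
begin

text \<open>
  Write \<open>b\<close> for \<^const>\<open>beta\<close>, \<open>y\<close> for \<open>yfun b\<close> and \<open>L\<close> for \<open>ln (ln N)\<close>, and recall that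
  \<open>y * (1 + y) = b\<close> and \<open>eta = 2 b ln (1 + y) - y\<^sup>2 = b ln b - b + 1\<close>. Both quadratic forms reward a vector for
  sitting on integers with few common factors, and there are two ways to pay. Integers with fewer than \<open>b L\<close>
  prime factors are rare: their density is about \<open>(ln N) powr - eta\<close>, so the diagonal of the form is large. Integers
  with more prime factors share many divisors, so the off-diagonal part is large. The number \<open>b\<close> is where the two
  costs agree.

  \<^emph>\<open>Lower bound.\<close> Split a vector \<open>c\<close> of norm 1 according to the number \<open>\<omega> n\<close> of distinct prime
  factors. On \<open>\<omega> n < b L\<close> the Cauchy-Schwarz inequality and the diagonal terms suffice, with the count of such
  \<open>n\<close> bounded by the mean value of \<open>b ^ \<omega> n\<close> (lemmas \<open>sum_weighted_le_sum_recip\<close> and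
  \<open>sum_recip_weighted_le\<close>). On \<open>\<omega> n \<ge> b L\<close> use that \<open>gcd m n\<close> is at least the sum of
  \<open>\<Prod>p\<in>A. p - 1\<close> over the sets \<open>A\<close> of common primes; a Cauchy-Schwarz inequality over \<open>A\<close> with weights
  \<open>y ^ card A\<close> then bounds \<open>\<Sum>n. c n * (1 + y) ^ \<omega> n\<close> (lemma \<open>gcd_form_ge_weighted_sum\<close>). The choice
  of \<open>y\<close> minimises the resulting exponent, and both parts give \<open>(ln N) powr eta\<close>.

  \<^emph>\<open>Upper bound.\<close> The test vector lives on integers \<open>p * r\<close> close to \<open>N\<close>, where \<open>p\<close> is a large prime
  and \<open>r\<close> has exactly \<open>k\<close> prime factors, \<open>k\<close> being about \<open>b L\<close>. Cut the primes into \<open>k\<close> consecutive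
  blocks, on each of which the reciprocals sum to about \<open>1 / b\<close>, and require \<open>r\<close> to have at most \<open>j\<close> prime
  factors in the first \<open>j\<close> blocks, for every \<open>j\<close>. This ballot condition is what makes the form small at every
  scale: if two such \<open>r = d u\<close> and \<open>r' = d v\<close> have comparable size with \<open>u\<close>, \<open>v\<close> composed of primes from
  the first \<open>j\<close> blocks, then the contributions of all \<open>j\<close> carry the same power of \<open>ln N\<close>, again because the
  two expressions for \<open>eta\<close> agree (lemma \<open>beta_identity\<close>).

  Counting \<open>r\<close> as a multiset of primes with the weight \<open>\<Prod> (1/p) ^ v / v!\<close> turns all sums over integers into
  exact exponentials. In particular the total weight of the ballot multisets has the closed form of Abel's
  identity (lemma \<open>sum_poisson_weight_ballot\<close>); it is smaller than its exponential order \<open>(exp 1 / b) ^ k\<close>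
  by a factor \<open>k powr (3/2)\<close>, which enters the form squared and is the source of \<open>L ^ 3\<close>. Nothing more is lost in the numerator:
  at scale \<open>j\<close> the local bound for the Poisson distribution saves the factors \<open>sqrt (k - j)\<close> and
  \<open>sqrt j\<close>, and \<open>\<Sum>j\<le>k. 1 / sqrt ((j + 1) * (k - j + 1))\<close> is bounded (lemma
  \<open>sum_close_gcd_le\<close>).
\<close>

section \<open>The theorems of Chebyshev and Mertens\<close>

abbreviation \<Lambda> :: "nat \<Rightarrow> real" where "\<Lambda> \<equiv> mangoldt"

definition \<psi> :: "nat \<Rightarrow> real" where "\<psi> n = (\<Sum>d\<in>{1..n}. \<Lambda> d)"

lemma Lambda_nonneg: "\<Lambda> d \<ge> 0"
  by (simp add: mangoldt_nonneg)

lemma ln_eq_sum_Lambda: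
  assumes "n > 0" "n \<le> N"
  shows "ln (real n) = (\<Sum>d\<in>{1..N}. if d dvd n then \<Lambda> d else 0)"
proof -
  have "(\<Sum>d\<in>{1..N}. if d dvd n then \<Lambda> d else 0) = (\<Sum>d\<in>{d\<in>{1..N}. d dvd n}. \<Lambda> d)"
    by (rule sum.inter_filter[symmetric]) simp
  also have "{d\<in>{1..N}. d dvd n} = {d. d dvd n}"
    using assms by (auto simp: Suc_le_eq dest: dvd_imp_le intro: Nat.gr0I)
  finally show ?thesis using mangoldt_sum[of n, where ?'a = real] assms by (simp add:)
qed

lemma multiples_eq_image: "{n\<in>{1..N}. d dvd n} = (\<lambda>k. d * k) ` {1..N div d}" if "d > 0" for d N :: nat
proof (intro equalityI subsetI)
  fix n assume "n \<in> {n\<in>{1..N}. d dvd n}"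
  then obtain k where "n = d * k" "n \<ge> 1" "n \<le> N" by auto
  then have "k \<in> {1..N div d}" using that
    by (auto simp: less_eq_div_iff_mult_less_eq mult.commute Suc_le_eq intro: Nat.gr0I)
  then show "n \<in> (\<lambda>k. d * k) ` {1..N div d}" using \<open>n = d * k\<close> by auto
next
  fix n assume "n \<in> (\<lambda>k. d * k) ` {1..N div d}"
  then show "n \<in> {n\<in>{1..N}. d dvd n}" using that
    by (auto simp: less_eq_div_iff_mult_less_eq mult.commute Suc_le_eq)
qed

lemma card_multiples: "card {n\<in>{1..N}. d dvd n} = N div d" if "d > 0" for d N :: nat
proof -
  have "inj_on (\<lambda>k. d * k) {1..N div d}" using that by (auto simp: inj_on_def)
  then show ?thesis unfolding multiples_eq_image[OF that] by (simp add: card_image)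
qed

lemma ln_fact_eq_sum_Lambda:
  assumes "n \<le> N"
  shows "ln (fact n) = (\<Sum>d\<in>{1..N}. \<Lambda> d * real (n div d))"
proof -
  have "ln (fact n :: real) = (\<Sum>m\<in>{1..n}. ln (real m))"
    by (induction n) (simp_all add: ln_mult)
  also have "\<dots> = (\<Sum>m\<in>{1..n}. \<Sum>d\<in>{1..N}. if d dvd m then \<Lambda> d else 0)"
    by (intro sum.cong refl ln_eq_sum_Lambda) (use assms in auto)
  also have "\<dots> = (\<Sum>d\<in>{1..N}. \<Sum>m\<in>{1..n}. if d dvd m then \<Lambda> d else 0)"
    by (rule sum.swap)
  also have "\<dots> = (\<Sum>d\<in>{1..N}. \<Lambda> d * real (n div d))"
  proof (intro sum.cong refl)
    fix d assume d: "d \<in> {1..N}"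
    have "(\<Sum>m\<in>{1..n}. if d dvd m then \<Lambda> d else 0) = (\<Sum>m\<in>{m\<in>{1..n}. d dvd m}. \<Lambda> d)"
      by (rule sum.inter_filter[symmetric]) simp
    also have "\<dots> = \<Lambda> d * real (n div d)"
      using d by (subst sum_constant, subst card_multiples) auto
    finally show "(\<Sum>m\<in>{1..n}. if d dvd m then \<Lambda> d else 0) = \<Lambda> d * real (n div d)" .
  qed
  finally show ?thesis .
qed

text \<open>The central binomial coefficient is at most \<open>4 ^ n\<close>, and each prime power in \<open>(n, 2 n]\<close> contributes
  to its logarithm.\<close>
lemma psi_double: "\<psi> (2 * n) - \<psi> n \<le> 2 * real n * ln 2"
proof -
  have "(2 * n choose n) \<le> 2 ^ (2 * n)" using binomial_le_pow2 by blast
  then have "real (2 * n choose n) \<le> 2 ^ (2 * n)"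
    by (metis numeral_power_le_of_nat_cancel_iff of_nat_le_iff of_nat_numeral of_nat_power)
  moreover have "real (2 * n choose n) > 0" by simp
  ultimately have "ln (real (2 * n choose n)) \<le> ln (2 ^ (2 * n))" by (subst ln_le_cancel_iff) auto
  also have "\<dots> = 2 * real n * ln 2" by (simp add: ln_realpow)
  finally have 1: "ln (real (2 * n choose n)) \<le> 2 * real n * ln 2" .
  have "real (2 * n choose n) = fact (2 * n) / (fact n * fact n)"
    using binomial_fact[of n "2 * n", where ?'a = real] by (simp add: mult_2)
  then have "ln (real (2 * n choose n)) = ln (fact (2 * n)) - 2 * ln (fact n)"
    by (simp add: ln_div ln_mult)
  also have "\<dots> = (\<Sum>d\<in>{1..2*n}. \<Lambda> d * (real (2 * n div d) - 2 * real (n div d)))"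
    by (simp add: ln_fact_eq_sum_Lambda[of _ "2 * n"] sum_distrib_left sum_subtractf algebra_simps)
  also have "\<dots> \<ge> (\<Sum>d\<in>{1..2*n}. if d > n then \<Lambda> d else 0)"
  proof (intro sum_mono)
    fix d assume d: "d \<in> {1..2*n}"
    have "2 * (n div d) \<le> 2 * n div d"
    proof -
      have "2 * (n div d) * d \<le> 2 * n"
        using div_times_less_eq_dividend[of n d] by linarith
      then show ?thesis using d by (subst less_eq_div_iff_mult_less_eq) auto
    qed
    then have "real (2 * n div d) - 2 * real (n div d) \<ge> 0" by linarith
    moreover have "real (2 * n div d) - 2 * real (n div d) \<ge> 1" if "d > n"
    proof -
      have "2 * n div d \<ge> 1" using d by (simp add: less_eq_div_iff_mult_less_eq)
      then show ?thesis using that by simp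
    qed
    ultimately show "(if d > n then \<Lambda> d else 0) \<le> \<Lambda> d * (real (2 * n div d) - 2 * real (n div d))"
      using Lambda_nonneg[of d] by (auto simp: mult_le_cancel_left1)
  qed
  moreover have "(\<Sum>d\<in>{1..2*n}. if d > n then \<Lambda> d else 0) = \<psi> (2 * n) - \<psi> n"
  proof -
    have eq: "{1..2*n} = {1..n} \<union> {d\<in>{1..2*n}. d > n}" by auto
    have "\<psi> (2 * n) = sum \<Lambda> ({1..n} \<union> {d\<in>{1..2*n}. d > n})"
      unfolding \<psi>_def by (rule arg_cong[OF eq])
    also have "\<dots> = \<psi> n + (\<Sum>d\<in>{d\<in>{1..2*n}. d > n}. \<Lambda> d)"
      unfolding \<psi>_def by (rule sum.union_disjoint) auto
    also have "(\<Sum>d\<in>{d\<in>{1..2*n}. d > n}. \<Lambda> d) = (\<Sum>d\<in>{1..2*n}. if d > n then \<Lambda> d else 0)"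
      by (rule sum.inter_filter) simp
    finally show ?thesis by simp
  qed
  ultimately show ?thesis using 1 by linarith
qed

lemma psi_mono: "m \<le> n \<Longrightarrow> \<psi> m \<le> \<psi> n"
  unfolding \<psi>_def by (intro sum_mono2) (auto simp: Lambda_nonneg)

text \<open>Chebyshev's bound: halving \<open>n\<close> repeatedly in the previous estimate gives a geometric series.\<close>
lemma psi_le: "\<psi> n \<le> 6 * real n"
proof (induction n rule: less_induct)
  case (less n)
  show ?case
  proof (cases "n \<le> 1")
    case True
    then have "n = 0 \<or> n = 1" by auto
    then show ?thesis by (auto simp: \<psi>_def)
  next
    case False
    \<comment> \<open>The constant 6 works as \<open>\<psi> n \<le> \<psi> m + 2 m \<le> 8 m \<le> 4 (n + 1) \<le> 6 n\<close>.\<close>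
    define m where "m = (n + 1) div 2"
    have m: "m < n" "n \<le> 2 * m" "2 * m \<le> n + 1" using False by (auto simp: m_def)
    have "\<psi> n \<le> \<psi> (2 * m)" using m by (intro psi_mono) auto
    also have "\<dots> \<le> \<psi> m + 2 * real m * ln 2" using psi_double[of m] by simp
    also have "\<dots> \<le> 6 * real m + 2 * real m * 1"
      using less[OF m(1)] ln_add_one_self_le_self[of 1] by (intro add_mono mult_left_mono) auto
    also have "\<dots> \<le> 8 * real m" by simp
    also have "\<dots> \<le> 4 * (real n + 1)" using of_nat_mono[OF m(3), where ?'a = real] by simp
    also have "\<dots> \<le> 6 * real n" using False by simp
    finally show ?thesis .
  qed
qed

lemma ln_fact_bounds:
  "ln (fact n) \<le> real n * ln (real n)" "ln (fact n) \<ge> real n * ln (real n) - real n"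
proof -
  show "ln (fact n) \<le> real n * ln (real n)"
  proof (cases "n = 0")
    case False
    have "fact n \<le> (real n) ^ n" using fact_le_power[of n, where ?'a = real] by simp
    then have "ln (fact n) \<le> ln (real n ^ n)" using False by (subst ln_le_cancel_iff) auto
    then show ?thesis using False by (simp add: ln_realpow)
  qed simp
  show "ln (fact n) \<ge> real n * ln (real n) - real n"
  proof (induction n)
    case 0
    show ?case by simp
  next
    case (Suc n)
    show ?case
    proof (cases "n = 0")
      case True
      then show ?thesis by simp
    next
      case False
      have "ln (real (Suc n)) - ln (real n) \<le> (real (Suc n) - real n) / real n"
        using False by (intro ln_diff_le) auto
      then have "real n * (ln (real (Suc n)) - ln (real n)) \<le> 1"
        using False by (simp add: field_simps)
      moreover have "ln (fact (Suc n)) = ln (real (Suc n)) + ln (fact n)"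
        unfolding fact_Suc by (subst ln_mult) auto
      moreover have "real (Suc n) * ln (real (Suc n)) - real (Suc n) =
          real n * (ln (real (Suc n)) - ln (real n)) + real n * ln (real n) + ln (real (Suc n)) - real n - 1"
        unfolding of_nat_Suc by (simp only: ring_distribs)
      ultimately show ?thesis using Suc by linarith
    qed
  qed
qed

text \<open>Mertens' estimate for the von Mangoldt function: compare \<open>ln (n!)\<close> with
  \<open>\<Sum>d. \<Lambda> d * (n div d)\<close>; replacing \<open>n div d\<close> by \<open>n / d\<close> costs at most \<open>\<psi> n\<close>.\<close>
lemma mertens_Lambda:
  assumes "n \<ge> 1"
  shows "\<bar>(\<Sum>d\<in>{1..n}. \<Lambda> d / real d) - ln (real n)\<bar> \<le> 6"
proof -
  define s where "s = (\<Sum>d\<in>{1..n}. \<Lambda> d / real d)"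
  have f: "ln (fact n) = (\<Sum>d\<in>{1..n}. \<Lambda> d * real (n div d))"
    by (rule ln_fact_eq_sum_Lambda) simp
  have ub: "ln (fact n) \<le> real n * s"
    unfolding f s_def sum_distrib_left
  proof (intro sum_mono)
    fix d assume "d \<in> {1..n}"
    have "real (n div d) \<le> real n / real d" by (simp add: of_nat_div_le_of_nat)
    then have "\<Lambda> d * real (n div d) \<le> \<Lambda> d * (real n / real d)"
      by (intro mult_left_mono Lambda_nonneg)
    then show "\<Lambda> d * real (n div d) \<le> real n * (\<Lambda> d / real d)"
      by (simp add: mult.commute)
  qed
  have "real n * s - \<psi> n \<le> ln (fact n)"
    unfolding f s_def sum_distrib_left \<psi>_def sum_subtractf[symmetric]
  proof (intro sum_mono)
    fix d assume "d \<in> {1..n}"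
    then have d: "d > 0" by simp
    have "n \<le> (n div d + 1) * d"
      using dividend_less_times_div[OF d, of n] by (simp add: mult.commute)
    then have "real n \<le> real ((n div d + 1) * d)" by (rule of_nat_mono)
    then have "real n \<le> (real (n div d) + 1) * real d" by (simp add: ring_distribs)
    then have "real n / real d \<le> real (n div d) + 1"
      using d by (subst pos_divide_le_eq) auto
    then have "real n / real d - 1 \<le> real (n div d)" by linarith
    then have "\<Lambda> d * (real n / real d - 1) \<le> \<Lambda> d * real (n div d)"
      by (intro mult_left_mono Lambda_nonneg)
    then show "real n * (\<Lambda> d / real d) - \<Lambda> d \<le> \<Lambda> d * real (n div d)" by (simp add: algebra_simps)
  qed
  then have "real n * s \<le> real n * (ln (real n) + 6)"
    using ln_fact_bounds(1)[of n] psi_le[of n] by (simp add: algebra_simps)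
  then have "s \<le> ln (real n) + 6" using assms by simp
  moreover have "real n * (ln (real n) - 1) \<le> real n * s"
    using ub ln_fact_bounds(2)[of n] by (simp add: algebra_simps)
  then have "ln (real n) - 1 \<le> s" using assms by simp
  ultimately show ?thesis unfolding s_def by linarith
qed


abbreviation primes_le :: "nat \<Rightarrow> nat set" where
  "primes_le n \<equiv> {p\<in>{1..n}. prime p}"

lemma ln_le_2_sqrt: "ln x \<le> 2 * sqrt x" if "x > 0" for x :: real
proof -
  have "ln (sqrt x) \<le> sqrt x - 1" using that by (intro ln_le_minus_one) auto
  then show ?thesis using that by (simp add: ln_sqrt)
qed

lemma summable_ln_over_square: "summable (\<lambda>m. ln (real m) / (real m)\<^sup>2)"
proof (rule summable_comparison_test)
  show "summable (\<lambda>m. 2 * real m powr (-3/2))"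
    by (intro summable_mult) (subst summable_real_powr_iff, simp)
  show "\<exists>N. \<forall>m\<ge>N. norm (ln (real m) / (real m)\<^sup>2) \<le> 2 * real m powr (-3/2)"
  proof (intro exI[of _ 1] allI impI)
    fix m :: nat assume m: "1 \<le> m"
    have "real m powr (1/2 - 2) = real m powr (1/2) / real m powr 2"
      by (rule powr_diff)
    then have eq: "real m powr (-3/2) = sqrt (real m) / (real m)\<^sup>2"
      using m by (simp add: powr_half_sqrt)
    have "ln (real m) / (real m)\<^sup>2 \<le> 2 * sqrt (real m) / (real m)\<^sup>2"
      using m ln_le_2_sqrt[of "real m"] by (intro divide_right_mono) auto
    then show "norm (ln (real m) / (real m)\<^sup>2) \<le> 2 * real m powr (-3/2)"
      unfolding eq using m by simp
  qed
qed

lemma sum_geometric_tail_le: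
  fixes q :: real
  assumes "q \<ge> 2"
  shows "(\<Sum>k\<in>{2..n}. 1 / q ^ k) \<le> 2 / q\<^sup>2"
proof -
  have "(\<Sum>k\<in>{2..n}. 1 / q ^ k) \<le> 2 / q\<^sup>2 - (1 / q ^ n) * (if n \<ge> 2 then 1 else 0)"
  proof (induction n)
    case (Suc n)
    show ?case
    proof (cases "n \<ge> 2")
      case True
      have "{2..Suc n} = insert (Suc n) {2..n}" using True by auto
      then have "(\<Sum>k\<in>{2..Suc n}. 1 / q ^ k) = 1 / q ^ Suc n + (\<Sum>k\<in>{2..n}. 1 / q ^ k)" by simp
      also have "\<dots> \<le> 1 / q ^ Suc n + (2 / q\<^sup>2 - 1 / q ^ n)" using Suc True by simp
      also have "\<dots> \<le> 2 / q\<^sup>2 - 1 / q ^ Suc n"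
      proof -
        have "2 / q ^ Suc n \<le> 1 / q ^ n" using assms by (simp add: field_simps)
        then show ?thesis by simp
      qed
      finally show ?thesis using True by simp
    next
      case False
      then have "Suc n < 2 \<or> n = 1" by auto
      then show ?thesis by (auto simp: power2_eq_square)
    qed
  qed auto
  also have "\<dots> \<le> 2 / q\<^sup>2" using assms by simp
  finally show ?thesis .
qed

text \<open>The proper prime powers contribute \<open>O (\<Sum>p. ln p / p\<^sup>2)\<close>, which converges.\<close>
lemma sum_Lambda_nonprime_bounded: "\<exists>C\<ge>0. \<forall>n. (\<Sum>d\<in>{d\<in>{1..n}. \<not> prime d}. \<Lambda> d / real d) \<le> C"
proof (intro exI conjI allI)
  define C where "C = (\<Sum>m. 2 * (ln (real m) / (real m)\<^sup>2))"
  have nn: "ln (real m) / (real m)\<^sup>2 \<ge> 0" for m by (cases "m = 0") auto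
  have sm: "summable (\<lambda>m. 2 * (ln (real m) / (real m)\<^sup>2))"
    by (intro summable_mult summable_ln_over_square)
  show "C \<ge> 0" unfolding C_def by (intro suminf_nonneg sm mult_nonneg_nonneg nn) auto
  fix n
  let ?I = "primes_le n \<times> {2..n}"
  have "(\<Sum>d\<in>{d\<in>{1..n}. \<not> prime d}. \<Lambda> d / real d) =
      (\<Sum>d\<in>{d\<in>{1..n}. primepow d \<and> \<not> prime d}. \<Lambda> d / real d)"
    by (intro sum.mono_neutral_right) (auto simp: mangoldt_def)
  also have "\<dots> \<le> (\<Sum>d\<in>(\<lambda>(p,k). p ^ k) ` ?I. \<Lambda> d / real d)"
  proof (intro sum_mono2)
    show "{d\<in>{1..n}. primepow d \<and> \<not> prime d} \<subseteq> (\<lambda>(p,k). p ^ k) ` ?I"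
    proof
      fix d assume d: "d \<in> {d\<in>{1..n}. primepow d \<and> \<not> prime d}"
      then obtain p k where pk: "prime p" "k > 0" "d = p ^ k" unfolding primepow_def by auto
      then have "k \<noteq> 1" using d by auto
      have "p \<ge> 2" using pk prime_ge_2_nat by blast
      have "k < 2 ^ k" by simp
      also have "\<dots> \<le> p ^ k" using \<open>p \<ge> 2\<close> by (intro power_mono) auto
      finally have "k \<le> n" using d pk by simp
      have "p ^ 1 \<le> p ^ k" using pk \<open>p \<ge> 2\<close> by (intro power_increasing) auto
      then have "p \<le> n" using d pk by simp
      then have "(p, k) \<in> ?I" using pk \<open>k \<noteq> 1\<close> \<open>k \<le> n\<close> \<open>p \<ge> 2\<close> by auto
      then show "d \<in> (\<lambda>(p,k). p ^ k) ` ?I" using pk by force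
    qed
  qed (auto simp: Lambda_nonneg)
  also have "\<dots> \<le> (\<Sum>x\<in>?I. \<Lambda> ((\<lambda>(p,k). p ^ k) x) / real ((\<lambda>(p,k). p ^ k) x))"
    by (intro sum_image_le[unfolded o_def]) (auto simp: Lambda_nonneg)
  also have "\<dots> = (\<Sum>(p,k)\<in>?I. \<Lambda> (p ^ k) / real (p ^ k))"
    by (simp add: case_prod_unfold)
  also have "\<dots> = (\<Sum>p\<in>primes_le n. \<Sum>k\<in>{2..n}. \<Lambda> (p ^ k) / real (p ^ k))"
    by (rule sum.cartesian_product[symmetric])
  also have "\<dots> = (\<Sum>p\<in>primes_le n. ln (real p) * (\<Sum>k\<in>{2..n}. 1 / real p ^ k))"
    unfolding sum_distrib_left by (intro sum.cong refl) auto
  also have "\<dots> \<le> (\<Sum>p\<in>primes_le n. ln (real p) * (2 / (real p)\<^sup>2))"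
  proof (intro sum_mono mult_left_mono sum_geometric_tail_le)
    fix p assume "p \<in> primes_le n"
    then show "real p \<ge> 2" using prime_ge_2_nat[of p] by simp
    then show "ln (real p) \<ge> 0" by simp
  qed
  also have "\<dots> = (\<Sum>p\<in>primes_le n. 2 * (ln (real p) / (real p)\<^sup>2))"
    by (simp add: mult.commute)
  also have "\<dots> \<le> C" unfolding C_def by (intro sum_le_suminf sm mult_nonneg_nonneg nn) auto
  finally show "(\<Sum>d\<in>{d\<in>{1..n}. \<not> prime d}. \<Lambda> d / real d) \<le> C" .
qed

abbreviation ln_prime_sum :: "nat \<Rightarrow> real" where
  "ln_prime_sum n \<equiv> \<Sum>p\<in>primes_le n. ln (real p) / real p"

text \<open>Mertens' first theorem, by discarding the proper prime powers.\<close>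
lemma mertens_first:
  "\<exists>C>0. \<forall>n\<ge>1. \<bar>ln_prime_sum n - ln (real n)\<bar> \<le> C"
proof -
  obtain C where C: "C \<ge> 0" "\<And>n. (\<Sum>d\<in>{d\<in>{1..n}. \<not> prime d}. \<Lambda> d / real d) \<le> C"
    using sum_Lambda_nonprime_bounded by blast
  show ?thesis
  proof (intro exI[of _ "C + 6"] conjI allI impI)
    show "C + 6 > 0" using C by simp
    fix n :: nat assume n: "n \<ge> 1"
    have eq: "{1..n} = primes_le n \<union> {d\<in>{1..n}. \<not> prime d}" by auto
    have "(\<Sum>d\<in>{1..n}. \<Lambda> d / real d) =
        (\<Sum>d\<in>primes_le n \<union> {d\<in>{1..n}. \<not> prime d}. \<Lambda> d / real d)"
      by (rule arg_cong[OF eq])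
    also have "\<dots> = (\<Sum>d\<in>primes_le n. \<Lambda> d / real d) + (\<Sum>d\<in>{d\<in>{1..n}. \<not> prime d}. \<Lambda> d / real d)"
      by (rule sum.union_disjoint) auto
    also have "(\<Sum>d\<in>primes_le n. \<Lambda> d / real d) = ln_prime_sum n"
      by (intro sum.cong refl) auto
    finally have "(\<Sum>d\<in>{1..n}. \<Lambda> d / real d) = ln_prime_sum n
        + (\<Sum>d\<in>{d\<in>{1..n}. \<not> prime d}. \<Lambda> d / real d)" .
    moreover have "(\<Sum>d\<in>{d\<in>{1..n}. \<not> prime d}. \<Lambda> d / real d) \<ge> 0"
      by (intro sum_nonneg) (auto simp: Lambda_nonneg)
    ultimately show "\<bar>ln_prime_sum n - ln (real n)\<bar> \<le> C + 6"
      using mertens_Lambda[OF n] C(2)[of n] unfolding abs_le_iff by linarith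
  qed
qed

definition prime_recip_sum :: "nat \<Rightarrow> real" where
  "prime_recip_sum n = (\<Sum>p\<in>primes_le n. 1 / real p)"

lemma sum_primes_le_Suc:
  "(\<Sum>p\<in>primes_le (Suc n). f p) = (\<Sum>p\<in>primes_le n. f p) + (if prime (Suc n) then f (Suc n) else (0::real))"
proof -
  have "primes_le (Suc n) = (if prime (Suc n) then insert (Suc n) (primes_le n) else primes_le n)"
    by (auto simp: le_Suc_eq)
  then show ?thesis by (auto simp: add.commute)
qed

text \<open>Mertens' second theorem up to a bounded error. Partial summation from the first theorem: the increments of
  \<open>prime_recip_sum n - A n / ln n\<close> are \<open>A n * (1 / ln n - 1 / ln (n + 1))\<close>, and with \<open>A n = ln n + O(1)\<close>
  these telescope to \<open>ln (ln n)\<close>.\<close>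
lemma mertens_second:
  "\<exists>M>0. \<forall>n\<ge>2. \<bar>prime_recip_sum n - ln (ln (real n))\<bar> \<le> M"
proof -
  define A where "A = (\<lambda>n. \<Sum>p\<in>primes_le n. ln (real p) / real p)"
  obtain C where C: "C > 0" "\<And>n. n \<ge> 1 \<Longrightarrow> \<bar>A n - ln (real n)\<bar> \<le> C"
    using mertens_first unfolding A_def by blast
  define S where "S = prime_recip_sum"
  have SSuc: "S (Suc n) = S n + (A (Suc n) - A n) / ln (real (Suc n))" if "n \<ge> 1" for n
  proof -
    have "ln (real (Suc n)) > 0" using that by simp
    then show ?thesis unfolding S_def prime_recip_sum_def A_def sum_primes_le_Suc
      by (auto simp del: of_nat_Suc)
  qed
  have main: "S n - A n / ln n \<le> ln (ln n) - ln (ln 2) + C * (1 / ln 2 - 1 / ln n) \<and>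
      S n - A n / ln n \<ge> ln (ln n) - ln (ln 2) - (C + 1) * (1 / ln 2 - 1 / ln n)" if "n \<ge> 2" for n :: nat
    using that
  proof (induction n rule: dec_induct)
    case base
    have "primes_le 2 = {2}" by (auto dest: prime_ge_2_nat)
    then show ?case by (simp add: S_def prime_recip_sum_def A_def)
  next
    case (step n)
    define a b where "a = ln (real n)" and "b = ln (real (Suc n))"
    have ab: "0 < a" "a < b" using step by (auto simp: a_def b_def)
    have "b - a \<le> (real (Suc n) - real n) / real n"
      unfolding a_def b_def using step by (intro ln_diff_le) auto
    also have "\<dots> \<le> 1" using step by simp
    finally have ba: "b - a \<le> 1" .
    define \<delta> where "\<delta> = 1 / a - 1 / b"
    have \<delta>: "\<delta> = (b - a) / (a * b)" "\<delta> \<ge> 0" using ab by (auto simp: \<delta>_def field_simps)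
    have lnab: "ln b - ln a \<le> (b - a) / a" "ln a - ln b \<le> (a - b) / b"
      using ab by (auto intro!: ln_diff_le)
    have "(b - a) / a - (b - a) / b = (b - a) * \<delta>"
      using ab by (simp add: \<delta>_def field_simps)
    also have "\<dots> \<le> 1 * \<delta>" using ba \<delta>(2) by (intro mult_right_mono)
    finally have d1: "(b - a) / b \<ge> ln b - ln a - \<delta>" using lnab(1) by linarith
    have d2: "(b - a) / b \<le> ln b - ln a" using lnab(2) ab by (simp add: diff_divide_distrib)
    have aD: "a * \<delta> = (b - a) / b" using ab by (simp add: \<delta>(1))
    have AB: "A n \<le> a + C" "A n \<ge> a - C" using C(2)[of n] step unfolding a_def abs_le_iff by linarith+
    have "A n * \<delta> \<le> (a + C) * \<delta>" "A n * \<delta> \<ge> (a - C) * \<delta>"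
      using AB \<delta>(2) by (auto intro!: mult_right_mono)
    then have AD: "A n * \<delta> \<le> ln b - ln a + C * \<delta>" "A n * \<delta> \<ge> ln b - ln a - (C + 1) * \<delta>"
      using aD d1 d2 by (simp_all add: ring_distribs)
    have eq: "S (Suc n) - A (Suc n) / b = S n - A n / a + A n * \<delta>"
      using SSuc[of n] step.hyps unfolding b_def[symmetric]
      by (simp add: \<delta>_def diff_divide_distrib right_diff_distrib)
    have IH: "S n - A n / a \<le> ln a - ln (ln 2) + C * (1 / ln 2 - 1 / a)"
       "S n - A n / a \<ge> ln a - ln (ln 2) - (C + 1) * (1 / ln 2 - 1 / a)"
      using step.IH unfolding a_def by auto
    have e1: "C * (1 / ln 2 - 1 / b) = C * (1 / ln 2 - 1 / a) + C * \<delta>"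
      and e2: "(C + 1) * (1 / ln 2 - 1 / b) = (C + 1) * (1 / ln 2 - 1 / a) + (C + 1) * \<delta>"
      by (simp_all add: \<delta>_def algebra_simps)
    show ?case unfolding b_def[symmetric] eq e1 e2 using IH AD by linarith
  qed
  define M where "M = \<bar>ln (ln 2)\<bar> + (C + 1) / ln 2 + (1 + C / ln 2)"
  have l2: "ln 2 > (0::real)" by simp
  show ?thesis
  proof (intro exI[of _ M] conjI allI impI)
    show "M > 0" unfolding M_def using C l2 by (intro add_nonneg_pos add_nonneg_nonneg) (auto intro: add_pos_pos)
    fix n :: nat assume n: "n \<ge> 2"
    define a where "a = ln (real n)"
    have a: "a \<ge> ln 2" unfolding a_def using n by simp
    have "A n \<le> a + C" "A n \<ge> a - C" using C(2)[of n] n unfolding a_def abs_le_iff by linarith+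
    moreover have a0: "a > 0" "a \<noteq> 0" "a \<ge> 0" using a l2 by linarith+
    ultimately have "A n / a \<le> (a + C) / a" "A n / a \<ge> (a - C) / a" by (auto intro!: divide_right_mono)
    moreover have "(a + C) / a = 1 + C / a" "(a - C) / a = 1 - C / a"
      using a0 by (simp_all add: field_simps)
    moreover have "C / a \<le> C / ln 2" using a l2 C a0 by (intro divide_left_mono mult_pos_pos a0(1)) auto
    ultimately have 1: "A n / a \<le> 1 + C / ln 2" "A n / a \<ge> 1 - C / ln 2" by linarith+
    have "1 / a > 0" using a0(1) by simp
    have "C * (1 / ln 2 - 1 / a) \<le> (C + 1) * (1 / ln 2 - 1 / a)"
      using a l2 by (intro mult_right_mono) (auto simp: frac_le)
    moreover have "(C + 1) * (1 / ln 2 - 1 / a) \<le> (C + 1) * (1 / ln 2)"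
      using C \<open>1 / a > 0\<close> by (intro mult_left_mono) auto
    ultimately have 2: "C * (1 / ln 2 - 1 / a) \<le> (C + 1) / ln 2" "(C + 1) * (1 / ln 2 - 1 / a) \<le> (C + 1) / ln 2"
      by simp_all
    show "\<bar>prime_recip_sum n - ln (ln (real n))\<bar> \<le> M"
      using main[OF n] 1 2 unfolding S_def[symmetric] a_def[symmetric] M_def abs_le_iff by linarith
  qed
qed

lemma prime_recip_sum_le_ln: "n \<ge> 1 \<Longrightarrow> prime_recip_sum n \<le> ln (real n)"
proof (induction n rule: dec_induct)
  case base
  have "primes_le 1 = {}" by auto
  then show ?case by (simp add: prime_recip_sum_def)
next
  case (step n)
  have "ln (real n) - ln (real (Suc n)) \<le> (real n - real (Suc n)) / real (Suc n)"
    using step by (intro ln_diff_le) auto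
  then have "1 / real (Suc n) \<le> ln (real (Suc n)) - ln (real n)" by (simp add: field_simps)
  moreover have "1 / real (Suc n) \<ge> 0" by simp
  moreover have "prime_recip_sum (Suc n) = prime_recip_sum n + (if prime (Suc n) then 1 / real (Suc n) else 0)"
    unfolding prime_recip_sum_def sum_primes_le_Suc ..
  ultimately show ?case using step.IH by (smt (verit))
qed

lemma sum_inverse_pred_primes_le:
  "(\<Sum>p\<in>primes_le n. 1 / (real p - 1)) \<le> prime_recip_sum n + 1"
proof -
  have "(\<Sum>p\<in>primes_le n. 1 / (real p - 1)) \<le> prime_recip_sum n + 1 - 1 / real n" if "n \<ge> 1"
    using that
  proof (induction n rule: dec_induct)
    case base
    have "primes_le 1 = {}" by auto
    then show ?case by (simp add: prime_recip_sum_def)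
  next
    case (step n)
    have "1 / (real (Suc n) - 1) = 1 / real (Suc n) + (1 / real n - 1 / real (Suc n))" by simp
    moreover have "1 / real n \<ge> 1 / real (Suc n)" using step by (intro divide_left_mono) auto
    ultimately show ?case using step.IH
      unfolding prime_recip_sum_def sum_primes_le_Suc by (smt (verit))
  qed
  then show ?thesis
    by (cases "n = 0") (auto simp: prime_recip_sum_def intro: order.trans)
qed

section \<open>Mean values of powers of the number of prime factors, and a lower bound for gcd sums\<close>

abbreviation \<omega> :: "nat \<Rightarrow> nat" where "\<omega> n \<equiv> card (prime_factors n)"

lemma prod_one_plus_le_exp_sum:
  fixes f :: "'a \<Rightarrow> real"
  assumes "\<And>x. x \<in> A \<Longrightarrow> f x \<ge> 0"
  shows "(\<Prod>x\<in>A. 1 + f x) \<le> exp (\<Sum>x\<in>A. f x)"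
proof (cases "finite A")
  case True
  have "(\<Prod>x\<in>A. 1 + f x) \<le> (\<Prod>x\<in>A. exp (f x))"
    using assms by (intro prod_mono) (auto intro: add_nonneg_nonneg)
  then show ?thesis using True by (simp add: exp_sum)
qed simp

lemma prod_primes_le:
  "\<exists>C>0. \<forall>N\<ge>2. \<forall>z. 0 \<le> z \<and> z \<le> 1 \<longrightarrow>
     (\<Prod>p\<in>primes_le N. 1 + z / (real p - 1)) \<le> C * ln (real N) powr z"
proof -
  obtain M where M: "M > 0" "\<And>n. n \<ge> 2 \<Longrightarrow> \<bar>prime_recip_sum n - ln (ln (real n))\<bar> \<le> M"
    using mertens_second by blast
  show ?thesis
  proof (intro exI[of _ "exp (M + 1)"] conjI allI impI)
    fix N :: nat and z :: real assume N: "N \<ge> 2" and z: "0 \<le> z \<and> z \<le> 1"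
    have "(\<Prod>p\<in>primes_le N. 1 + z / (real p - 1)) \<le> exp (\<Sum>p\<in>primes_le N. z / (real p - 1))"
      using z by (intro prod_one_plus_le_exp_sum divide_nonneg_nonneg) auto
    also have "(\<Sum>p\<in>primes_le N. z / (real p - 1)) = z * (\<Sum>p\<in>primes_le N. 1 / (real p - 1))"
      by (simp add: sum_distrib_left)
    also have "\<dots> \<le> z * (ln (ln (real N)) + (M + 1))"
      using z sum_inverse_pred_primes_le[of N] M(2)[OF N]
      by (intro mult_left_mono) (auto simp: abs_le_iff)
    also have "\<dots> \<le> z * ln (ln (real N)) + (M + 1)"
      using z M(1) mult_right_mono[of z 1 "M + 1"] by (simp add: distrib_left)
    also have "exp \<dots> = exp (M + 1) * ln (real N) powr z"
      using N by (simp add: exp_add powr_def mult.commute)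
    finally show "(\<Prod>p\<in>primes_le N. 1 + z / (real p - 1)) \<le> exp (M + 1) * ln (real N) powr z" by simp
  qed simp
qed

text \<open>A finite Euler product inequality: adjoin one prime at a time and split off its exact power.\<close>
lemma sum_over_smooth_le:
  fixes b :: real
  assumes "finite F" "\<And>p. p \<in> F \<Longrightarrow> prime p" "b \<ge> 0"
  shows "(\<Sum>n\<in>{n\<in>{1..N}. prime_factors n \<subseteq> F}. b ^ \<omega> n / real n)
           \<le> (\<Prod>p\<in>F. 1 + b / (real p - 1))"
  using assms(1,2)
proof (induction F rule: finite_induct)
  case empty
  have "{n\<in>{1..N}. prime_factors n \<subseteq> {}} \<subseteq> {1}"
    by (auto simp: prime_factorization_empty_iff)
  then have "(\<Sum>n\<in>{n\<in>{1..N}. prime_factors n \<subseteq> {}}. b ^ \<omega> n / real n) \<le>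
      (\<Sum>n\<in>{1::nat}. b ^ \<omega> n / real n)"
    using assms(3) by (intro sum_mono2) auto
  then show ?case by simp
next
  case (insert p F)
  define S where "S = (\<lambda>F. {n\<in>{1..N}. prime_factors n \<subseteq> F})"
  define f where "f = (\<lambda>n. b ^ \<omega> n / real n)"
  define h where "h = (\<lambda>k. if k = 0 then 1 else b / real p ^ k)"
  have p: "prime p" "p \<ge> 2" using insert.prems prime_ge_2_nat by auto
  have f0: "f n \<ge> 0" for n using assms(3) by (simp add: f_def)
  have h0: "h k \<ge> 0" for k using assms(3) by (simp add: h_def)
  \<comment> \<open>Splitting off the exact power of the new prime is injective and multiplies the summands.\<close>
  define dec where "dec = (\<lambda>n. (multiplicity p n, n div p ^ multiplicity p n))"
  have dec: "dec n \<in> {0..N} \<times> S F \<and> f n = h (fst (dec n)) * f (snd (dec n)) \<and>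
      p ^ fst (dec n) * snd (dec n) = n" if n: "n \<in> S (insert p F)" for n
  proof -
    define k where "k = multiplicity p n"
    obtain m where m: "n = p ^ k * m" "\<not> p dvd m"
      using multiplicity_decompose'[of n p] n p unfolding k_def S_def
      by (metis One_nat_def atLeastAtMost_iff mem_Collect_eq not_one_le_zero not_prime_unit)
    have n1: "n \<ge> 1" "n \<le> N" using n by (auto simp: S_def)
    have m0: "m \<noteq> 0" using m n1 by (intro notI) auto
    have nm: "n div p ^ k = m" using m p by simp
    have pf: "prime_factors n = prime_factors (p ^ k) \<union> prime_factors m"
      unfolding m(1) using p m0 by (intro prime_factors_product) auto
    have pk: "prime_factors (p ^ k) = (if k = 0 then {} else {p})"
      using p by (auto simp: prime_factors_power prime_prime_factors)
    have pm: "p \<notin> prime_factors m" using m(2) by auto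
    have "m \<in> S F"
      using n pf pm m0 m(1) n1 p unfolding S_def
      by (auto simp: Suc_le_eq intro: order.trans[of m n N])
    moreover have "k \<le> N"
    proof -
      have "k < 2 ^ k" by simp
      also have "\<dots> \<le> p ^ k" using p by (intro power_mono) auto
      also have "\<dots> \<le> n" using m m0 by simp
      finally show ?thesis using n1 by simp
    qed
    moreover have "f n = h k * f m"
    proof (cases "k = 0")
      case True
      then show ?thesis using m by (simp add: h_def)
    next
      case False
      have "prime_factors n = insert p (prime_factors m)" using pf pk False by auto
      then have "\<omega> n = Suc (\<omega> m)" using pm by simp
      then show ?thesis using False m(1) by (simp add: f_def h_def)
    qed
    ultimately show ?thesis using m(1) nm unfolding dec_def k_def[symmetric] by simp
  qed
  have inj: "inj_on dec (S (insert p F))"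
    by (rule inj_onI) (metis dec)
  have "(\<Sum>n\<in>S (insert p F). f n) = (\<Sum>n\<in>S (insert p F). (\<lambda>(k,m). h k * f m) (dec n))"
    using dec by (intro sum.cong refl) (auto simp: case_prod_unfold)
  also have "\<dots> = (\<Sum>(k,m)\<in>dec ` S (insert p F). h k * f m)"
    using inj by (simp add: sum.reindex)
  also have "\<dots> \<le> (\<Sum>(k,m)\<in>{0..N} \<times> S F. h k * f m)"
  proof (intro sum_mono2)
    show "dec ` S (insert p F) \<subseteq> {0..N} \<times> S F" using dec by blast
  qed (use h0 f0 in \<open>auto simp: S_def\<close>)
  also have "\<dots> = (\<Sum>k\<in>{0..N}. h k) * (\<Sum>m\<in>S F. f m)"
    by (simp add: sum_product sum.cartesian_product)
  also have "\<dots> \<le> (1 + b / (real p - 1)) * (\<Prod>p\<in>F. 1 + b / (real p - 1))"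
  proof (intro mult_mono)
    have "(\<Sum>k\<in>{0..n}. h k) \<le> 1 + b / (real p - 1) * (1 - 1 / real p ^ n)" for n
    proof (induction n)
      case (Suc n)
      have "h (Suc n) = b / (real p - 1) * (1 / real p ^ n - 1 / real p ^ Suc n)"
        using p by (simp add: h_def field_simps)
      moreover have "(\<Sum>k\<in>{0..Suc n}. h k) = (\<Sum>k\<in>{0..n}. h k) + h (Suc n)" by simp
      ultimately show ?case using Suc by (simp add: algebra_simps)
    qed (simp add: h_def)
    from this[of N] have "(\<Sum>k\<in>{0..N}. h k) \<le> 1 + b / (real p - 1) * (1 - 1 / real p ^ N)" .
    also have "\<dots> \<le> 1 + b / (real p - 1) * 1"
      using p assms(3) by (intro add_left_mono mult_left_mono divide_nonneg_nonneg) auto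
    finally show "(\<Sum>k\<in>{0..N}. h k) \<le> 1 + b / (real p - 1)" by simp
    show "(\<Sum>m\<in>S F. f m) \<le> (\<Prod>p\<in>F. 1 + b / (real p - 1))"
      using insert unfolding S_def f_def by auto
    show "0 \<le> 1 + b / (real p - 1)" using p assms(3) by (intro add_nonneg_nonneg) auto
    show "0 \<le> (\<Sum>m\<in>S F. f m)" by (intro sum_nonneg f0)
  qed
  also have "\<dots> = (\<Prod>p\<in>insert p F. 1 + b / (real p - 1))"
    using insert by simp
  finally show ?case unfolding S_def f_def .
qed

lemma sum_recip_weighted_le:
  "\<exists>C>0. \<forall>N\<ge>2. \<forall>b. 0 \<le> b \<and> b \<le> 1 \<longrightarrow>
     (\<Sum>n\<in>{1..N}. b ^ \<omega> n / real n) \<le> C * ln (real N) powr b"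
proof -
  obtain C where C: "C > 0" "\<And>N z. N \<ge> 2 \<Longrightarrow> 0 \<le> z \<and> z \<le> 1 \<Longrightarrow>
     (\<Prod>p\<in>primes_le N. 1 + z / (real p - 1)) \<le> C * ln (real N) powr z"
    using prod_primes_le by blast
  show ?thesis
  proof (intro exI[of _ C] conjI allI impI C(1))
    fix N :: nat and b :: real assume N: "N \<ge> 2" and b: "0 \<le> b \<and> b \<le> 1"
    have "prime_factors n \<subseteq> primes_le N" if "n \<in> {1..N}" for n
    proof
      fix p assume p: "p \<in> prime_factors n"
      then have "p \<le> n" using that by (intro dvd_imp_le) auto
      moreover have "p \<ge> 1" using p prime_ge_1_nat by blast
      ultimately show "p \<in> primes_le N" using p that by auto
    qed
    then have "{1..N} = {n\<in>{1..N}. prime_factors n \<subseteq> primes_le N}" by blast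
    then have "(\<Sum>n\<in>{1..N}. b ^ \<omega> n / real n) =
      (\<Sum>n\<in>{n\<in>{1..N}. prime_factors n \<subseteq> primes_le N}. b ^ \<omega> n / real n)"
      by (rule arg_cong)
    also have "\<dots> \<le> (\<Prod>p\<in>primes_le N. 1 + b / (real p - 1))"
      using b by (intro sum_over_smooth_le) auto
    also have "\<dots> \<le> C * ln (real N) powr b" using C(2) N b by blast
    finally show "(\<Sum>n\<in>{1..N}. b ^ \<omega> n / real n) \<le> C * ln (real N) powr b" .
  qed
qed

text \<open>The Hall-Tenenbaum device: insert \<open>ln n = (\<Sum>d | d dvd n. \<Lambda> d)\<close>, write \<open>n = d m\<close>, and apply
  Chebyshev's bound to the sum over \<open>d\<close>. The number of distinct prime factors does not decrease from \<open>m\<close> to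
  \<open>d m\<close>, so the weight does not increase. This gains the factor \<open>ln N\<close> over the trivial bound.\<close>
lemma sum_weighted_le_sum_recip:
  assumes "0 \<le> b" "b \<le> 1" "N \<ge> 2"
  shows "ln (real N) * (\<Sum>n\<in>{1..N}. b ^ \<omega> n)
     \<le> 7 * real N * (\<Sum>n\<in>{1..N}. b ^ \<omega> n / real n)"
proof -
  define f where "f = (\<lambda>n::nat. b ^ \<omega> n)"
  have f0: "f n \<ge> 0" for n using assms by (simp add: f_def)
  have fmult: "f (d * m) \<le> f m" if "d > 0" "m > 0" for d m
    unfolding f_def using that assms
    by (intro power_decreasing card_mono) (auto simp: prime_factors_product)
  have "(\<Sum>n\<in>{1..N}. f n * ln (real n)) = (\<Sum>n\<in>{1..N}. \<Sum>d\<in>{1..N}. if d dvd n then \<Lambda> d * f n else 0)"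
  proof (intro sum.cong refl)
    fix n assume n: "n \<in> {1..N}"
    have "ln (real n) = (\<Sum>d\<in>{1..N}. if d dvd n then \<Lambda> d else 0)"
      using n by (intro ln_eq_sum_Lambda) auto
    then show "f n * ln (real n) = (\<Sum>d\<in>{1..N}. if d dvd n then \<Lambda> d * f n else 0)"
      by (auto simp: sum_distrib_left intro!: sum.cong)
  qed
  also have "\<dots> = (\<Sum>d\<in>{1..N}. \<Sum>n\<in>{1..N}. if d dvd n then \<Lambda> d * f n else 0)"
    by (rule sum.swap)
  also have "\<dots> \<le> (\<Sum>d\<in>{1..N}. \<Sum>m\<in>{1..N}. if d \<le> N div m then \<Lambda> d * f m else 0)"
  proof (rule sum_mono)
    fix d assume d: "d \<in> {1..N}"
    have "(\<Sum>n\<in>{1..N}. if d dvd n then \<Lambda> d * f n else 0) = (\<Sum>n\<in>{n\<in>{1..N}. d dvd n}. \<Lambda> d * f n)"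
      by (rule sum.inter_filter[symmetric]) simp
    also have "{n\<in>{1..N}. d dvd n} = (\<lambda>k. d * k) ` {1..N div d}"
      by (rule multiples_eq_image) (use d in auto)
    also have "(\<Sum>n\<in>(\<lambda>k. d * k) ` {1..N div d}. \<Lambda> d * f n) = (\<Sum>m\<in>{1..N div d}. \<Lambda> d * f (d * m))"
      using d by (subst sum.reindex) (auto simp: inj_on_def)
    also have "\<dots> \<le> (\<Sum>m\<in>{1..N div d}. \<Lambda> d * f m)"
      using d by (intro sum_mono mult_left_mono fmult Lambda_nonneg) auto
    also have "\<dots> = (\<Sum>m\<in>{m\<in>{1..N}. d \<le> N div m}. \<Lambda> d * f m)"
    proof (rule sum.cong)
      have "m \<le> N div d \<longleftrightarrow> m \<le> N \<and> d \<le> N div m" if "m \<ge> 1" for m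
      proof -
        have "m \<le> N div d \<longleftrightarrow> d \<le> N div m"
          using d that by (simp add: less_eq_div_iff_mult_less_eq mult.commute)
        then show ?thesis using div_le_dividend[of N d] by linarith
      qed
      then show "{1..N div d} = {m\<in>{1..N}. d \<le> N div m}" by auto
    qed simp
    also have "\<dots> = (\<Sum>m\<in>{1..N}. if d \<le> N div m then \<Lambda> d * f m else 0)"
      by (rule sum.inter_filter) simp
    finally show "(\<Sum>n\<in>{1..N}. if d dvd n then \<Lambda> d * f n else 0)
      \<le> (\<Sum>m\<in>{1..N}. if d \<le> N div m then \<Lambda> d * f m else 0)" .
  qed
  also have "\<dots> = (\<Sum>m\<in>{1..N}. \<Sum>d\<in>{1..N}. if d \<le> N div m then \<Lambda> d * f m else 0)"
    by (rule sum.swap)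
  also have "\<dots> \<le> (\<Sum>m\<in>{1..N}. 6 * real N * (f m / real m))"
  proof (intro sum_mono)
    fix m assume m: "m \<in> {1..N}"
    have "(\<Sum>d\<in>{1..N}. if d \<le> N div m then \<Lambda> d * f m else 0) = (\<Sum>d\<in>{d\<in>{1..N}. d \<le> N div m}. \<Lambda> d * f m)"
      by (rule sum.inter_filter[symmetric]) simp
    also have "{d\<in>{1..N}. d \<le> N div m} = {1..N div m}"
      by (auto intro: order.trans[OF _ div_le_dividend])
    also have "(\<Sum>d\<in>{1..N div m}. \<Lambda> d * f m) = \<psi> (N div m) * f m"
      by (simp add: \<psi>_def sum_distrib_right)
    also have "\<dots> \<le> (6 * real (N div m)) * f m"
      by (intro mult_right_mono psi_le f0)
    also have "\<dots> \<le> (6 * (real N / real m)) * f m"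
      by (intro mult_right_mono mult_left_mono f0 of_nat_div_le_of_nat) auto
    finally show "(\<Sum>d\<in>{1..N}. if d \<le> N div m then \<Lambda> d * f m else 0) \<le> 6 * real N * (f m / real m)"
      by simp
  qed
  finally have 1: "(\<Sum>n\<in>{1..N}. f n * ln (real n)) \<le> 6 * real N * (\<Sum>n\<in>{1..N}. f n / real n)"
    by (simp add: sum_distrib_left)
  have "ln (real N) * (\<Sum>n\<in>{1..N}. f n) \<le> (\<Sum>n\<in>{1..N}. f n * ln (real n) + real N * (f n / real n))"
    unfolding sum_distrib_left
  proof (intro sum_mono)
    fix n assume n: "n \<in> {1..N}"
    have "ln (real N) - ln (real n) \<le> (real N - real n) / real n"
      using n by (intro ln_diff_le) auto
    also have "\<dots> \<le> real N / real n" using n by (intro divide_right_mono) auto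
    finally have "f n * ln (real N) \<le> f n * (ln (real n) + real N / real n)"
      by (intro mult_left_mono f0) auto
    then show "ln (real N) * f n \<le> f n * ln (real n) + real N * (f n / real n)"
      by (simp add: algebra_simps)
  qed
  also have "\<dots> = (\<Sum>n\<in>{1..N}. f n * ln (real n)) + real N * (\<Sum>n\<in>{1..N}. f n / real n)"
    by (simp add: sum.distrib sum_distrib_left)
  also have "\<dots> \<le> 7 * real N * (\<Sum>n\<in>{1..N}. f n / real n)" using 1 by simp
  finally show ?thesis unfolding f_def .
qed


lemma prod_common_primes_le_gcd:
  fixes m n :: nat
  assumes "m > 0" "n > 0"
  shows "(\<Prod>p\<in>prime_factors m \<inter> prime_factors n. p) \<le> gcd m n"
proof -
  have g: "gcd m n > 0" using assms by simp
  have "(\<Prod>p\<in>prime_factors m \<inter> prime_factors n. p) = (\<Prod>p\<in>prime_factors (gcd m n). p)"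
    using assms by simp
  also have "\<dots> \<le> (\<Prod>p\<in>prime_factors (gcd m n). p ^ multiplicity p (gcd m n))"
  proof (intro prod_mono conjI)
    fix p assume p: "p \<in> prime_factors (gcd m n)"
    then have "multiplicity p (gcd m n) \<ge> 1"
      by (simp add: prime_factors_multiplicity Suc_le_eq)
    then have "p ^ 1 \<le> p ^ multiplicity p (gcd m n)"
      using p prime_ge_1_nat[of p] by (intro power_increasing) auto
    then show "p \<le> p ^ multiplicity p (gcd m n)" by simp
  qed simp
  also have "\<dots> = gcd m n" by (rule prime_factorization_nat[OF g, symmetric])
  finally show ?thesis .
qed

abbreviation gcd_form :: "nat \<Rightarrow> (nat \<Rightarrow> real) \<Rightarrow> real" where
  "gcd_form N c \<equiv> (\<Sum>m\<in>{1..N}. \<Sum>n\<in>{1..N}. real (gcd m n) * c m * c n)"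

text \<open>The left-hand side is the expansion of \<open>\<Prod>p. ((p - 1) + 1)\<close> over the common primes \<open>p\<close>.\<close>
lemma gcd_ge_sum_over_prime_sets:
  assumes "m \<in> {1..N}" "n \<in> {1..N}"
  shows "(\<Sum>A\<in>Pow (primes_le N). if A \<subseteq> prime_factors m \<and> A \<subseteq> prime_factors n
            then (\<Prod>p\<in>A. real p - 1) else 0) \<le> real (gcd m n)"
proof -
  define D where "D = prime_factors m \<inter> prime_factors n"
  have D: "finite D" "D \<subseteq> primes_le N"
  proof -
    show "D \<subseteq> primes_le N"
    proof
      fix p assume p: "p \<in> D"
      then have "p dvd m" "prime p" by (auto simp: D_def)
      then have "p \<le> m" using assms by (intro dvd_imp_le) auto
      then show "p \<in> primes_le N" using assms \<open>prime p\<close> prime_ge_1_nat[of p] by auto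
    qed
  qed (simp add: D_def)
  have "(\<Sum>A\<in>Pow (primes_le N). if A \<subseteq> prime_factors m \<and> A \<subseteq> prime_factors n
            then (\<Prod>p\<in>A. real p - 1) else 0) = (\<Sum>A\<in>{A\<in>Pow (primes_le N). A \<subseteq> D}. \<Prod>p\<in>A. real p - 1)"
    by (subst sum.inter_filter) (auto simp: D_def intro!: sum.cong)
  also have "{A\<in>Pow (primes_le N). A \<subseteq> D} = Pow D" using D by auto
  also have "(\<Sum>A\<in>Pow D. \<Prod>p\<in>A. real p - 1) = (\<Prod>p\<in>D. (real p - 1) + 1)"
    using D by (subst prod_add) auto
  also have "\<dots> = real (\<Prod>p\<in>D. p)" by simp
  also have "\<dots> \<le> real (gcd m n)"
    unfolding D_def using prod_common_primes_le_gcd[of m n] assms by (intro of_nat_mono) auto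
  finally show ?thesis .
qed

text \<open>The lower bound for the gcd is a sum of squares \<open>(\<Sum>n. c n)\<^sup>2\<close>, each over the \<open>n\<close> divisible by all
  primes of a set \<open>A\<close>. The Cauchy-Schwarz inequality over \<open>A\<close> with coefficients \<open>z ^ card A\<close> recombines
  them, since \<open>\<Sum>A\<subseteq>prime_factors n. z ^ card A = (1 + z) ^ \<omega> n\<close>.\<close>
lemma gcd_form_ge_weighted_sum:
  fixes c :: "nat \<Rightarrow> real" and z :: real
  assumes "\<And>n. n \<in> {1..N} \<Longrightarrow> c n \<ge> 0" "z \<ge> 0"
  shows "(\<Sum>n\<in>{1..N}. c n * (1 + z) ^ \<omega> n)\<^sup>2
     \<le> (\<Prod>p\<in>primes_le N. 1 + z\<^sup>2 / (real p - 1)) *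
        gcd_form N c"
proof -
  define P where "P = primes_le N"
  define u where "u = (\<lambda>A. \<Prod>p\<in>A. real p - 1)"
  define C where "C = (\<lambda>A. \<Sum>n\<in>{1..N}. if A \<subseteq> prime_factors n then c n else 0)"
  have finP: "finite P" by (simp add: P_def)
  have u0: "u A > 0" if "A \<subseteq> P" for A
    unfolding u_def using that by (intro prod_pos) (auto simp: P_def dest!: subsetD prime_gt_1_nat)
  have pf: "prime_factors n \<subseteq> P" if "n \<in> {1..N}" for n
  proof
    fix p assume p: "p \<in> prime_factors n"
    then have "p \<le> n" using that by (intro dvd_imp_le) auto
    moreover have "p \<ge> 1" using p prime_ge_1_nat by blast
    ultimately show "p \<in> P" using p that by (auto simp: P_def)
  qed
  have "(\<Sum>n\<in>{1..N}. c n * (1 + z) ^ \<omega> n) = (\<Sum>n\<in>{1..N}. \<Sum>A\<in>Pow P.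
      if A \<subseteq> prime_factors n then c n * z ^ card A else 0)"
  proof (intro sum.cong refl)
    fix n assume n: "n \<in> {1..N}"
    have "(1 + z) ^ \<omega> n = (\<Prod>p\<in>prime_factors n. z + 1)" by (simp add: add.commute)
    also have "\<dots> = (\<Sum>A\<in>Pow (prime_factors n). z ^ card A)"
      by (subst prod_add) auto
    also have "Pow (prime_factors n) = {A\<in>Pow P. A \<subseteq> prime_factors n}" using pf[OF n] by auto
    also have "(\<Sum>A\<in>{A\<in>Pow P. A \<subseteq> prime_factors n}. z ^ card A) =
        (\<Sum>A\<in>Pow P. if A \<subseteq> prime_factors n then z ^ card A else 0)"
      using finP by (intro sum.inter_filter) auto
    finally show "c n * (1 + z) ^ \<omega> n = (\<Sum>A\<in>Pow P.
      if A \<subseteq> prime_factors n then c n * z ^ card A else 0)"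
      by (auto simp: sum_distrib_left intro!: sum.cong)
  qed
  also have "\<dots> = (\<Sum>A\<in>Pow P. \<Sum>n\<in>{1..N}. if A \<subseteq> prime_factors n then c n * z ^ card A else 0)"
    by (rule sum.swap)
  also have "\<dots> = (\<Sum>A\<in>Pow P. (z ^ card A / sqrt (u A)) * (sqrt (u A) * C A))"
  proof (intro sum.cong refl)
    fix A assume A: "A \<in> Pow P"
    have "(z ^ card A / sqrt (u A)) * (sqrt (u A) * C A) = z ^ card A * C A" using u0[of A] A by simp
    then show "(\<Sum>n\<in>{1..N}. if A \<subseteq> prime_factors n then c n * z ^ card A else 0) =
        (z ^ card A / sqrt (u A)) * (sqrt (u A) * C A)"
      by (auto simp: C_def sum_distrib_left intro!: sum.cong)
  qed
  finally have eq: "(\<Sum>n\<in>{1..N}. c n * (1 + z) ^ \<omega> n) =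
    (\<Sum>A\<in>Pow P. (z ^ card A / sqrt (u A)) * (sqrt (u A) * C A))" .
  have "(\<Sum>n\<in>{1..N}. c n * (1 + z) ^ \<omega> n)\<^sup>2 \<le>
     (\<Sum>A\<in>Pow P. (z ^ card A / sqrt (u A))\<^sup>2) * (\<Sum>A\<in>Pow P. (sqrt (u A) * C A)\<^sup>2)"
    unfolding eq by (rule Cauchy_Schwarz_ineq_sum)
  also have "(\<Sum>A\<in>Pow P. (z ^ card A / sqrt (u A))\<^sup>2) = (\<Sum>A\<in>Pow P. (\<Prod>p\<in>A. z\<^sup>2 / (real p - 1)) * (\<Prod>p\<in>P-A. 1))"
  proof (intro sum.cong refl)
    fix A assume A: "A \<in> Pow P"
    have "(z ^ card A / sqrt (u A))\<^sup>2 = (z\<^sup>2) ^ card A / u A"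
      using u0[of A] A by (simp add: power_divide power_mult[symmetric] mult.commute)
    also have "\<dots> = (\<Prod>p\<in>A. z\<^sup>2 / (real p - 1))"
      by (simp add: u_def prod_dividef)
    finally show "(z ^ card A / sqrt (u A))\<^sup>2 = (\<Prod>p\<in>A. z\<^sup>2 / (real p - 1)) * (\<Prod>p\<in>P-A. 1)" by simp
  qed
  also have "\<dots> = (\<Prod>p\<in>P. z\<^sup>2 / (real p - 1) + 1)"
    by (rule prod_add[symmetric]) (rule finP)
  finally have CS: "(\<Sum>n\<in>{1..N}. c n * (1 + z) ^ \<omega> n)\<^sup>2
     \<le> (\<Prod>p\<in>P. z\<^sup>2 / (real p - 1) + 1) * (\<Sum>A\<in>Pow P. (sqrt (u A) * C A)\<^sup>2)" .
  have "(\<Sum>A\<in>Pow P. (sqrt (u A) * C A)\<^sup>2) \<le> gcd_form N c"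
  proof -
    have "(\<Sum>A\<in>Pow P. (sqrt (u A) * C A)\<^sup>2) = (\<Sum>A\<in>Pow P. \<Sum>m\<in>{1..N}. \<Sum>n\<in>{1..N}.
        (if A \<subseteq> prime_factors m \<and> A \<subseteq> prime_factors n then u A else 0) * (c m * c n))"
    proof (intro sum.cong refl)
      fix A assume A: "A \<in> Pow P"
      have "(sqrt (u A) * C A)\<^sup>2 = u A * (C A * C A)"
        using u0[of A] A by (simp add: power_mult_distrib power2_eq_square)
      also have "\<dots> = (\<Sum>m\<in>{1..N}. \<Sum>n\<in>{1..N}.
        (if A \<subseteq> prime_factors m \<and> A \<subseteq> prime_factors n then u A else 0) * (c m * c n))"
      proof -
        have "C A * C A = (\<Sum>m\<in>{1..N}. \<Sum>n\<in>{1..N}.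
            (if A \<subseteq> prime_factors m then c m else 0) * (if A \<subseteq> prime_factors n then c n else 0))"
          unfolding C_def by (rule sum_product)
        then show ?thesis by (auto simp: sum_distrib_left intro!: sum.cong)
      qed
      finally show "(sqrt (u A) * C A)\<^sup>2 = (\<Sum>m\<in>{1..N}. \<Sum>n\<in>{1..N}.
        (if A \<subseteq> prime_factors m \<and> A \<subseteq> prime_factors n then u A else 0) * (c m * c n))" .
    qed
    also have "\<dots> = (\<Sum>m\<in>{1..N}. \<Sum>A\<in>Pow P. \<Sum>n\<in>{1..N}.
        (if A \<subseteq> prime_factors m \<and> A \<subseteq> prime_factors n then u A else 0) * (c m * c n))"
      by (rule sum.swap)
    also have "\<dots> = (\<Sum>m\<in>{1..N}. \<Sum>n\<in>{1..N}. \<Sum>A\<in>Pow P.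
        (if A \<subseteq> prime_factors m \<and> A \<subseteq> prime_factors n then u A else 0) * (c m * c n))"
      by (intro sum.cong refl sum.swap)
    also have "\<dots> \<le> (\<Sum>m\<in>{1..N}. \<Sum>n\<in>{1..N}. real (gcd m n) * (c m * c n))"
      unfolding sum_distrib_right[symmetric] u_def P_def
      by (intro sum_mono mult_right_mono gcd_ge_sum_over_prime_sets mult_nonneg_nonneg assms)
    finally show ?thesis by (simp add: mult.assoc)
  qed
  then have "(\<Prod>p\<in>P. z\<^sup>2 / (real p - 1) + 1) * (\<Sum>A\<in>Pow P. (sqrt (u A) * C A)\<^sup>2) \<le>
      (\<Prod>p\<in>P. z\<^sup>2 / (real p - 1) + 1) * gcd_form N c"
    by (intro mult_left_mono prod_nonneg) (auto simp: P_def)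
  then show ?thesis using CS unfolding P_def by (simp only: add.commute[of 1 "_ / _"])
qed

section \<open>The lower bound for V, and the comparison of V and T\<close>

lemma beta_bounds: "beta > 0" "beta \<le> 1" and ffun_beta_eq_Qfun: "ffun beta = Qfun beta"
  using theI'[OF beta_ex1] unfolding beta_def[symmetric] by auto

lemma yfun_beta: "yfun beta > 0" "yfun beta < 1" "(yfun beta)\<^sup>2 = beta - yfun beta"
proof -
  show y: "yfun beta > 0" by (rule yfun_pos[OF beta_bounds(1)])
  have e: "yfun beta * (1 + yfun beta) = beta" by (rule yfun_eq[OF beta_bounds(1)])
  show sq: "(yfun beta)\<^sup>2 = beta - yfun beta"
    using e by (simp add: power2_eq_square algebra_simps)
  have "(yfun beta)\<^sup>2 > 0" using y by simp
  then show "yfun beta < 1" using sq beta_bounds by linarith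
qed

lemma eta_eq_ffun: "eta = 2 * beta * ln (1 + yfun beta) - (yfun beta)\<^sup>2"
  by (simp add: eta_def ffun_def)

lemma eta_eq_Qfun: "eta = beta * ln beta - beta + 1"
  using ffun_beta_eq_Qfun by (simp add: eta_def Qfun_def)

lemma eta_nonneg: "eta \<ge> 0"
proof -
  have "beta * (ln 1 - ln beta) \<le> beta * ((1 - beta) / beta)"
    using beta_bounds by (intro mult_left_mono ln_diff_le) auto
  then show ?thesis unfolding eta_eq_Qfun using beta_bounds by simp
qed

lemma ln_ge_1: "ln (real N) \<ge> 1" if "N \<ge> 3"
proof -
  have "exp 1 \<le> real N" using exp_le that by linarith
  then show ?thesis using that by (subst ln_ge_iff) auto
qed

abbreviation V_form :: "nat \<Rightarrow> (nat \<Rightarrow> real) \<Rightarrow> real" where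
  "V_form N c \<equiv> (\<Sum>m\<in>{1..N}. \<Sum>n\<in>{1..N}. real (gcd m n) / (real m + real n) * c m * c n)"

abbreviation T_form :: "nat \<Rightarrow> (nat \<Rightarrow> real) \<Rightarrow> real" where
  "T_form N c \<equiv> (\<Sum>m\<in>{1..N}. \<Sum>n\<in>{1..N}. real (gcd m n) / sqrt (real m * real n) * c m * c n)"

text \<open>With \<open>t = beta * ln (ln N)\<close>, the part of \<open>c\<close> on integers with at least \<open>t\<close> prime factors is
  controlled by the previous gcd bound with \<open>z = yfun beta\<close> and the first formula for \<^const>\<open>eta\<close>; the
  other part by the diagonal terms, Rankin's trick with \<open>beta ^ (\<omega> n - t)\<close> and the second formula.\<close>
lemma lower_bound_for_vector:
  "\<exists>K>0. \<forall>N\<ge>3. \<forall>c\<in>simplex_vecs N. ln (real N) powr eta \<le>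
     K * (real N * V_form N c)"
proof -
  obtain C1 where C1: "C1 > 0" "\<And>N z. N \<ge> 2 \<Longrightarrow> 0 \<le> z \<and> z \<le> 1 \<Longrightarrow>
     (\<Prod>p\<in>primes_le N. 1 + z / (real p - 1)) \<le> C1 * ln (real N) powr z"
    using prod_primes_le by blast
  obtain C2 where C2: "C2 > 0" "\<And>N b. N \<ge> 2 \<Longrightarrow> 0 \<le> b \<and> b \<le> 1 \<Longrightarrow>
     (\<Sum>n\<in>{1..N}. b ^ \<omega> n / real n) \<le> C2 * ln (real N) powr b"
    using sum_recip_weighted_le by blast
  define y where "y = yfun beta"
  note y = yfun_beta[folded y_def]
  show ?thesis
  proof (intro exI[of _ "4 * C1 + 28 * C2"] conjI allI impI ballI)
    fix N :: nat and c assume N: "N \<ge> 3" and c: "c \<in> simplex_vecs N"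
    define \<Phi> where "\<Phi> = V_form N c"
    have c0: "c n \<ge> 0" if "n \<in> {1..N}" for n
      using c that by (auto simp: simplex_vecs_def PiE_iff)
    have c1: "(\<Sum>n\<in>{1..N}. c n) = 1"
      using c c0 by (simp add: simplex_vecs_def)
    define l where "l = ln (ln (real N))"
    have lnN: "ln (real N) \<ge> 1" by (rule ln_ge_1[OF N])
    then have l: "l \<ge> 0" "exp l = ln (real N)" by (auto simp: l_def)
    have pw: "ln (real N) powr a = exp (a * l)" for a using lnN by (simp add: powr_def l_def)
    \<comment> \<open>The threshold for the number of prime factors.\<close>
    define t where "t = beta * l"
    define w where "w = (\<lambda>n::nat. \<omega> n)"
    define I where "I = {n\<in>{1..N}. real (w n) \<ge> t}"
    define J where "J = {n\<in>{1..N}. \<not> real (w n) \<ge> t}"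
    define s1 where "s1 = (\<Sum>n\<in>I. c n)"
    define s2 where "s2 = (\<Sum>n\<in>J. c n)"
    have s12: "s1 + s2 = 1"
    proof -
      have "s1 + s2 = (\<Sum>n\<in>I\<union>J. c n)" unfolding s1_def s2_def
        by (rule sum.union_disjoint[symmetric]) (auto simp: I_def J_def)
      also have "I \<union> J = {1..N}" by (auto simp: I_def J_def)
      finally show ?thesis using c1 by simp
    qed
    have s0: "s1 \<ge> 0" "s2 \<ge> 0" unfolding s1_def s2_def I_def J_def by (auto intro!: sum_nonneg c0)
    have \<Phi>0: "\<Phi> \<ge> 0" unfolding \<Phi>_def
      by (intro sum_nonneg mult_nonneg_nonneg divide_nonneg_nonneg c0) auto

    have G: "gcd_form N c \<le> 2 * real N * \<Phi>"
      unfolding \<Phi>_def sum_distrib_left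
    proof (intro sum_mono)
      fix m n assume mn: "m \<in> {1..N}" "n \<in> {1..N}"
      have "1 \<le> 2 * real N / (real m + real n)"
        using mn by (simp add: field_simps flip: of_nat_add)
      then have "real (gcd m n) * c m * c n * 1 \<le> real (gcd m n) * c m * c n * (2 * real N / (real m + real n))"
        using mn by (intro mult_left_mono mult_nonneg_nonneg c0) auto
      then show "real (gcd m n) * c m * c n \<le>
          2 * real N * (real (gcd m n) / (real m + real n) * c m * c n)"
        by (simp add: mult_ac)
    qed
    have "s1 * exp (t * ln (1 + y)) \<le> (\<Sum>n\<in>I. c n * (1 + y) ^ w n)"
      unfolding s1_def sum_distrib_right
    proof (intro sum_mono mult_left_mono)
      fix n assume n: "n \<in> I"
      have "exp (t * ln (1 + y)) \<le> exp (real (w n) * ln (1 + y))"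
        using n y unfolding I_def by (intro iffD2[OF exp_le_cancel_iff] mult_right_mono) auto
      also have "\<dots> = (1 + y) ^ w n" using y by (simp add: exp_of_nat_mult)
      finally show "exp (t * ln (1 + y)) \<le> (1 + y) ^ w n" .
    qed (auto simp: I_def c0)
    also have "\<dots> \<le> (\<Sum>n\<in>{1..N}. c n * (1 + y) ^ w n)"
      using y by (intro sum_mono2 mult_nonneg_nonneg c0) (auto simp: I_def)
    finally have "(s1 * exp (t * ln (1 + y)))\<^sup>2 \<le> (\<Sum>n\<in>{1..N}. c n * (1 + y) ^ w n)\<^sup>2"
      using s0 by (intro power_mono mult_nonneg_nonneg) auto
    also have "\<dots> \<le> (\<Prod>p\<in>primes_le N. 1 + y\<^sup>2 / (real p - 1)) *
        gcd_form N c"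
      unfolding w_def using y by (intro gcd_form_ge_weighted_sum c0) auto
    also have "\<dots> \<le> (C1 * ln (real N) powr (y\<^sup>2)) * (2 * real N * \<Phi>)"
    proof (intro mult_mono G)
      show "(\<Prod>p\<in>primes_le N. 1 + y\<^sup>2 / (real p - 1)) \<le> C1 * ln (real N) powr (y\<^sup>2)"
        by (rule C1(2)) (use N y(1,2) in \<open>auto simp: power_le_one\<close>)
      show "0 \<le> gcd_form N c"
        by (intro sum_nonneg mult_nonneg_nonneg c0) auto
    qed (use C1 in auto)
    also have "(s1 * exp (t * ln (1 + y)))\<^sup>2 = s1\<^sup>2 * exp (2 * t * ln (1 + y))"
      by (simp add: power_mult_distrib flip: exp_double)
    finally have "s1\<^sup>2 * exp (2 * t * ln (1 + y)) \<le> 2 * C1 * real N * \<Phi> * exp (y\<^sup>2 * l)"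
      by (simp add: pw mult_ac)
    then have "s1\<^sup>2 * exp (2 * t * ln (1 + y)) * exp (- (y\<^sup>2 * l))
        \<le> 2 * C1 * real N * \<Phi> * exp (y\<^sup>2 * l) * exp (- (y\<^sup>2 * l))"
      by (intro mult_right_mono) auto
    also have "\<dots> = 2 * C1 * real N * \<Phi>" by (simp add: exp_minus)
    also have "s1\<^sup>2 * exp (2 * t * ln (1 + y)) * exp (- (y\<^sup>2 * l)) = s1\<^sup>2 * exp (eta * l)"
      unfolding eta_eq_ffun y_def[symmetric] t_def by (simp add: mult.assoc algebra_simps flip: exp_add)
    finally have S1: "s1\<^sup>2 * exp (eta * l) \<le> 2 * C1 * real N * \<Phi>" .

    have "(\<Sum>n\<in>J. 1 * c n)\<^sup>2 \<le> (\<Sum>n\<in>J. 1\<^sup>2) * (\<Sum>n\<in>J. (c n)\<^sup>2)"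
      by (rule Cauchy_Schwarz_ineq_sum)
    then have "s2\<^sup>2 \<le> real (card J) * (\<Sum>n\<in>J. (c n)\<^sup>2)" by (simp add: s2_def)
    also have "\<dots> \<le> (14 * C2 * real N * exp (- (eta * l)) / 2) * (2 * \<Phi>)"
    proof (intro mult_mono)
      have "real (card J) * exp (t * ln beta) \<le> (\<Sum>n\<in>J. beta ^ w n)"
      proof -
        have "exp (t * ln beta) \<le> beta ^ w n" if "n \<in> J" for n
        proof -
          have "exp (t * ln beta) \<le> exp (real (w n) * ln beta)"
            using that beta_bounds unfolding J_def
            by (intro iffD2[OF exp_le_cancel_iff] mult_right_mono_neg) auto
          also have "\<dots> = beta ^ w n" using beta_bounds by (simp add: exp_of_nat_mult)
          finally show ?thesis .
        qed
        from sum_mono[OF this, of J "\<lambda>n. n"] show ?thesis by simp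
      qed
      also have "\<dots> \<le> (\<Sum>n\<in>{1..N}. beta ^ w n)"
        using beta_bounds by (intro sum_mono2) (auto simp: J_def)
      finally have "real (card J) * exp (t * ln beta) * exp l \<le> (\<Sum>n\<in>{1..N}. beta ^ w n) * exp l"
        by (intro mult_right_mono) auto
      also have "\<dots> = ln (real N) * (\<Sum>n\<in>{1..N}. beta ^ w n)" by (simp add: l)
      also have "\<dots> \<le> 7 * real N * (\<Sum>n\<in>{1..N}. beta ^ w n / real n)"
        unfolding w_def using beta_bounds N by (intro sum_weighted_le_sum_recip) auto
      also have "\<dots> \<le> 7 * real N * (C2 * ln (real N) powr beta)"
        unfolding w_def using C2(2)[of N beta] beta_bounds N by (intro mult_left_mono) auto
      finally have "real (card J) * exp (t * ln beta + l) \<le> 7 * C2 * real N * exp (beta * l)"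
        by (simp add: pw exp_add mult_ac)
      then have "real (card J) * exp (t * ln beta + l) * exp (- (t * ln beta + l))
          \<le> 7 * C2 * real N * exp (beta * l) * exp (- (t * ln beta + l))"
        by (intro mult_right_mono) auto
      also have "real (card J) * exp (t * ln beta + l) * exp (- (t * ln beta + l)) = real (card J)"
        by (simp only: mult.assoc exp_add[symmetric]) simp
      also have "7 * C2 * real N * exp (beta * l) * exp (- (t * ln beta + l)) = 7 * C2 * real N * exp (- (eta * l))"
        unfolding eta_eq_Qfun t_def by (simp add: mult.assoc algebra_simps flip: exp_add)
      finally show "real (card J) \<le> 14 * C2 * real N * exp (- (eta * l)) / 2" by simp
      have "(\<Sum>n\<in>J. (c n)\<^sup>2) \<le> (\<Sum>n\<in>{1..N}. (c n)\<^sup>2)" by (intro sum_mono2) (auto simp: J_def)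
      also have "\<dots> \<le> 2 * \<Phi>" unfolding \<Phi>_def sum_distrib_left
      proof (intro sum_mono)
        fix m assume m: "m \<in> {1..N}"
        have "(c m)\<^sup>2 = 2 * (real (gcd m m) / (real m + real m) * c m * c m)"
          using m by (simp add: power2_eq_square)
        also have "\<dots> \<le> (\<Sum>n\<in>{1..N}. 2 * (real (gcd m n) / (real m + real n) * c m * c n))"
          using m by (intro member_le_sum mult_nonneg_nonneg divide_nonneg_nonneg c0) auto
        finally show "(c m)\<^sup>2 \<le> (\<Sum>n\<in>{1..N}. 2 * (real (gcd m n) / (real m + real n) * c m * c n))" .
      qed
      finally show "(\<Sum>n\<in>J. (c n)\<^sup>2) \<le> 2 * \<Phi>" .
    qed (use C2 in \<open>auto intro!: sum_nonneg\<close>)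
    finally have "s2\<^sup>2 * exp (eta * l) \<le> (14 * C2 * real N * exp (- (eta * l)) / 2) * (2 * \<Phi>) * exp (eta * l)"
      by (intro mult_right_mono) auto
    also have "\<dots> = 14 * C2 * real N * \<Phi>" by (simp add: exp_minus)
    finally have S2: "s2\<^sup>2 * exp (eta * l) \<le> 14 * C2 * real N * \<Phi>" .
    have "1 = (s1 + s2)\<^sup>2" by (simp add: s12)
    also have "\<dots> \<le> 2 * s1\<^sup>2 + 2 * s2\<^sup>2"
      using sum_squares_bound[of s1 s2] by (simp add: power2_sum)
    finally have "1 * exp (eta * l) \<le> (2 * s1\<^sup>2 + 2 * s2\<^sup>2) * exp (eta * l)"
      by (intro mult_right_mono) auto
    then have "exp (eta * l) \<le> 2 * (s1\<^sup>2 * exp (eta * l)) + 2 * (s2\<^sup>2 * exp (eta * l))"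
      by (simp add: algebra_simps)
    also have "\<dots> \<le> (4 * C1 + 28 * C2) * (real N * \<Phi>)" using S1 S2 by (simp add: algebra_simps)
    finally show "ln (real N) powr eta \<le> (4 * C1 + 28 * C2) * (real N * V_form N c)"
      unfolding \<Phi>_def[symmetric] pw .
  qed (use C1 C2 in auto)
qed

lemma V_lower_bound: "\<exists>K>0. \<forall>N::nat. N \<ge> 3 \<longrightarrow> ln (real N) powr eta \<le> K * V N"
proof -
  obtain K where K: "K > 0" "\<And>N c. N \<ge> 3 \<Longrightarrow> c \<in> simplex_vecs N \<Longrightarrow> ln (real N) powr eta \<le>
     K * (real N * V_form N c)"
    using lower_bound_for_vector by blast
  show ?thesis
  proof (intro exI[of _ K] conjI allI impI K(1))
    fix N :: nat assume N: "N \<ge> 3"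
    have "ln (real N) powr eta / (K * real N) \<le> (INF c\<in>simplex_vecs N.
     V_form N c)"
    proof (rule cINF_greatest)
      show "simplex_vecs N \<noteq> {}" using N by (intro simplex_vecs_nonempty) auto
      fix c assume "c \<in> simplex_vecs N"
      from K(2)[OF N this] show "ln (real N) powr eta / (K * real N) \<le>
        V_form N c"
        using K(1) N by (simp add: field_simps)
    qed
    then have "ln (real N) powr eta / (K * real N) * (K * real N) \<le> (INF c\<in>simplex_vecs N.
     V_form N c) * (K * real N)"
      using K(1) by (intro mult_right_mono) auto
    then show "ln (real N) powr eta \<le> K * V N"
      unfolding V_def using K(1) N by (simp add: mult_ac)
  qed
qed

lemma V_le_half_T:
  assumes "N \<ge> 3"
  shows "V N \<le> 1 / 2 * T N"
proof -
  have "2 * (INF c\<in>simplex_vecs N.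
     V_form N c) \<le> (INF c\<in>simplex_vecs N.
     T_form N c)"
  proof (rule cINF_greatest)
    show "simplex_vecs N \<noteq> {}" using assms by (intro simplex_vecs_nonempty) auto
    fix c assume c: "c \<in> simplex_vecs N"
    have c0: "c n \<ge> 0" if "n \<in> {1..N}" for n
      using c that by (auto simp: simplex_vecs_def PiE_iff)
    have "(INF c\<in>simplex_vecs N.
     V_form N c) \<le>
      V_form N c"
      by (rule cINF_lower[OF bdd_below_V c])
    also have "\<dots> \<le> (\<Sum>m\<in>{1..N}. \<Sum>n\<in>{1..N}. 1 / 2 * (real (gcd m n) / sqrt (real m * real n) * c m * c n))"
    proof (intro sum_mono)
      fix m n assume mn: "m \<in> {1..N}" "n \<in> {1..N}"
      have "2 * sqrt (real m * real n) \<le> real m + real n"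
        using arith_geo_mean_sqrt[of "real m" "real n"] by simp
      then have "1 / (real m + real n) \<le> 1 / (2 * sqrt (real m * real n))"
        using mn by (intro divide_left_mono) auto
      then have "1 / (real m + real n) * (real (gcd m n) * c m * c n) \<le>
          1 / (2 * sqrt (real m * real n)) * (real (gcd m n) * c m * c n)"
        using mn by (intro mult_right_mono mult_nonneg_nonneg c0) auto
      then show "real (gcd m n) / (real m + real n) * c m * c n \<le>
          1 / 2 * (real (gcd m n) / sqrt (real m * real n) * c m * c n)" by simp
    qed
    also have "\<dots> = 1 / 2 * T_form N c"
      by (simp add: sum_distrib_left)
    finally show "2 * (INF c\<in>simplex_vecs N.
     V_form N c) \<le>
     T_form N c" by simp
  qed
  then have "real N * (2 * (INF c\<in>simplex_vecs N.
     V_form N c)) \<le> T N"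
    unfolding T_def by (intro mult_left_mono) auto
  then show ?thesis unfolding V_def by simp
qed

section \<open>Poisson weights on multisets and the ballot condition\<close>

text \<open>For \<open>x a = 1/a\<close> this is the weight \<open>1 / n\<close> of the integer \<open>n\<close> with prime factorization \<open>M\<close>, damped
  by factorials at repeated primes. The factorials make the sum over all multisets of size \<open>m\<close> equal to
  \<open>(\<Sum>a. x a) ^ m / m!\<close> without error terms.\<close>
definition poisson_weight :: "('a \<Rightarrow> real) \<Rightarrow> 'a multiset \<Rightarrow> real" where
  "poisson_weight x M = (\<Prod>a\<in>set_mset M. x a ^ count M a / fact (count M a))"

lemma poisson_weight_superset:
  assumes "finite F" "set_mset M \<subseteq> F"
  shows "poisson_weight x M = (\<Prod>a\<in>F. x a ^ count M a / fact (count M a))"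
  unfolding poisson_weight_def using assms
  by (intro prod.mono_neutral_left) (auto simp: not_in_iff)

lemma poisson_weight_nonneg: "(\<And>a. a \<in># M \<Longrightarrow> x a \<ge> 0) \<Longrightarrow> poisson_weight x M \<ge> 0"
  unfolding poisson_weight_def by (intro prod_nonneg) auto

lemma poisson_weight_empty [simp]: "poisson_weight x {#} = 1"
  by (simp add: poisson_weight_def)

lemma poisson_weight_mono:
  assumes "\<And>a. a \<in># M \<Longrightarrow> 0 \<le> x a \<and> x a \<le> y a"
  shows "poisson_weight x M \<le> poisson_weight y M"
  unfolding poisson_weight_def
  by (intro prod_mono conjI divide_right_mono power_mono divide_nonneg_nonneg zero_le_power)
     (use assms in auto)

lemma poisson_weight_union_le:
  assumes "\<And>a. a \<in># A + B \<Longrightarrow> x a \<ge> 0"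
  shows "poisson_weight x (A + B) \<le> poisson_weight x A * poisson_weight x B"
proof -
  define F where "F = set_mset (A + B)"
  have F: "finite F" "set_mset A \<subseteq> F" "set_mset B \<subseteq> F" by (auto simp: F_def)
  have "poisson_weight x (A + B) = (\<Prod>a\<in>F. x a ^ count (A + B) a / fact (count (A + B) a))"
    by (intro poisson_weight_superset F) (simp add: F_def)
  also have "\<dots> \<le> (\<Prod>a\<in>F. (x a ^ count A a / fact (count A a)) * (x a ^ count B a / fact (count B a)))"
  proof (intro prod_mono conjI)
    fix a assume a: "a \<in> F"
    then have x: "x a \<ge> 0" using assms by (auto simp: F_def)
    show "0 \<le> x a ^ count (A + B) a / fact (count (A + B) a)" using x by simp
    have "fact (count A a) * fact (count B a) \<le> (fact (count A a + count B a) :: nat)"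
      by (intro dvd_imp_le fact_fact_dvd_fact) auto
    then have "real (fact (count A a) * fact (count B a)) \<le> real (fact (count A a + count B a))"
      by (rule of_nat_mono)
    then have f: "fact (count A a) * fact (count B a) \<le> (fact (count A a + count B a) :: real)"
      by simp
    have "x a ^ count (A + B) a / fact (count (A + B) a) \<le>
       x a ^ count (A + B) a / (fact (count A a) * fact (count B a))"
      using x f by (intro divide_left_mono) auto
    then show "x a ^ count (A + B) a / fact (count (A + B) a) \<le>
        (x a ^ count A a / fact (count A a)) * (x a ^ count B a / fact (count B a))"
      by (simp add: power_add)
  qed
  also have "\<dots> = poisson_weight x A * poisson_weight x B"
    by (simp only: prod.distrib poisson_weight_superset[OF F(1,2)] poisson_weight_superset[OF F(1,3)])
  finally show ?thesis .
qed

lemma poisson_weight_union_disjoint: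
  assumes "set_mset A \<inter> set_mset B = {}"
  shows "poisson_weight x (A + B) = poisson_weight x A * poisson_weight x B"
proof -
  have c: "a \<in># A \<Longrightarrow> count B a = 0" "a \<in># B \<Longrightarrow> count A a = 0" for a
    using assms by (auto simp flip: not_in_iff)
  have "poisson_weight x (A + B) = (\<Prod>a\<in>set_mset A \<union> set_mset B. x a ^ count (A + B) a / fact (count (A + B) a))"
    by (simp add: poisson_weight_def)
  also have "\<dots> = (\<Prod>a\<in>set_mset A. x a ^ count (A + B) a / fact (count (A + B) a)) *
      (\<Prod>a\<in>set_mset B. x a ^ count (A + B) a / fact (count (A + B) a))"
    using assms by (intro prod.union_disjoint) auto
  also have "(\<Prod>a\<in>set_mset A. x a ^ count (A + B) a / fact (count (A + B) a)) = poisson_weight x A"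
    unfolding poisson_weight_def by (intro prod.cong refl) (simp add: c)
  also have "(\<Prod>a\<in>set_mset B. x a ^ count (A + B) a / fact (count (A + B) a)) = poisson_weight x B"
    unfolding poisson_weight_def by (intro prod.cong refl) (simp add: c)
  finally show ?thesis .
qed

text \<open>Up to the multiplicity, removing one copy of \<open>a\<close> divides the weight by \<open>x a\<close>: the factorial in the
  denominator is there for this rule.\<close>
lemma poisson_weight_add_mset:
  "real (count (add_mset a M) a) * poisson_weight x (add_mset a M) = x a * poisson_weight x M"
proof -
  define F where "F = set_mset (add_mset a M)"
  have F: "finite F" "set_mset M \<subseteq> F" "set_mset (add_mset a M) \<subseteq> F" "a \<in> F" by (auto simp: F_def)
  have "(\<Prod>b\<in>F - {a}. x b ^ count (add_mset a M) b / fact (count (add_mset a M) b)) =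
        (\<Prod>b\<in>F - {a}. x b ^ count M b / fact (count M b))"
    by (intro prod.cong) auto
  moreover have "real (Suc (count M a)) * (x a ^ Suc (count M a) / fact (Suc (count M a)) * R) =
      x a * (x a ^ count M a / fact (count M a) * R)" for R
    by (simp add: field_simps del: of_nat_Suc)
  ultimately show ?thesis
    unfolding poisson_weight_superset[OF F(1,2)] poisson_weight_superset[OF F(1,3)]
      prod.remove[OF F(1,4)] by (simp del: of_nat_Suc power_Suc fact_Suc)
qed

lemma sum_count_poisson_weight:
  assumes "finite \<A>"
  shows "(\<Sum>M\<in>\<A>. real (count M a) * poisson_weight x M) =
         x a * (\<Sum>M\<in>{M. add_mset a M \<in> \<A>}. poisson_weight x M)"
proof -
  have im: "{M\<in>\<A>. a \<in># M} = add_mset a ` {M. add_mset a M \<in> \<A>}"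
  proof (intro equalityI subsetI)
    fix M assume "M \<in> {M\<in>\<A>. a \<in># M}"
    then have "M = add_mset a (M - {#a#})" "M \<in> \<A>" by auto
    then show "M \<in> add_mset a ` {M. add_mset a M \<in> \<A>}" by (metis imageI mem_Collect_eq)
  qed auto
  have "(\<Sum>M\<in>\<A>. real (count M a) * poisson_weight x M) =
      (\<Sum>M\<in>{M\<in>\<A>. a \<in># M}. real (count M a) * poisson_weight x M)"
    using assms by (intro sum.mono_neutral_right) (auto simp: not_in_iff)
  also have "\<dots> = (\<Sum>M\<in>{M. add_mset a M \<in> \<A>}. real (count (add_mset a M) a) * poisson_weight x (add_mset a M))"
    unfolding im by (subst sum.reindex) (auto simp: inj_on_def)
  also have "\<dots> = x a * (\<Sum>M\<in>{M. add_mset a M \<in> \<A>}. poisson_weight x M)"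
    unfolding poisson_weight_add_mset by (rule sum_distrib_left[symmetric])
  finally show ?thesis .
qed

lemma sum_mset_eq_sum_count:
  assumes "finite F" "set_mset M \<subseteq> F"
  shows "(\<Sum>a\<in>#M. h a) = (\<Sum>a\<in>F. real (count M a) * h a)"
  using assms(2)
proof (induction M)
  case (add b M)
  have "(\<Sum>a\<in>F. real (count (add_mset b M) a) * h a) =
      (\<Sum>a\<in>F. real (count M a) * h a + (if a = b then h a else 0))"
    by (intro sum.cong) (auto simp: algebra_simps)
  also have "\<dots> = (\<Sum>a\<in>F. real (count M a) * h a) + h b"
    using assms(1) add.prems by (simp add: sum.distrib)
  finally show ?case using add by simp
qed simp

text \<open>Size-biasing: a sum of an additive function against the weight becomes a sum over a marked element and the
  rest of the multiset.\<close>
lemma sum_additive_poisson_weight: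
  assumes "finite \<A>" "finite F" "\<And>M. M \<in> \<A> \<Longrightarrow> set_mset M \<subseteq> F"
  shows "(\<Sum>M\<in>\<A>. poisson_weight x M * (\<Sum>a\<in>#M. h a)) =
         (\<Sum>a\<in>F. h a * x a * (\<Sum>M\<in>{M. add_mset a M \<in> \<A>}. poisson_weight x M))"
proof -
  have "(\<Sum>M\<in>\<A>. poisson_weight x M * (\<Sum>a\<in>#M. h a)) = (\<Sum>M\<in>\<A>. \<Sum>a\<in>F. h a * (real (count M a) * poisson_weight x M))"
  proof (intro sum.cong refl)
    fix M assume M: "M \<in> \<A>"
    have "(\<Sum>a\<in>#M. h a) = (\<Sum>a\<in>F. real (count M a) * h a)"
      by (rule sum_mset_eq_sum_count) (use assms M in auto)
    then show "poisson_weight x M * (\<Sum>a\<in>#M. h a) = (\<Sum>a\<in>F. h a * (real (count M a) * poisson_weight x M))"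
      by (simp add: sum_distrib_left mult_ac)
  qed
  also have "\<dots> = (\<Sum>a\<in>F. h a * (\<Sum>M\<in>\<A>. real (count M a) * poisson_weight x M))"
    by (subst sum.swap) (simp add: sum_distrib_left)
  finally show ?thesis by (simp add: sum_count_poisson_weight[OF assms(1)] mult.assoc)
qed

lemma multisets_of_size_remove:
  assumes "a \<in> F"
  shows "{M. add_mset a M \<in> multisets_of_size F (Suc m)} = multisets_of_size F m"
  using assms by (auto simp: multisets_of_size_def)

text \<open>The multinomial theorem, obtained by size-biasing with the constant function 1.\<close>
lemma sum_poisson_weight_multisets_of_size:
  assumes "finite F"
  shows "(\<Sum>M\<in>multisets_of_size F m. poisson_weight x M) = (\<Sum>a\<in>F. x a) ^ m / fact m"
proof (induction m)
  case (Suc m)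
  let ?A = "multisets_of_size F (Suc m)"
  have "real (Suc m) * (\<Sum>M\<in>?A. poisson_weight x M) = (\<Sum>M\<in>?A. poisson_weight x M * (\<Sum>a\<in>#M. 1))"
    by (simp add: sum_distrib_left mult.commute multisets_of_size_def del: of_nat_Suc)
  also have "\<dots> = (\<Sum>a\<in>F. 1 * x a * (\<Sum>M\<in>{M. add_mset a M \<in> ?A}. poisson_weight x M))"
    using assms finite_multisets_of_size[OF assms]
    by (intro sum_additive_poisson_weight) (auto dest: multisets_of_size_subset)
  also have "\<dots> = (\<Sum>a\<in>F. x a * ((\<Sum>a\<in>F. x a) ^ m / fact m))"
    by (intro sum.cong refl) (simp add: multisets_of_size_remove Suc)
  also have "\<dots> = (\<Sum>a\<in>F. x a) * ((\<Sum>a\<in>F. x a) ^ m / fact m)"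
    by (rule sum_distrib_right[symmetric])
  finally have "(\<Sum>M\<in>?A. poisson_weight x M) =
      (\<Sum>a\<in>F. x a) * ((\<Sum>a\<in>F. x a) ^ m / fact m) / real (Suc m)"
    by (simp add: eq_divide_eq mult.commute del: of_nat_Suc)
  then show ?case by (simp add: mult_ac del: of_nat_Suc)
qed simp

lemma sum_poisson_weight_product:
  assumes "\<And>A. A \<in> \<A> \<Longrightarrow> set_mset A \<subseteq> F" "\<And>B. B \<in> \<B> \<Longrightarrow> set_mset B \<subseteq> G" "F \<inter> G = {}"
  shows "(\<Sum>M\<in>(\<lambda>(A,B). A + B) ` (\<A> \<times> \<B>). poisson_weight x M) =
         (\<Sum>A\<in>\<A>. poisson_weight x A) * (\<Sum>B\<in>\<B>. poisson_weight x B)"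
proof -
  have flt: "filter_mset (\<lambda>a. a \<in> F) (A + B) = A \<and> filter_mset (\<lambda>a. a \<in> G) (A + B) = B"
    if "A \<in> \<A>" "B \<in> \<B>" for A B
  proof -
    have "set_mset A \<subseteq> F" "set_mset B \<subseteq> G" using assms that by auto
    then have "filter_mset (\<lambda>a. a \<in> F) A = A" "filter_mset (\<lambda>a. a \<in> F) B = {#}"
         "filter_mset (\<lambda>a. a \<in> G) A = {#}" "filter_mset (\<lambda>a. a \<in> G) B = B"
      using assms(3) unfolding filter_mset_eq_conv by auto
    then show ?thesis by simp
  qed
  have inj: "inj_on (\<lambda>(A,B). A + B) (\<A> \<times> \<B>)"
  proof (rule inj_onI, clarify)
    fix A B A' B' assume "A \<in> \<A>" "B \<in> \<B>" "A' \<in> \<A>" "B' \<in> \<B>" "A + B = A' + B'"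
    then show "A = A' \<and> B = B'" using flt by metis
  qed
  have "(\<Sum>M\<in>(\<lambda>(A,B). A + B) ` (\<A> \<times> \<B>). poisson_weight x M) = (\<Sum>(A,B)\<in>\<A> \<times> \<B>. poisson_weight x (A + B))"
    using inj by (subst sum.reindex) (auto simp: case_prod_unfold)
  also have "\<dots> = (\<Sum>(A,B)\<in>\<A> \<times> \<B>. poisson_weight x A * poisson_weight x B)"
  proof (intro sum.cong refl, clarify)
    fix A B assume "A \<in> \<A>" "B \<in> \<B>"
    then have "set_mset A \<inter> set_mset B = {}" using assms by blast
    then show "poisson_weight x (A + B) = poisson_weight x A * poisson_weight x B"
      by (rule poisson_weight_union_disjoint)
  qed
  also have "\<dots> = (\<Sum>A\<in>\<A>. poisson_weight x A) * (\<Sum>B\<in>\<B>. poisson_weight x B)"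
    by (simp add: sum_product sum.cartesian_product)
  finally show ?thesis .
qed

text \<open>The instance of Abel's identity behind the ballot count.\<close>
lemma sum_binomial_weighted:
  fixes q :: real
  shows "(\<Sum>s\<le>m. real (m choose s) * (q - real s) * q ^ s) = q * (1 + q) ^ m - real m * q * (1 + q) ^ (m - 1)"
proof -
  have "(\<Sum>s\<le>m. real (m choose s) * q ^ s) = (1 + q) ^ m"
    using binomial_ring[of q 1 m] by (simp add: add.commute)
  moreover have "(\<Sum>s\<le>m. real s * real (m choose s) * q ^ s) = real m * q * (1 + q) ^ (m - 1)"
  proof (cases m)
    case (Suc n)
    have "(\<Sum>s\<le>Suc n. real s * real (Suc n choose s) * q ^ s) = (\<Sum>s\<le>n. real (Suc s) * real (Suc n choose Suc s) * q ^ Suc s)"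
      by (subst sum.atMost_Suc_shift) simp
    also have "\<dots> = (\<Sum>s\<le>n. real (Suc n) * q * (real (n choose s) * q ^ s))"
    proof (intro sum.cong refl)
      fix s
      have "real (Suc s) * real (Suc n choose Suc s) = real (Suc n) * real (n choose s)"
        by (metis Suc_times_binomial of_nat_mult)
      then show "real (Suc s) * real (Suc n choose Suc s) * q ^ Suc s = real (Suc n) * q * (real (n choose s) * q ^ s)"
        by simp
    qed
    also have "\<dots> = real (Suc n) * q * (\<Sum>s\<le>n. real (n choose s) * q ^ s)"
      by (simp only: sum_distrib_left)
    also have "(\<Sum>s\<le>n. real (n choose s) * q ^ s) = (1 + q) ^ n"
      using binomial_ring[of q 1 n] by (simp add: add.commute)
    finally show ?thesis using Suc by simp
  qed simp
  moreover have "(\<Sum>s\<le>m. real (m choose s) * (q - real s) * q ^ s) =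
    q * (\<Sum>s\<le>m. real (m choose s) * q ^ s) - (\<Sum>s\<le>m. real s * real (m choose s) * q ^ s)"
    by (simp add: sum_distrib_left sum_subtractf[symmetric] algebra_simps)
  ultimately show ?thesis by simp
qed

text \<open>The bins are the differences \<open>F (Suc j) - F j\<close>, and each has the same total \<open>\<sigma>\<close>.\<close>
locale ballot_bins =
  fixes F :: "nat \<Rightarrow> 'a set" and x :: "'a \<Rightarrow> real" and \<sigma> :: real
  assumes fin: "\<And>j. finite (F j)"
      and F0: "F 0 = {}"
      and F_mono: "\<And>j. F j \<subseteq> F (Suc j)"
      and bin_sum: "\<And>j. (\<Sum>a\<in>F (Suc j) - F j. x a) = \<sigma>"
begin

definition ballot :: "nat \<Rightarrow> nat \<Rightarrow> 'a multiset set" where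
  "ballot j m = {M \<in> multisets_of_size (F j) m. \<forall>i\<le>j. size (filter_mset (\<lambda>a. a \<in> F i) M) \<le> i}"

lemma F_le: "i \<le> j \<Longrightarrow> F i \<subseteq> F j"
  using F_mono by (rule lift_Suc_mono_le)

lemma finite_ballot: "finite (ballot j m)"
  unfolding ballot_def by (rule finite_subset[OF _ finite_multisets_of_size[OF fin]]) auto

text \<open>The bound at the last level follows from the total size, so a ballot multiset splits freely into a ballot
  multiset of the earlier bins and an arbitrary multiset of the new bin.\<close>
lemma ballot_Suc:
  assumes "m \<le> Suc j"
  shows "ballot (Suc j) m =
    (\<Union>l\<le>m. (\<lambda>(A,B). A + B) ` (ballot j l \<times> multisets_of_size (F (Suc j) - F j) (m - l)))"
proof (intro equalityI subsetI)
  fix M assume M: "M \<in> ballot (Suc j) m"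
  define A where "A = filter_mset (\<lambda>a. a \<in> F j) M"
  define B where "B = filter_mset (\<lambda>a. a \<notin> F j) M"
  have MAB: "M = A + B" by (simp add: A_def B_def multiset_partition[symmetric])
  have sz: "size A + size B = m" "set_mset M \<subseteq> F (Suc j)"
    using M by (auto simp: ballot_def multisets_of_size_def MAB)
  have "filter_mset (\<lambda>a. a \<in> F i) A = filter_mset (\<lambda>a. a \<in> F i) M" if "i \<le> j" for i
    unfolding A_def filter_filter_mset using F_le[OF that] by (intro filter_mset_cong) auto
  then have "A \<in> ballot j (size A)"
    using M by (auto simp: ballot_def multisets_of_size_def A_def)
  moreover have "B \<in> multisets_of_size (F (Suc j) - F j) (m - size A)"
    using sz by (auto simp: multisets_of_size_def B_def)
  ultimately show "M \<in> (\<Union>l\<le>m. (\<lambda>(A,B). A + B) ` (ballot j l \<times> multisets_of_size (F (Suc j) - F j) (m - l)))"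
    using MAB sz by (intro UN_I[of "size A"]) auto
next
  fix M assume "M \<in> (\<Union>l\<le>m. (\<lambda>(A,B). A + B) ` (ballot j l \<times> multisets_of_size (F (Suc j) - F j) (m - l)))"
  then obtain l A B where l: "l \<le> m" and A: "A \<in> ballot j l" and B: "B \<in> multisets_of_size (F (Suc j) - F j) (m - l)"
    and M: "M = A + B" by auto
  have sM: "size M = m" "set_mset M \<subseteq> F (Suc j)"
    using A B l M F_mono[of j] by (auto simp: ballot_def multisets_of_size_def)
  have "size (filter_mset (\<lambda>a. a \<in> F i) M) \<le> i" if i: "i \<le> Suc j" for i
  proof (cases "i = Suc j")
    case True
    have "size (filter_mset (\<lambda>a. a \<in> F i) M) \<le> size M" by (rule size_filter_mset_lesseq)
    then show ?thesis using True sM assms by simp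
  next
    case False
    then have "i \<le> j" using i by simp
    have "filter_mset (\<lambda>a. a \<in> F i) B = {#}"
      using B F_le[OF \<open>i \<le> j\<close>] by (auto simp: multisets_of_size_def)
    then have "size (filter_mset (\<lambda>a. a \<in> F i) M) = size (filter_mset (\<lambda>a. a \<in> F i) A)"
      by (simp only: M filter_union_mset size_union) simp
    then show ?thesis using A \<open>i \<le> j\<close> by (simp add: ballot_def)
  qed
  then show "M \<in> ballot (Suc j) m" using sM by (auto simp: ballot_def multisets_of_size_def)
qed

text \<open>The continuous analogue of counting parking functions. All bins having exactly the same total \<open>\<sigma>\<close> is what
  allows a closed form; the formula includes the degenerate case \<open>m = Suc j\<close>, where both sides vanish.\<close>
lemma sum_poisson_weight_ballot:
  "m \<le> Suc j \<Longrightarrow> (\<Sum>M\<in>ballot j m. poisson_weight x M) =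
     \<sigma> ^ m * (real (Suc j) - real m) * real (Suc j) ^ m / (real (Suc j) * fact m)"
proof (induction j arbitrary: m)
  case 0
  show ?case
  proof (cases "m = 0")
    case True
    have "ballot 0 0 = {{#}}" by (auto simp: ballot_def multisets_of_size_def)
    then show ?thesis using True by simp
  next
    case False
    then have "m = 1" using 0 by simp
    moreover have "ballot 0 1 = {}" by (auto simp: ballot_def multisets_of_size_def F0)
    ultimately show ?thesis by simp
  qed
next
  case (Suc j)
  show ?case
  proof (cases "m = Suc (Suc j)")
    case True
    have "ballot (Suc j) m = {}"
    proof -
      have "False" if "M \<in> ballot (Suc j) m" for M
      proof -
        have "filter_mset (\<lambda>a. a \<in> F (Suc j)) M = M"
          using that by (auto simp: ballot_def multisets_of_size_def filter_mset_eq_conv)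
        moreover have "size (filter_mset (\<lambda>a. a \<in> F (Suc j)) M) \<le> Suc j" "size M = m"
          using that by (auto simp: ballot_def multisets_of_size_def)
        ultimately show False using True by simp
      qed
      then show ?thesis by blast
    qed
    then show ?thesis using True by simp
  next
    case False
    then have m: "m \<le> Suc j" using Suc.prems by simp
    define q where "q = real (Suc j)"
    have q: "q > 0" by (simp add: q_def)
    have "(\<Sum>M\<in>ballot (Suc j) m. poisson_weight x M) =
      (\<Sum>l\<le>m. \<Sum>M\<in>(\<lambda>(A,B). A + B) ` (ballot j l \<times> multisets_of_size (F (Suc j) - F j) (m - l)). poisson_weight x M)"
      unfolding ballot_Suc[OF m]
    proof (rule sum.UNION_disjoint)
      show "\<forall>l\<in>{..m}. finite ((\<lambda>(A,B). A + B) ` (ballot j l \<times> multisets_of_size (F (Suc j) - F j) (m - l)))"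
        using fin by (auto intro!: finite_imageI finite_cartesian_product finite_ballot finite_multisets_of_size)
      have key: "size (filter_mset (\<lambda>a. a \<in> F j) M) = l"
        if M0: "M \<in> (\<lambda>(A,B). A + B) ` (ballot j l \<times> multisets_of_size (F (Suc j) - F j) (m - l))" for M l
      proof -
        obtain A B where A: "A \<in> ballot j l" and B: "B \<in> multisets_of_size (F (Suc j) - F j) (m - l)"
          and M: "M = A + B" using M0 by auto
        have "filter_mset (\<lambda>a. a \<in> F j) A = A" "filter_mset (\<lambda>a. a \<in> F j) B = {#}"
          using A B by (auto simp: ballot_def multisets_of_size_def filter_mset_eq_conv)
        then show ?thesis using A M by (simp add: ballot_def multisets_of_size_def)
      qed
      show "\<forall>l\<in>{..m}. \<forall>l'\<in>{..m}. l \<noteq> l' \<longrightarrow>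
        (\<lambda>(A,B). A + B) ` (ballot j l \<times> multisets_of_size (F (Suc j) - F j) (m - l)) \<inter>
        (\<lambda>(A,B). A + B) ` (ballot j l' \<times> multisets_of_size (F (Suc j) - F j) (m - l')) = {}"
        using key by blast
    qed simp
    also have "\<dots> = (\<Sum>l\<le>m. (\<sigma> ^ l * (q - real l) * q ^ l / (q * fact l)) * (\<sigma> ^ (m - l) / fact (m - l)))"
    proof (intro sum.cong refl)
      fix l assume l: "l \<in> {..m}"
      have "(\<Sum>M\<in>(\<lambda>(A,B). A + B) ` (ballot j l \<times> multisets_of_size (F (Suc j) - F j) (m - l)). poisson_weight x M) =
        (\<Sum>A\<in>ballot j l. poisson_weight x A) * (\<Sum>B\<in>multisets_of_size (F (Suc j) - F j) (m - l). poisson_weight x B)"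
        by (rule sum_poisson_weight_product[of _ "F j" _ "F (Suc j) - F j"])
           (auto simp: ballot_def multisets_of_size_def)
      also have "(\<Sum>A\<in>ballot j l. poisson_weight x A) = \<sigma> ^ l * (q - real l) * q ^ l / (q * fact l)"
        using Suc.IH[of l] l m unfolding q_def by simp
      also have "(\<Sum>B\<in>multisets_of_size (F (Suc j) - F j) (m - l). poisson_weight x B) = \<sigma> ^ (m - l) / fact (m - l)"
        using fin by (subst sum_poisson_weight_multisets_of_size) (auto simp: bin_sum)
      finally show "(\<Sum>M\<in>(\<lambda>(A,B). A + B) ` (ballot j l \<times> multisets_of_size (F (Suc j) - F j) (m - l)). poisson_weight x M) =
        (\<sigma> ^ l * (q - real l) * q ^ l / (q * fact l)) * (\<sigma> ^ (m - l) / fact (m - l))" .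
    qed
    also have "\<dots> = (\<Sum>l\<le>m. \<sigma> ^ m / (q * fact m) * (real (m choose l) * (q - real l) * q ^ l))"
    proof (intro sum.cong refl)
      fix l assume "l \<in> {..m}"
      then have l: "l \<le> m" by simp
      have "\<sigma> ^ m = \<sigma> ^ l * \<sigma> ^ (m - l)" using l by (simp flip: power_add)
      moreover have "real (m choose l) = fact m / (fact l * fact (m - l))" using l by (rule binomial_fact)
      moreover have "(u * w * v / (q * c)) * (u' / d) = (u * u') / (q * e) * (e / (c * d) * w * v)"
        if "c > 0" "d > 0" "e > 0" for u w v c u' d e :: real
        using that q by (simp add: field_simps)
      ultimately show "(\<sigma> ^ l * (q - real l) * q ^ l / (q * fact l)) * (\<sigma> ^ (m - l) / fact (m - l)) =
        \<sigma> ^ m / (q * fact m) * (real (m choose l) * (q - real l) * q ^ l)"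
        by (simp add: mult_ac)
    qed
    also have "\<dots> = \<sigma> ^ m / (q * fact m) * (q * (1 + q) ^ m - real m * q * (1 + q) ^ (m - 1))"
      by (simp only: sum_distrib_left[symmetric] sum_binomial_weighted)
    also have "\<dots> = \<sigma> ^ m * (real (Suc (Suc j)) - real m) * real (Suc (Suc j)) ^ m / (real (Suc (Suc j)) * fact m)"
    proof -
      have e: "real (Suc (Suc j)) = 1 + q" by (simp add: q_def)
      have eq: "q * (1 + q) ^ m - real m * q * (1 + q) ^ (m - 1) = q * (1 + q - real m) * (1 + q) ^ m / (1 + q)"
        using q by (cases m) (auto simp: field_simps)
      show ?thesis unfolding e eq using q by (simp add: mult_ac)
    qed
    finally show ?thesis .
  qed
qed

end

section \<open>Stirling bounds and the Poisson distribution\<close>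

lemma ln_ge_pade: "ln x \<ge> 2 * (x - 1) / (x + 1)" if "x \<ge> 1" for x :: real
proof -
  define g where "g = (\<lambda>x::real. ln x - 2 * (x - 1) / (x + 1))"
  have "g 1 \<le> g x"
  proof (rule DERIV_nonneg_imp_nondecreasing[OF that])
    fix t :: real assume t: "1 \<le> t" "t \<le> x"
    have "(g has_real_derivative (1 / t - (2 * (t + 1) - 2 * (t - 1)) / ((t + 1) * (t + 1)))) (at t)"
      unfolding g_def using t by (auto intro!: derivative_eq_intros)
    moreover have "1 / t - (2 * (t + 1) - 2 * (t - 1)) / ((t + 1) * (t + 1)) = (t - 1)\<^sup>2 / (t * (t + 1)\<^sup>2)"
      using t by (simp add: divide_simps power2_eq_square) (simp add: algebra_simps)
    moreover have "(t - 1)\<^sup>2 / (t * (t + 1)\<^sup>2) \<ge> 0" using t by simp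
    ultimately show "\<exists>y. (g has_real_derivative y) (at t) \<and> 0 \<le> y" by metis
  qed
  then show ?thesis by (simp add: g_def)
qed

lemma ln_le_half_diff_inverse: "ln x \<le> (x - 1 / x) / 2" if "x \<ge> 1" for x :: real
proof -
  define g where "g = (\<lambda>x::real. (x - 1 / x) / 2 - ln x)"
  have "g 1 \<le> g x"
  proof (rule DERIV_nonneg_imp_nondecreasing[OF that])
    fix t :: real assume t: "1 \<le> t" "t \<le> x"
    have "(g has_real_derivative ((1 + 1 / t\<^sup>2) / 2 - 1 / t)) (at t)"
      unfolding g_def using t by (auto intro!: derivative_eq_intros simp: power2_eq_square)
    moreover have "(1 + 1 / t\<^sup>2) / 2 - 1 / t = (1 - 1 / t)\<^sup>2 / 2"
      by (simp add: power2_diff power_one_over)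
    ultimately show "\<exists>y. (g has_real_derivative y) (at t) \<and> 0 \<le> y" by (metis zero_le_power2 divide_nonneg_pos zero_less_numeral)
  qed
  then show ?thesis by (simp add: g_def)
qed

text \<open>The two inequalities for the logarithm say that the expression decreases in \<open>m\<close>, but by at most
  \<open>1 / (4 m) - 1 / (4 (m + 1))\<close> in each step.\<close>
lemma stirling_ln:
  assumes "m \<ge> 1"
  shows "ln (fact m) - (real m + 1/2) * ln (real m) + real m \<le> 1"
    and "ln (fact m) - (real m + 1/2) * ln (real m) + real m \<ge> 3/4 + 1 / (4 * real m)"
  using assms
proof (induction m rule: dec_induct)
  case (step m)
  define r where "r = real m"
  have r: "r \<ge> 1" "real (Suc m) = r + 1" using step by (auto simp: r_def)
  define L where "L = ln (1 + 1 / r)"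
  have L: "ln (r + 1) = ln r + L"
  proof -
    have "r + 1 = r * (1 + 1 / r)" using r by (simp add: field_simps)
    then show ?thesis using r by (simp add: L_def ln_mult_pos add_pos_pos)
  qed
  have f: "ln (fact (Suc m)) = ln (real (Suc m)) + ln (fact m)"
    unfolding fact_Suc by (subst ln_mult) auto
  have eq: "ln (fact (Suc m)) - (real (Suc m) + 1/2) * ln (real (Suc m)) + real (Suc m) =
     ln (fact m) - (r + 1/2) * ln r + r + (1 - (r + 1/2) * L)"
    unfolding f r(2) L by (simp add: algebra_simps)
  have "L \<ge> 2 * (1 + 1 / r - 1) / (1 + 1 / r + 1)" unfolding L_def using r by (intro ln_ge_pade) auto
  also have "2 * (1 + 1 / r - 1) / (1 + 1 / r + 1) = 2 / (2 * r + 1)" using r by (simp add: field_simps)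
  finally have "(r + 1/2) * L \<ge> (r + 1/2) * (2 / (2 * r + 1))" using r by (intro mult_left_mono) auto
  also have "(r + 1/2) * (2 / (2 * r + 1)) = 1" using r by (simp add: field_simps)
  finally have 1: "(r + 1/2) * L \<ge> 1" .
  have "L \<le> ((1 + 1 / r) - 1 / (1 + 1 / r)) / 2" unfolding L_def using r by (intro ln_le_half_diff_inverse) auto
  also have "\<dots> = (2 * r + 1) / (2 * r * (r + 1))" using r by (simp add: divide_simps) (simp add: algebra_simps)
  finally have "(r + 1/2) * L \<le> (r + 1/2) * ((2 * r + 1) / (2 * r * (r + 1)))" using r by (intro mult_left_mono) auto
  also have "\<dots> = 1 + 1 / (4 * r) - 1 / (4 * (r + 1))" using r by (simp add: divide_simps) (simp add: algebra_simps)
  finally have 2: "(r + 1/2) * L \<le> 1 + 1 / (4 * r) - 1 / (4 * (r + 1))" .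
  {
    case 1
    show ?case unfolding eq using step.IH(1) \<open>(r + 1/2) * L \<ge> 1\<close> unfolding r_def by linarith
  next
    case 2
    show ?case unfolding eq unfolding r(2)
      using step.IH(2)[folded r_def] \<open>(r + 1/2) * L \<le> 1 + 1 / (4 * r) - 1 / (4 * (r + 1))\<close> by linarith
  }
qed auto

lemma fact_ge_stirling: "fact m \<ge> sqrt (real m + 1) * real m ^ m / exp (real m)"
proof (cases "m = 0")
  case False
  then have m: "m \<ge> 1" by simp
  define r where "r = real m"
  have r: "r \<ge> 1" using m by (simp add: r_def)
  have "ln (r + 1) \<le> ln (2 * r)" using r by (subst ln_le_cancel_iff) auto
  also have "\<dots> = ln 2 + ln r" using r by (simp add: ln_mult)
  finally have "ln (r + 1) \<le> 1 + ln r" using ln_le_minus_one[of "2::real"] by simp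
  then have "(1/2) * ln (r + 1) + r * ln r - r \<le> ln (fact m)"
  proof -
    have "(r + 1/2) * ln r = r * ln r + (1/2) * ln r" by (simp add: algebra_simps)
    moreover have "1 / (4 * r) \<ge> 0" using r by simp
    ultimately show ?thesis
      using stirling_ln(2)[OF m] \<open>ln (r + 1) \<le> 1 + ln r\<close> unfolding r_def[symmetric] by linarith
  qed
  then have "exp ((1/2) * ln (r + 1) + r * ln r - r) \<le> fact m"
    by (simp add: ln_ge_iff)
  also have "exp ((1/2) * ln (r + 1) + r * ln r - r) = sqrt (r + 1) * r ^ m / exp r"
  proof -
    have "exp ((1/2) * ln (r + 1)) = sqrt (r + 1)" using r by (simp add: ln_sqrt[symmetric])
    moreover have "exp (r * ln r) = r ^ m" using r unfolding r_def by (simp add: exp_of_nat_mult)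
    ultimately show ?thesis by (simp add: exp_add exp_diff)
  qed
  finally show ?thesis by (simp add: r_def)
qed simp

lemma fact_le_stirling:
  assumes "m \<ge> 1"
  shows "fact m \<le> exp 1 * sqrt (real m) * real m ^ m / exp (real m)"
proof -
  define r where "r = real m"
  have r: "r \<ge> 1" using assms by (simp add: r_def)
  have "ln (fact m) \<le> 1 + (1/2) * ln r + r * ln r - r"
    using stirling_ln(1)[OF assms] unfolding r_def[symmetric] by (simp add: algebra_simps)
  then have "fact m \<le> exp (1 + (1/2) * ln r + r * ln r - r)"
    by (metis exp_le_cancel_iff exp_ln fact_gt_zero)
  also have "\<dots> = exp 1 * sqrt r * r ^ m / exp r"
  proof -
    have "exp ((1/2) * ln r) = sqrt r" using r by (simp add: ln_sqrt[symmetric])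
    moreover have "exp (r * ln r) = r ^ m" using r unfolding r_def by (simp add: exp_of_nat_mult)
    ultimately show ?thesis by (simp add: exp_add exp_diff)
  qed
  finally show ?thesis by (simp add: r_def)
qed

lemma power_exp_le: "\<mu> ^ m * exp (- \<mu>) \<le> real m ^ m * exp (- real m)" if "\<mu> \<ge> 0" for \<mu> :: real
proof (cases "\<mu> = 0 \<or> m = 0")
  case True
  then show ?thesis using that by (auto simp: power_0_left)
next
  case False
  then have p: "\<mu> > 0" "real m > 0" using that by auto
  have "real m * (ln \<mu> - ln (real m)) \<le> real m * ((\<mu> - real m) / real m)"
    using p by (intro mult_left_mono ln_diff_le) auto
  then have "real m * ln \<mu> - real m * ln (real m) \<le> \<mu> - real m"
    using p by (simp only: right_diff_distrib[of "real m" "ln \<mu>"]) simp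
  then have "real m * ln \<mu> - \<mu> \<le> real m * ln (real m) - real m" by linarith
  then have "exp (real m * ln \<mu> - \<mu>) \<le> exp (real m * ln (real m) - real m)" by simp
  then show ?thesis using p by (simp add: exp_diff exp_of_nat_mult exp_minus divide_inverse)
qed

text \<open>The Poisson distribution with mean \<open>z l\<close> has no atom larger than \<open>1 / sqrt (m + 1)\<close> at \<open>m\<close>. Compared
  with Rankin's trick, which gives the bound without the square root, this saves a square root.\<close>
lemma power_div_fact_le:
  fixes l z :: real
  assumes "l \<ge> 0" "z > 0"
  shows "l ^ m / fact m \<le> (1 / z) ^ m * exp (z * l) / sqrt (real m + 1)"
proof -
  have "(z * l) ^ m * exp (- (z * l)) \<le> real m ^ m * exp (- real m)"
    using assms by (intro power_exp_le) auto
  also have "\<dots> \<le> fact m / sqrt (real m + 1)"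
    using fact_ge_stirling[of m] by (simp add: exp_minus field_simps)
  finally have "(z * l) ^ m \<le> exp (z * l) * fact m / sqrt (real m + 1)"
    by (simp add: exp_minus field_simps)
  then show ?thesis using assms by (simp add: power_mult_distrib power_divide field_simps)
qed

lemma sum_power_div_fact_le: "(\<Sum>m\<le>n. \<mu> ^ m / fact m) \<le> exp \<mu>" if "\<mu> \<ge> 0" for \<mu> :: real
proof -
  have "(\<Sum>m\<in>{..n}. \<mu> ^ m /\<^sub>R fact m) \<le> (\<Sum>m. \<mu> ^ m /\<^sub>R fact m)"
    using that by (intro sum_le_suminf summable_exp_generic) auto
  then show ?thesis by (simp add: exp_def divide_inverse mult.commute)
qed

text \<open>The Cauchy-Schwarz inequality reduces the claim to the mean of \<open>1 / (m + 1)\<close>, which is explicit.\<close>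
lemma sum_poisson_over_sqrt_le:
  fixes \<mu> :: real
  assumes "\<mu> > 0"
  shows "(\<Sum>m\<le>n. \<mu> ^ m / fact m / sqrt (real m + 1)) \<le> exp \<mu> / sqrt \<mu>"
proof -
  define p where "p = (\<lambda>m. \<mu> ^ m / fact m)"
  have p0: "p m \<ge> 0" for m using assms by (simp add: p_def)
  have "(\<Sum>m\<le>n. sqrt (p m) * sqrt (p m / (real m + 1)))\<^sup>2 \<le>
      (\<Sum>m\<le>n. (sqrt (p m))\<^sup>2) * (\<Sum>m\<le>n. (sqrt (p m / (real m + 1)))\<^sup>2)"
    by (rule Cauchy_Schwarz_ineq_sum)
  also have "(\<Sum>m\<le>n. (sqrt (p m))\<^sup>2) = (\<Sum>m\<le>n. p m)" using p0 by simp
  also have "(\<Sum>m\<le>n. (sqrt (p m / (real m + 1)))\<^sup>2) = (\<Sum>m\<le>n. p m / (real m + 1))" using p0 by simp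
  also have "(\<Sum>m\<le>n. p m) * (\<Sum>m\<le>n. p m / (real m + 1)) \<le> exp \<mu> * (exp \<mu> / \<mu>)"
  proof (intro mult_mono)
    show "(\<Sum>m\<le>n. p m) \<le> exp \<mu>" unfolding p_def using assms by (intro sum_power_div_fact_le) auto
    have "\<mu> * (\<Sum>m\<le>n. p m / (real m + 1)) = (\<Sum>m\<le>n. p (Suc m))"
      unfolding sum_distrib_left p_def by (intro sum.cong refl) (simp add: field_simps)
    also have "\<dots> \<le> (\<Sum>m\<le>Suc n. p m)" using p0 by (subst sum.atMost_Suc_shift) simp
    also have "\<dots> \<le> exp \<mu>" unfolding p_def using assms by (intro sum_power_div_fact_le) auto
    finally show "(\<Sum>m\<le>n. p m / (real m + 1)) \<le> exp \<mu> / \<mu>" using assms by (simp add: field_simps)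
  qed (use p0 in \<open>auto intro!: sum_nonneg\<close>)
  also have "\<dots> = (exp \<mu> / sqrt \<mu>)\<^sup>2" using assms by (simp add: power_divide power2_eq_square)
  finally have "(\<Sum>m\<le>n. sqrt (p m) * sqrt (p m / (real m + 1))) \<le> exp \<mu> / sqrt \<mu>"
    using assms by (auto intro: power2_le_imp_le)
  moreover have "sqrt (p m) * sqrt (p m / (real m + 1)) = \<mu> ^ m / fact m / sqrt (real m + 1)" for m
    using p0[of m] by (simp add: real_sqrt_divide) (simp add: p_def)
  ultimately show ?thesis by simp
qed

lemma sum_inverse_sqrt_le: "(\<Sum>j\<le>k. 1 / sqrt (real j + 1)) \<le> 2 * sqrt (real k + 1)"
proof (induction k)
  case (Suc k)
  have "1 / sqrt (real (Suc k) + 1) \<le> 2 * (sqrt (real (Suc k) + 1) - sqrt (real k + 1))"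
  proof -
    define a b where "a = sqrt (real k + 1)" and "b = sqrt (real (Suc k) + 1)"
    have ab: "0 \<le> a" "a < b" "b * b - a * a = 1" unfolding a_def b_def by auto
    have "1 = (b - a) * (b + a)" using ab by (simp add: algebra_simps)
    also have "\<dots> \<le> (b - a) * (2 * b)" using ab by (intro mult_left_mono) auto
    finally show ?thesis unfolding a_def[symmetric] b_def[symmetric] using ab by (simp add: field_simps)
  qed
  then show ?case using Suc by simp
qed simp

text \<open>Of the two factors in the denominator, the larger one is at least \<open>sqrt ((k + 2) / 2)\<close>.\<close>
lemma sum_inverse_sqrt_convolution_le:
  "(\<Sum>j\<le>k. 1 / (sqrt (real j + 1) * sqrt (real (k - j) + 1))) \<le> 8"
proof -
  define s where "s = sqrt (2 / (real k + 2))"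
  have "(\<Sum>j\<le>k. 1 / (sqrt (real j + 1) * sqrt (real (k - j) + 1))) \<le>
     (\<Sum>j\<le>k. s * (1 / sqrt (real j + 1) + 1 / sqrt (real (k - j) + 1)))"
  proof (intro sum_mono)
    fix j assume "j \<in> {..k}"
    define a b where "a = real j + 1" and "b = real (k - j) + 1"
    have ab: "a > 0" "b > 0" "a + b = real k + 2" using \<open>j \<in> {..k}\<close> by (auto simp: a_def b_def)
    have *: "1 / (sqrt a * sqrt b) \<le> s * (1 / sqrt a)" if "a > 0" "b > 0" "a + b = real k + 2" "a \<le> b" for a b
    proof -
      have "1 / b \<le> 2 / (real k + 2)" using that by (simp add: field_simps)
      then have "sqrt (1 / b) \<le> s" unfolding s_def by simp
      then have "sqrt (1 / b) * (1 / sqrt a) \<le> s * (1 / sqrt a)" using that by (intro mult_right_mono) auto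
      then show ?thesis by (simp add: real_sqrt_divide mult.commute)
    qed
    have s0: "s \<ge> 0" by (simp add: s_def)
    show "1 / (sqrt (real j + 1) * sqrt (real (k - j) + 1)) \<le>
        s * (1 / sqrt (real j + 1) + 1 / sqrt (real (k - j) + 1))"
      unfolding a_def[symmetric] b_def[symmetric]
    proof (cases "a \<le> b")
      case True
      have "s * (1 / sqrt b) \<ge> 0" using s0 ab by simp
      then show "1 / (sqrt a * sqrt b) \<le> s * (1 / sqrt a + 1 / sqrt b)"
        using *[OF ab True] by (simp add: distrib_left)
    next
      case False
      have "s * (1 / sqrt a) \<ge> 0" using s0 ab by simp
      then show "1 / (sqrt a * sqrt b) \<le> s * (1 / sqrt a + 1 / sqrt b)"
        using *[of b a] ab False by (simp add: distrib_left mult.commute)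
    qed
  qed
  also have "\<dots> = s * ((\<Sum>j\<le>k. 1 / sqrt (real j + 1)) + (\<Sum>j\<le>k. 1 / sqrt (real (k - j) + 1)))"
    by (simp only: sum_distrib_left sum.distrib[symmetric])
  also have "(\<Sum>j\<le>k. 1 / sqrt (real (k - j) + 1)) = (\<Sum>j\<le>k. 1 / sqrt (real j + 1))"
    by (rule sum.reindex_bij_witness[of _ "\<lambda>j. k - j" "\<lambda>j. k - j"]) auto
  also have "s * ((\<Sum>j\<le>k. 1 / sqrt (real j + 1)) + (\<Sum>j\<le>k. 1 / sqrt (real j + 1))) \<le>
      s * (2 * sqrt (real k + 1) + 2 * sqrt (real k + 1))"
    by (intro mult_left_mono add_mono sum_inverse_sqrt_le) (simp add: s_def)
  also have "\<dots> = 4 * sqrt (2 / (real k + 2) * (real k + 1))"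
  proof -
    have "u * (2 * v + 2 * v) = 4 * (u * v)" for u v :: real by simp
    then show ?thesis unfolding s_def real_sqrt_mult .
  qed
  also have "\<dots> \<le> 4 * sqrt 4"
    by (intro mult_left_mono real_sqrt_le_mono) (auto simp: field_simps)
  finally show ?thesis by simp
qed

section \<open>Blocks of primes\<close>

lemma prime_recip_sum_mono: "m \<le> n \<Longrightarrow> prime_recip_sum m \<le> prime_recip_sum n"
  unfolding prime_recip_sum_def by (intro sum_mono2) auto

lemma prime_recip_sum_Suc:
  "prime_recip_sum (Suc n) = prime_recip_sum n + (if prime (Suc n) then 1 / real (Suc n) else 0)"
  unfolding prime_recip_sum_def by (rule sum_primes_le_Suc)

lemma prime_recip_sum_0 [simp]: "prime_recip_sum 0 = 0" "prime_recip_sum (Suc 0) = 0"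
proof -
  have "primes_le (Suc 0) = {}" by auto
  then show "prime_recip_sum 0 = 0" "prime_recip_sum (Suc 0) = 0"
    by (simp_all add: prime_recip_sum_def)
qed

lemma prime_recip_sum_unbounded: "\<exists>n. prime_recip_sum n > b"
proof -
  obtain M where M: "M > 0" "\<And>n. n \<ge> 2 \<Longrightarrow> \<bar>prime_recip_sum n - ln (ln (real n))\<bar> \<le> M"
    using mertens_second by blast
  define n where "n = max 2 (nat \<lceil>exp (exp (b + M + 1))\<rceil>)"
  have "exp (exp (b + M + 1)) \<le> real n" unfolding n_def by linarith
  then have "ln (exp (exp (b + M + 1))) \<le> ln (real n)" by (subst ln_le_cancel_iff) (auto simp: n_def)
  then have "exp (b + M + 1) \<le> ln (real n)" by simp
  then have "ln (exp (b + M + 1)) \<le> ln (ln (real n))" by (intro ln_mono) (auto intro: less_le_trans[OF exp_gt_zero])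
  then have "b + M + 1 \<le> ln (ln (real n))" by simp
  then show ?thesis using M(2)[of n] by (intro exI[of _ n]) (auto simp: n_def abs_le_iff)
qed

text \<open>The thresholds for \<^const>\<open>prime_recip_sum\<close> that separate the blocks. The bounded correction
  to \<open>j / beta\<close> makes every block sum at least \<open>1 / beta\<close>, although a block can only end at a prime.\<close>
definition tau :: "nat \<Rightarrow> real" where "tau j = real j / beta + 2 - 2 * (1/2) ^ j"

definition cutoff :: "nat \<Rightarrow> nat" where
  "cutoff j = (GREATEST n. prime_recip_sum n \<le> tau j)"

lemma tau_nonneg: "tau j \<ge> 0"
proof -
  have "(1/2::real) ^ j \<le> 1" by (rule power_le_one) auto
  moreover have "real j / beta \<ge> 0" using beta_bounds by simp
  ultimately show ?thesis unfolding tau_def by linarith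
qed

lemma tau_ge: "tau j \<ge> real j / beta" and tau_le: "tau j \<le> real j / beta + 2"
proof -
  have "(1/2::real) ^ j \<le> 1" by (rule power_le_one) auto
  then show "tau j \<ge> real j / beta" unfolding tau_def by linarith
  have "(1/2::real) ^ j \<ge> 0" by simp
  then show "tau j \<le> real j / beta + 2" unfolding tau_def by linarith
qed

lemma real_le_over_beta: "real j \<le> real j / beta"
  using beta_bounds by (simp add: le_divide_eq mult_left_le)

lemma cutoff_iff: "prime_recip_sum n \<le> tau j \<longleftrightarrow> n \<le> cutoff j"
proof -
  obtain n0 where n0: "prime_recip_sum n0 > tau j" using prime_recip_sum_unbounded by blast
  have bnd: "\<forall>n. prime_recip_sum n \<le> tau j \<longrightarrow> n \<le> n0"
    using n0 prime_recip_sum_mono by (metis le_cases not_le order.trans)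
  have "prime_recip_sum 0 \<le> tau j" using tau_nonneg by simp
  from GreatestI_nat[of "\<lambda>n. prime_recip_sum n \<le> tau j", OF this bnd[rule_format]]
  have 1: "prime_recip_sum (cutoff j) \<le> tau j" unfolding cutoff_def .
  show ?thesis
  proof
    assume "prime_recip_sum n \<le> tau j"
    then show "n \<le> cutoff j" unfolding cutoff_def using bnd by (intro Greatest_le_nat) auto
  next
    assume "n \<le> cutoff j"
    then show "prime_recip_sum n \<le> tau j" using 1 prime_recip_sum_mono order.trans by blast
  qed
qed

lemma cutoff_mono: "i \<le> j \<Longrightarrow> cutoff i \<le> cutoff j"
proof -
  assume ij: "i \<le> j"
  have "real i / beta \<le> real j / beta" using ij beta_bounds by (intro divide_right_mono) auto
  moreover have "(1/2::real) ^ j \<le> (1/2) ^ i" using ij by (intro power_decreasing) auto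
  ultimately have "tau i \<le> tau j" unfolding tau_def by linarith
  then show "cutoff i \<le> cutoff j" using cutoff_iff order.trans by blast
qed

lemma prime_recip_sum_cutoff_le: "prime_recip_sum (cutoff j) \<le> tau j"
  using cutoff_iff by blast

text \<open>The integer after the cutoff exceeds the threshold, and \<open>prime_recip_sum n \<le> ln n\<close> shows that it is at least
  \<open>2 ^ j\<close>; so the sum falls short of the threshold by at most \<open>(1/2) ^ j\<close>.\<close>
lemma prime_recip_sum_cutoff_ge: "prime_recip_sum (cutoff j) \<ge> tau j - (1/2) ^ j"
proof -
  define n where "n = cutoff j"
  have gt: "prime_recip_sum (Suc n) > tau j" using cutoff_iff[of "Suc n" j] by (simp add: n_def)
  have "prime_recip_sum (Suc n) \<le> ln (real (Suc n))" by (rule prime_recip_sum_le_ln) simp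
  then have "real j < ln (real (Suc n))" using gt tau_ge[of j] real_le_over_beta[of j] by linarith
  then have "exp (real j) < exp (ln (real (Suc n)))" by (subst exp_less_cancel_iff)
  then have "exp (real j) < real (Suc n)" by (subst (asm) exp_ln) auto
  moreover have "exp (real j) = exp 1 ^ j" by (simp flip: exp_of_nat_mult)
  moreover have "(2::real) ^ j \<le> exp 1 ^ j"
    using exp_ge_add_one_self[of "1::real"] by (intro power_mono) auto
  ultimately have "2 ^ j \<le> real (Suc n)" by linarith
  then have "1 / real (Suc n) \<le> 1 / 2 ^ j" by (intro divide_left_mono) auto
  moreover have "prime_recip_sum (Suc n) \<le> prime_recip_sum n + 1 / real (Suc n)"
    unfolding prime_recip_sum_Suc by auto
  ultimately show ?thesis using gt by (simp add: n_def power_one_over)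
qed

definition first_blocks :: "nat \<Rightarrow> nat set" where "first_blocks j = primes_le (cutoff j)"

lemma mem_first_blocks [simp]: "p \<in> first_blocks j \<longleftrightarrow> prime p \<and> p \<le> cutoff j"
  by (auto simp: first_blocks_def Suc_le_eq prime_gt_0_nat)

lemma finite_first_blocks [simp]: "finite (first_blocks j)"
  by (simp add: first_blocks_def)

definition bin_sum :: "nat \<Rightarrow> real" where
  "bin_sum j = prime_recip_sum (cutoff (Suc j)) - prime_recip_sum (cutoff j)"

lemma sum_recip_block_diff:
  "i \<le> j \<Longrightarrow> (\<Sum>p\<in>first_blocks j - first_blocks i. 1 / real p) =
     prime_recip_sum (cutoff j) - prime_recip_sum (cutoff i)"
  unfolding prime_recip_sum_def first_blocks_def using cutoff_mono[of i j] by (intro sum_diff) auto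

text \<open>The increments of the thresholds exceed \<open>1 / beta\<close> by more than the possible loss at the upper end.\<close>
lemma bin_sum_ge: "bin_sum j \<ge> 1 / beta"
proof -
  have "tau (Suc j) - tau j = 1 / beta + (1/2) ^ j"
    unfolding tau_def by (simp add: add_divide_distrib)
  moreover have "(1/2::real) ^ Suc j \<le> (1/2) ^ j" by simp
  ultimately show ?thesis
    using prime_recip_sum_cutoff_ge[of "Suc j"] prime_recip_sum_cutoff_le[of j]
    unfolding bin_sum_def by linarith
qed

text \<open>The reciprocals \<open>1 / p\<close>, reduced on each block by a constant factor so that every block sums to exactly
  \<open>1 / beta\<close>.\<close>
definition tilted :: "nat \<Rightarrow> real" where
  "tilted p = (1 / beta) / (real p * bin_sum (LEAST j. p \<in> first_blocks (Suc j)))"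

lemma block_least:
  assumes "p \<in> first_blocks (Suc j) - first_blocks j"
  shows "(LEAST j. p \<in> first_blocks (Suc j)) = j"
proof (rule Least_equality)
  fix i assume i: "p \<in> first_blocks (Suc i)"
  show "j \<le> i"
  proof (rule ccontr)
    assume "\<not> j \<le> i"
    then have "cutoff (Suc i) \<le> cutoff j" by (intro cutoff_mono) auto
    then show False using i assms by auto
  qed
qed (use assms in auto)

lemma tilted_bounds: "0 \<le> tilted p" "tilted p \<le> 1 / real p"
proof -
  define b where "b = bin_sum (LEAST j. p \<in> first_blocks (Suc j))"
  have b: "b \<ge> 1 / beta" "1 / beta > 0" unfolding b_def using bin_sum_ge beta_bounds by auto
  then have b0: "b > 0" by linarith
  show "0 \<le> tilted p" unfolding tilted_def b_def[symmetric] using b0 b(2) by simp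
  have "(1 / beta) / b \<le> 1" using b b0 by (subst divide_le_eq_1_pos) auto
  then have "(1 / beta) / b * (1 / real p) \<le> 1 * (1 / real p)" by (intro mult_right_mono) auto
  then show "tilted p \<le> 1 / real p" unfolding tilted_def b_def[symmetric] by (simp add: mult_ac)
qed

lemma first_blocks_0: "first_blocks 0 = {}"
proof -
  have "p \<notin> first_blocks 0" for p
  proof
    assume p: "p \<in> first_blocks 0"
    then have "p \<le> cutoff 0" by auto
    then have "prime_recip_sum p \<le> tau 0" by (simp add: cutoff_iff)
    then have "prime_recip_sum p \<le> 0" by (simp add: tau_def)
    moreover obtain n where "p = Suc n" using p prime_gt_0_nat by (cases p) auto
    then have "prime_recip_sum p = prime_recip_sum n + 1 / real p" using p by (simp add: prime_recip_sum_Suc)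
    moreover have "prime_recip_sum n \<ge> 0" unfolding prime_recip_sum_def by (intro sum_nonneg) auto
    moreover have "1 / real p > 0" using p prime_gt_0_nat by simp
    ultimately show False by linarith
  qed
  then show ?thesis by blast
qed

interpretation bins: ballot_bins first_blocks tilted "1 / beta"
proof
  fix j
  show "finite (first_blocks j)" by simp
  show "first_blocks 0 = {}" by (rule first_blocks_0)
  show "first_blocks j \<subseteq> first_blocks (Suc j)" using cutoff_mono[of j "Suc j"] by auto
  have "(\<Sum>p\<in>first_blocks (Suc j) - first_blocks j. tilted p) =
      (\<Sum>p\<in>first_blocks (Suc j) - first_blocks j. (1 / beta) / bin_sum j * (1 / real p))"
    by (intro sum.cong refl) (simp only: tilted_def block_least, simp add: mult.commute)
  also have "\<dots> = (1 / beta) / bin_sum j * bin_sum j"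
    unfolding sum_distrib_left[symmetric] bin_sum_def by (subst sum_recip_block_diff) auto
  also have "\<dots> = 1 / beta"
    using bin_sum_ge[of j] beta_bounds
    by (smt (verit) divide_pos_pos nonzero_eq_divide_eq)
  finally show "(\<Sum>p\<in>first_blocks (Suc j) - first_blocks j. tilted p) = 1 / beta" .
qed

abbreviation recip_weight :: "nat multiset \<Rightarrow> real" where
  "recip_weight \<equiv> poisson_weight (\<lambda>p. 1 / real p)"

abbreviation gcd_weight :: "nat multiset \<Rightarrow> nat multiset \<Rightarrow> real" where
  "gcd_weight M M' \<equiv> real (gcd (prod_mset M) (prod_mset M')) * recip_weight M * recip_weight M'"

lemma recip_weight_nonneg: "recip_weight M \<ge> 0"
  by (intro poisson_weight_nonneg) auto

lemma recip_weight_union_le: "recip_weight (A + B) \<le> recip_weight A * recip_weight B"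
  by (intro poisson_weight_union_le) auto

text \<open>In the gcd form the common part \<open>D\<close> occurs with weight \<open>prod_mset D * recip_weight D ^ 2\<close>; by this bound
  one factor \<^term>\<open>recip_weight D\<close> suffices.\<close>
lemma prod_mset_mult_recip_weight_le:
  "real (prod_mset D) * recip_weight D \<le> 1" if "\<And>p. p \<in># D \<Longrightarrow> prime p" for D :: "nat multiset"
proof -
  have "real (prod_mset D) = (\<Prod>p\<in>set_mset D. real p ^ count D p)"
    by (simp add: prod_mset_multiplicity)
  then have "real (prod_mset D) * recip_weight D =
      (\<Prod>p\<in>set_mset D. real p ^ count D p * ((1 / real p) ^ count D p / fact (count D p)))"
    by (simp only: poisson_weight_def prod.distrib)
  also have "\<dots> \<le> (\<Prod>p\<in>set_mset D. 1)"
  proof (intro prod_mono conjI)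
    fix p assume "p \<in> set_mset D"
    then have "real p > 0" using that prime_gt_0_nat by auto
    then have "real p ^ count D p * ((1 / real p) ^ count D p / fact (count D p)) = 1 / fact (count D p)"
      by (simp add: power_one_over)
    also have "\<dots> \<le> 1" by (simp add: fact_ge_1)
    finally show "real p ^ count D p * ((1 / real p) ^ count D p / fact (count D p)) \<le> 1" .
  qed auto
  finally show ?thesis by simp
qed

lemma gcd_prod_mset_primes:
  fixes A B :: "nat multiset"
  assumes "\<And>p. p \<in># A \<Longrightarrow> prime p" "\<And>p. p \<in># B \<Longrightarrow> prime p"
  shows "gcd (prod_mset A) (prod_mset B) = prod_mset (A \<inter># B)"
proof -
  have nz: "prod_mset A \<noteq> 0" "prod_mset B \<noteq> 0" using assms by (metis not_prime_0 prod_mset_zero_iff)+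
  have "prime_factorization (gcd (prod_mset A) (prod_mset B)) = A \<inter># B"
    using nz assms by (simp add: prime_factorization_gcd prime_factorization_prod_mset_primes)
  then have "prod_mset (prime_factorization (gcd (prod_mset A) (prod_mset B))) = prod_mset (A \<inter># B)" by simp
  then show ?thesis using nz by (simp add: prod_mset_prime_factorization_nat)
qed

lemma gcd_weight_le:
  fixes M M' :: "nat multiset"
  assumes "\<And>p. p \<in># M \<Longrightarrow> prime p" "\<And>p. p \<in># M' \<Longrightarrow> prime p"
  shows "gcd_weight M M' \<le>
     recip_weight (M \<inter># M') * recip_weight (M - M') * recip_weight (M' - M)"
proof -
  define D where "D = M \<inter># M'"
  have M: "M = D + (M - M')" "M' = D + (M' - M)"
    unfolding D_def by (auto simp: multiset_eq_iff)
  have "recip_weight M \<le> recip_weight D * recip_weight (M - M')"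
    using recip_weight_union_le[of D "M - M'"] M(1) by simp
  moreover have "recip_weight M' \<le> recip_weight D * recip_weight (M' - M)"
    using recip_weight_union_le[of D "M' - M"] M(2) by simp
  ultimately have "recip_weight M * recip_weight M' \<le>
      (recip_weight D * recip_weight (M - M')) * (recip_weight D * recip_weight (M' - M))"
    by (intro mult_mono mult_nonneg_nonneg recip_weight_nonneg)
  then have "real (prod_mset D) * (recip_weight M * recip_weight M') \<le>
      real (prod_mset D) * ((recip_weight D * recip_weight (M - M')) * (recip_weight D * recip_weight (M' - M)))"
    by (rule mult_left_mono) simp
  also have "\<dots> = (real (prod_mset D) * recip_weight D) * (recip_weight D * recip_weight (M - M') * recip_weight (M' - M))"
    by (simp only: mult_ac)
  also have "\<dots> \<le> 1 * (recip_weight D * recip_weight (M - M') * recip_weight (M' - M))"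
    using assms by (intro mult_right_mono prod_mset_mult_recip_weight_le mult_nonneg_nonneg recip_weight_nonneg)
      (auto simp: D_def)
  finally show ?thesis using gcd_prod_mset_primes[OF assms] by (simp add: D_def mult.assoc)
qed

lemma sum_UN_le:
  fixes f :: "'b \<Rightarrow> real"
  assumes "finite I" "\<And>i. i \<in> I \<Longrightarrow> finite (X i)" "\<And>x. f x \<ge> 0"
  shows "(\<Sum>x\<in>(\<Union>i\<in>I. X i). f x) \<le> (\<Sum>i\<in>I. \<Sum>x\<in>X i. f x)"
  using assms(1,2)
proof (induction I rule: finite_induct)
  case (insert i I)
  have "(\<Sum>x\<in>X i \<union> (\<Union>i\<in>I. X i). f x) + (\<Sum>x\<in>X i \<inter> (\<Union>i\<in>I. X i). f x) =
      (\<Sum>x\<in>X i. f x) + (\<Sum>x\<in>(\<Union>i\<in>I. X i). f x)"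
    using insert by (intro sum.union_inter) auto
  moreover have "(\<Sum>x\<in>X i \<inter> (\<Union>i\<in>I. X i). f x) \<ge> 0" using assms(3) by (intro sum_nonneg)
  ultimately show ?case using insert by auto
qed simp

text \<open>A pair is determined by its common part and the two remainders.\<close>
lemma sum_pairs_le:
  fixes P :: "(nat multiset \<times> nat multiset) set"
  assumes "finite P" "\<And>M M'. (M, M') \<in> P \<Longrightarrow> (\<forall>p\<in>#M. prime p) \<and> (\<forall>p\<in>#M'. prime p)"
      "finite Q" "\<And>M M'. (M, M') \<in> P \<Longrightarrow> (M \<inter># M', M - M', M' - M) \<in> Q"
  shows "(\<Sum>(M,M')\<in>P. gcd_weight M M')
     \<le> (\<Sum>(D,A,B)\<in>Q. recip_weight D * recip_weight A * recip_weight B)"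
proof -
  define dec where "dec = (\<lambda>(M,M'). (M \<inter># M', M - M', M' - M) :: nat multiset \<times> nat multiset \<times> nat multiset)"
  have inj: "inj_on dec P"
  proof (rule inj_onI, clarify)
    fix M M' L L' assume "dec (M, M') = dec (L, L')"
    then have eq: "M \<inter># M' = L \<inter># L'" "M - M' = L - L'" "M' - M = L' - L" by (auto simp: dec_def)
    have "X = (X \<inter># Y) + (X - Y)" "Y = (X \<inter># Y) + (Y - X)" for X Y :: "nat multiset"
      by (auto simp: multiset_eq_iff)
    then show "M = L \<and> M' = L'" using eq by metis
  qed
  have "(\<Sum>(M,M')\<in>P. gcd_weight M M')
    \<le> (\<Sum>x\<in>P. (\<lambda>(D,A,B). recip_weight D * recip_weight A * recip_weight B) (dec x))"
    using gcd_weight_le assms(2) by (intro sum_mono) (auto simp: dec_def)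
  also have "\<dots> = (\<Sum>(D,A,B)\<in>dec ` P. recip_weight D * recip_weight A * recip_weight B)"
    by (simp add: sum.reindex[OF inj])
  also have "\<dots> \<le> (\<Sum>(D,A,B)\<in>Q. recip_weight D * recip_weight A * recip_weight B)"
    using assms(3,4) by (intro sum_mono2) (auto simp: dec_def intro!: mult_nonneg_nonneg recip_weight_nonneg)
  finally show ?thesis .
qed

section \<open>Pairs of comparable size at a given scale\<close>

abbreviation yb :: real where "yb \<equiv> yfun beta"

lemma prod_mset_primes_pos: "(\<And>p. p \<in># B \<Longrightarrow> prime p) \<Longrightarrow> prod_mset B > 0" for B :: "nat multiset"
  by (metis gr0I not_prime_0 prod_mset_zero_iff)

text \<open>Multiplicatively short intervals carry a bounded amount of \<open>ln p / p\<close>.\<close>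
lemma sum_ln_over_prime_window:
  "\<exists>C>0. \<forall>K n0 n1. K \<ge> 1 \<and> real n1 \<le> K * (real n0 + 1) \<longrightarrow>
     (\<Sum>p\<in>primes_le n1 - primes_le n0. ln (real p) / real p) \<le> ln K + C"
proof -
  obtain C where C: "C > 0"
    "\<And>n. n \<ge> 1 \<Longrightarrow> \<bar>ln_prime_sum n - ln (real n)\<bar> \<le> C"
    using mertens_first by blast
  show ?thesis
  proof (intro exI[of _ "2 * C + 1"] conjI allI impI)
    show "2 * C + 1 > 0" using C by simp
    fix K :: real and n0 n1 :: nat assume K: "K \<ge> 1 \<and> real n1 \<le> K * (real n0 + 1)"
    show "(\<Sum>p\<in>primes_le n1 - primes_le n0. ln (real p) / real p) \<le> ln K + (2 * C + 1)"
    proof (cases "n1 \<le> n0")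
      case True
      then have e: "primes_le n1 - primes_le n0 = {}" by auto
      have "ln K \<ge> 0" using K by simp
      then show ?thesis unfolding e using C(1) by simp
    next
      case False
      then have "(\<Sum>p\<in>primes_le n1 - primes_le n0. ln (real p) / real p) =
          ln_prime_sum n1 - ln_prime_sum n0"
        by (intro sum_diff) auto
      moreover have "ln_prime_sum n1 \<le> ln (real n1) + C"
        using C(2)[of n1] False by (auto simp: abs_le_iff)
      moreover have "ln_prime_sum n0 \<ge> ln (real n0 + 1) - 1 - C"
      proof (cases "n0 = 0")
        case True
        then show ?thesis using C by simp
      next
        case False
        have "ln (real n0 + 1) - ln (real n0) \<le> (real n0 + 1 - real n0) / real n0"
          using False by (intro ln_diff_le) auto
        also have "\<dots> \<le> 1" using False by simp
        finally show ?thesis using C(2)[of n0] False by (auto simp: abs_le_iff)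
      qed
      moreover have "ln (real n1) \<le> ln (K * (real n0 + 1))"
        using K False by (intro ln_mono) auto
      moreover have "ln (K * (real n0 + 1)) = ln K + ln (real n0 + 1)"
        using K by (intro ln_mult_pos) auto
      ultimately show ?thesis by linarith
    qed
  qed
qed

lemma ln_prod_mset:
  "(\<And>p. p \<in># M \<Longrightarrow> p > 0) \<Longrightarrow> ln (real (prod_mset M)) = (\<Sum>p\<in>#M. ln (real p))" for M :: "nat multiset"
proof (induction M)
  case (add p M)
  have "prod_mset M > 0" using add.prems by (intro Nat.gr0I) (auto simp: prod_mset_zero_iff)
  moreover have "p > 0" using add.prems by simp
  ultimately have "ln (real (prod_mset (add_mset p M))) = ln (real p) + ln (real (prod_mset M))"
    by (subst ln_mult_pos[symmetric]) auto
  then show ?case using add by simp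
qed simp

text \<open>The Hall-Tenenbaum device for multisets of fixed size: \<open>ln (prod_mset B)\<close> is additive, so size-biasing
  marks a prime of \<open>B\<close>, and given the rest of \<open>B\<close> this prime is confined to a short window.\<close>
lemma sum_window_ln_weight_le:
  "\<exists>C>0. \<forall>\<kappa>\<ge>1. \<forall>F a n. finite F \<and> (\<forall>p\<in>F. prime p) \<and> a \<ge> 1 \<longrightarrow>
    (\<Sum>B\<in>{B\<in>multisets_of_size F (Suc n). a < \<kappa> * prod_mset B \<and> prod_mset B < \<kappa> * a}.
        recip_weight B * ln (real (prod_mset B)))
     \<le> (2 * ln (real \<kappa>) + C) * ((\<Sum>p\<in>F. 1 / real p) ^ n / fact n)"
proof -
  obtain C where C: "C > 0" "\<And>K n0 n1. K \<ge> 1 \<Longrightarrow> real n1 \<le> K * (real n0 + 1) \<Longrightarrow>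
     (\<Sum>p\<in>primes_le n1 - primes_le n0. ln (real p) / real p) \<le> ln K + C"
    using sum_ln_over_prime_window by blast
  show ?thesis
  proof (intro exI[of _ C] conjI allI impI C(1))
    fix \<kappa> :: nat and F :: "nat set" and a n :: nat
    assume \<kappa>: "\<kappa> \<ge> 1" and F: "finite F \<and> (\<forall>p\<in>F. prime p) \<and> a \<ge> 1"
    have finF: "finite F" using F by blast
    define win where "win = (\<lambda>b. a < \<kappa> * b \<and> b < \<kappa> * a)"
    define \<A> where "\<A> = {B\<in>multisets_of_size F (Suc n). win (prod_mset B)}"
    have fin: "finite \<A>" "finite (multisets_of_size F n)"
      unfolding \<A>_def using finite_multisets_of_size[OF finF] by simp_all
    have pos: "prod_mset B > 0" if "set_mset B \<subseteq> F" for B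
      using F that by (intro prod_mset_primes_pos) auto
    have "(\<Sum>B\<in>\<A>. recip_weight B * ln (real (prod_mset B))) =
        (\<Sum>B\<in>\<A>. recip_weight B * (\<Sum>p\<in>#B. ln (real p)))"
    proof (intro sum.cong refl)
      fix B assume "B \<in> \<A>"
      then have "set_mset B \<subseteq> F" by (auto simp: \<A>_def multisets_of_size_def)
      then have "p > 0" if "p \<in># B" for p using F that prime_gt_0_nat by blast
      then show "recip_weight B * ln (real (prod_mset B)) = recip_weight B * (\<Sum>p\<in>#B. ln (real p))"
        by (subst ln_prod_mset) auto
    qed
    also have "\<dots> = (\<Sum>p\<in>F. ln (real p) * (1 / real p) * (\<Sum>B\<in>{B. add_mset p B \<in> \<A>}. recip_weight B))"
      using fin F by (intro sum_additive_poisson_weight) (auto simp: \<A>_def multisets_of_size_def)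
    also have "\<dots> = (\<Sum>p\<in>F. \<Sum>B\<in>multisets_of_size F n. if win (p * prod_mset B) then recip_weight B * (ln (real p) / real p) else 0)"
    proof (intro sum.cong refl)
      fix p assume p: "p \<in> F"
      have "{B. add_mset p B \<in> \<A>} = {B\<in>multisets_of_size F n. win (p * prod_mset B)}"
        using p by (auto simp: \<A>_def multisets_of_size_def)
      then have "(\<Sum>B\<in>{B. add_mset p B \<in> \<A>}. recip_weight B) =
          (\<Sum>B\<in>{B\<in>multisets_of_size F n. win (p * prod_mset B)}. recip_weight B)" by simp
      also have "\<dots> = (\<Sum>B\<in>multisets_of_size F n. if win (p * prod_mset B) then recip_weight B else 0)"
        using fin by (intro sum.inter_filter)
      finally show "ln (real p) * (1 / real p) * (\<Sum>B\<in>{B. add_mset p B \<in> \<A>}. recip_weight B) =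
         (\<Sum>B\<in>multisets_of_size F n. if win (p * prod_mset B) then recip_weight B * (ln (real p) / real p) else 0)"
        by (auto simp: sum_distrib_left intro!: sum.cong)
    qed
    also have "\<dots> = (\<Sum>B\<in>multisets_of_size F n. \<Sum>p\<in>F. if win (p * prod_mset B) then recip_weight B * (ln (real p) / real p) else 0)"
      by (rule sum.swap)
    also have "\<dots> \<le> (\<Sum>B\<in>multisets_of_size F n. recip_weight B * (2 * ln (real \<kappa>) + C))"
    proof (rule sum_mono)
      fix B assume B: "B \<in> multisets_of_size F n"
      define b where "b = prod_mset B"
      have b: "b > 0" unfolding b_def using B by (intro pos) (auto simp: multisets_of_size_def)
      define n0 n1 where "n0 = a div (\<kappa> * b)" and "n1 = \<kappa> * a div b"
      have "(\<Sum>p\<in>F. if win (p * b) then recip_weight B * (ln (real p) / real p) else 0) =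
          recip_weight B * (\<Sum>p\<in>{p\<in>F. win (p * b)}. ln (real p) / real p)"
        by (subst sum.inter_filter[OF finF]) (auto simp: sum_distrib_left intro!: sum.cong)
      also have "\<dots> \<le> recip_weight B * (\<Sum>p\<in>primes_le n1 - primes_le n0. ln (real p) / real p)"
      proof (intro mult_left_mono sum_mono2 recip_weight_nonneg)
        show "{p\<in>F. win (p * b)} \<subseteq> primes_le n1 - primes_le n0"
        proof
          fix p assume "p \<in> {p\<in>F. win (p * b)}"
          then have p: "prime p" "a < \<kappa> * (p * b)" "p * b < \<kappa> * a" using F by (auto simp: win_def)
          have "p \<le> n1" unfolding n1_def using p(3) b by (simp add: less_eq_div_iff_mult_less_eq)
          moreover have "n0 < p" unfolding n0_def using p(2) b \<kappa> by (simp add: div_less_iff_less_mult mult_ac)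
          moreover have "p \<ge> 1" using p(1) prime_ge_1_nat by blast
          ultimately show "p \<in> primes_le n1 - primes_le n0" using p(1) by auto
        qed
        show "0 \<le> ln (real p) / real p" if "p \<in> primes_le n1 - primes_le n0 - {p\<in>F. win (p * b)}" for p
          using that by (intro divide_nonneg_nonneg) auto
      qed auto
      also have "\<dots> \<le> recip_weight B * (ln ((real \<kappa>)\<^sup>2) + C)"
      proof (intro mult_left_mono C(2) recip_weight_nonneg)
        show "1 \<le> (real \<kappa>)\<^sup>2" using \<kappa> by simp
        have "a < (n0 + 1) * (\<kappa> * b)"
          unfolding n0_def using dividend_less_times_div[of "\<kappa> * b" a] \<kappa> b by (simp add: mult.commute)
        then have "real a \<le> real ((n0 + 1) * (\<kappa> * b))" by (intro of_nat_mono) auto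
        then have a: "real a \<le> (real n0 + 1) * (real \<kappa> * real b)" by (simp add: distrib_right)
        have "real n1 \<le> real (\<kappa> * a) / real b" unfolding n1_def by (rule of_nat_div_le_of_nat)
        also have "\<dots> \<le> real \<kappa> * ((real n0 + 1) * (real \<kappa> * real b)) / real b"
          unfolding of_nat_mult using a by (intro divide_right_mono mult_left_mono) auto
        also have "\<dots> = (real \<kappa>)\<^sup>2 * (real n0 + 1)" using b by (simp add: power2_eq_square)
        finally show "real n1 \<le> (real \<kappa>)\<^sup>2 * (real n0 + 1)" .
      qed
      also have "ln ((real \<kappa>)\<^sup>2) = 2 * ln (real \<kappa>)" using \<kappa> by (simp add: ln_realpow)
      finally show "(\<Sum>p\<in>F. if win (p * prod_mset B) then recip_weight B * (ln (real p) / real p) else 0)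
          \<le> recip_weight B * (2 * ln (real \<kappa>) + C)" unfolding b_def .
    qed
    also have "\<dots> = (2 * ln (real \<kappa>) + C) * ((\<Sum>p\<in>F. 1 / real p) ^ n / fact n)"
      by (simp only: sum_distrib_right[symmetric] sum_poisson_weight_multisets_of_size[OF finF] mult.commute)
    finally show "(\<Sum>B\<in>{B\<in>multisets_of_size F (Suc n). a < \<kappa> * prod_mset B \<and> prod_mset B < \<kappa> * a}.
        recip_weight B * ln (real (prod_mset B))) \<le> (2 * ln (real \<kappa>) + C) * ((\<Sum>p\<in>F. 1 / real p) ^ n / fact n)"
      unfolding \<A>_def win_def .
  qed
qed

lemma sum_block: "(\<Sum>p\<in>first_blocks j. 1 / real p) = prime_recip_sum (cutoff j)"
  by (simp add: prime_recip_sum_def first_blocks_def)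

lemma block_sum_bounds:
  "0 \<le> prime_recip_sum (cutoff j)" "prime_recip_sum (cutoff j) \<le> real j / beta + 2"
proof -
  show "0 \<le> prime_recip_sum (cutoff j)" unfolding prime_recip_sum_def by (intro sum_nonneg) auto
  show "prime_recip_sum (cutoff j) \<le> real j / beta + 2"
    using prime_recip_sum_cutoff_le[of j] tau_le[of j] by linarith
qed

text \<open>Pairs of equally large multisets of primes from the first \<open>j\<close> blocks whose products are comparable and have
  a logarithm of at least the order \<open>exp (j / beta)\<close> of the logarithm of the largest primes in these blocks.\<close>
definition close_pairs :: "nat \<Rightarrow> real \<Rightarrow> nat \<Rightarrow> nat \<Rightarrow> (nat multiset \<times> nat multiset) set" where
  "close_pairs \<kappa> C j m = {(A,B). A \<in> multisets_of_size (first_blocks j) m \<and> B \<in> multisets_of_size (first_blocks j) m \<and>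
      prod_mset A < \<kappa> * prod_mset B \<and> prod_mset B < \<kappa> * prod_mset A \<and>
      exp (real j / beta) \<le> C * (1 + ln (real (prod_mset B)))}"

abbreviation close_sum :: "nat \<Rightarrow> real \<Rightarrow> nat \<Rightarrow> nat \<Rightarrow> real" where
  "close_sum \<kappa> C j m \<equiv> (\<Sum>(A,B)\<in>close_pairs \<kappa> C j m. recip_weight A * recip_weight B)"

text \<open>For fixed \<open>A\<close> the condition that \<open>prod_mset B\<close> is comparable to \<open>prod_mset A\<close> saves a factor
  \<open>ln (prod_mset B)\<close>, that is, \<open>exp (j / beta)\<close>; having the same size as \<open>A\<close> saves \<open>sqrt (m + 1)\<close>, and on
  average over \<open>A\<close> the size \<open>m\<close> is of order \<open>j\<close>.\<close>
lemma sum_close_pairs_le: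
  assumes "\<kappa> \<ge> 1" "C0 > 0"
  shows "\<exists>C>0. \<forall>j n. (\<Sum>m\<le>n. (yb\<^sup>2) ^ m * close_sum \<kappa> C0 j m)
      \<le> C * exp ((2 * yb - 1) * (real j / beta)) / sqrt (real j + 1)"
proof -
  from sum_window_ln_weight_le obtain H where H: "H > 0 \<and> (\<forall>\<kappa>\<ge>1. \<forall>F a n. finite F \<and> (\<forall>p\<in>F. prime p) \<and> a \<ge> 1 \<longrightarrow>
    (\<Sum>B\<in>{B\<in>multisets_of_size F (Suc n). a < \<kappa> * prod_mset B \<and> prod_mset B < \<kappa> * a}.
        recip_weight B * ln (real (prod_mset B)))
     \<le> (2 * ln (real \<kappa>) + H) * ((\<Sum>p\<in>F. 1 / real p) ^ n / fact n))" ..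
  note H1 = conjunct1[OF H] and H2 = conjunct2[OF H]
  define H' where "H' = 2 * ln (real \<kappa>) + H"
  have H': "H' > 0" unfolding H'_def using H1 assms(1) by (intro add_nonneg_pos) auto
  note y = yfun_beta
  show ?thesis
  proof (intro exI[of _ "C0 * (1 + 2 * H') * exp (4 * yb) / sqrt yb"] conjI allI)
    show "C0 * (1 + 2 * H') * exp (4 * yb) / sqrt yb > 0"
      using assms H' y by (intro divide_pos_pos mult_pos_pos) auto
    fix j n
    define l where "l = prime_recip_sum (cutoff j)"
    define \<Lambda> where "\<Lambda> = real j / beta + 2"
    have l: "0 \<le> l" "l \<le> \<Lambda>" unfolding l_def \<Lambda>_def using block_sum_bounds by auto
    define E where "E = exp (- (real j / beta))"
    \<comment> \<open>What the sum over \<open>B\<close> contributes, up to the factor \<open>1 / sqrt (m + 1)\<close>.\<close>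
    define X where "X = C0 * E * (1 + 2 * H') * exp (yb * \<Lambda>)"
    have X0: "X \<ge> 0" unfolding X_def E_def using assms H' by simp
    define F where "F = first_blocks j"
    have F: "finite F" "\<forall>p\<in>F. prime p" by (auto simp: F_def)
    have lF: "(\<Sum>p\<in>F. 1 / real p) = l" unfolding F_def l_def by (rule sum_block)
    have hm: "(\<Sum>B\<in>multisets_of_size F i. recip_weight B) = l ^ i / fact i" for i
      by (simp only: sum_poisson_weight_multisets_of_size[OF F(1)] lF)
    have finms: "finite (multisets_of_size F m)" for m using F by (intro finite_multisets_of_size)
    have prd: "prod_mset A \<ge> 1" if "A \<in> multisets_of_size F m" for A m
    proof -
      have "prod_mset A > 0"
        using that F by (intro prod_mset_primes_pos) (auto simp: multisets_of_size_def)
      then show ?thesis by simp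
    qed
    have inner: "yb ^ m * (\<Sum>B\<in>{B. (A, B) \<in> close_pairs \<kappa> C0 j m}. recip_weight B) \<le> X / sqrt (real m + 1)"
      if A: "A \<in> multisets_of_size F m" for A m
    proof -
      define a where "a = prod_mset A"
      have a: "a \<ge> 1" unfolding a_def using prd[OF A] .
      define W where "W = {B\<in>multisets_of_size F m. a < \<kappa> * prod_mset B \<and> prod_mset B < \<kappa> * a}"
      have W: "finite W" unfolding W_def using finms by simp
      have lnB: "ln (real (prod_mset B)) \<ge> 0" if "B \<in> W" for B
        using prd[of B m] that by (auto simp: W_def)
      have "(\<Sum>B\<in>{B. (A, B) \<in> close_pairs \<kappa> C0 j m}. recip_weight B) \<le>
        (\<Sum>B\<in>{B. (A, B) \<in> close_pairs \<kappa> C0 j m}. C0 * E * (1 + ln (real (prod_mset B))) * recip_weight B)"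
      proof (rule sum_mono)
        fix B assume "B \<in> {B. (A, B) \<in> close_pairs \<kappa> C0 j m}"
        then have "exp (real j / beta) \<le> C0 * (1 + ln (real (prod_mset B)))" by (auto simp: close_pairs_def)
        then have "E * exp (real j / beta) \<le> E * (C0 * (1 + ln (real (prod_mset B))))"
          by (intro mult_left_mono) (auto simp: E_def)
        then have "1 \<le> C0 * E * (1 + ln (real (prod_mset B)))" by (simp add: E_def exp_minus mult_ac)
        then have "1 * recip_weight B \<le> C0 * E * (1 + ln (real (prod_mset B))) * recip_weight B"
          by (intro mult_right_mono recip_weight_nonneg)
        then show "recip_weight B \<le> C0 * E * (1 + ln (real (prod_mset B))) * recip_weight B" by simp
      qed
      also have "\<dots> \<le> (\<Sum>B\<in>W. C0 * E * (1 + ln (real (prod_mset B))) * recip_weight B)"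
        using assms lnB W
        by (intro sum_mono2 mult_nonneg_nonneg recip_weight_nonneg add_nonneg_nonneg)
           (auto simp: close_pairs_def W_def a_def E_def F_def)
      also have "\<dots> = C0 * E * ((\<Sum>B\<in>W. recip_weight B) + (\<Sum>B\<in>W. recip_weight B * ln (real (prod_mset B))))"
        by (simp add: sum_distrib_left sum.distrib[symmetric] algebra_simps)
      also have "\<dots> \<le> C0 * E * (l ^ m / fact m + (if m = 0 then 0 else H' * (l ^ (m - 1) / fact (m - 1))))"
      proof (intro mult_left_mono add_mono)
        have "(\<Sum>B\<in>W. recip_weight B) \<le> (\<Sum>B\<in>multisets_of_size F m. recip_weight B)"
          using finms by (intro sum_mono2 recip_weight_nonneg) (auto simp: W_def)
        also have "\<dots> = l ^ m / fact m"
          by (rule hm)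
        finally show "(\<Sum>B\<in>W. recip_weight B) \<le> l ^ m / fact m" .
        show "(\<Sum>B\<in>W. recip_weight B * ln (real (prod_mset B))) \<le> (if m = 0 then 0 else H' * (l ^ (m - 1) / fact (m - 1)))"
        proof (cases m)
          case 0
          have "(\<Sum>B\<in>W. recip_weight B * ln (real (prod_mset B))) = 0"
            using 0 by (intro sum.neutral) (auto simp: W_def)
          then show ?thesis using 0 by simp
        next
          case (Suc n)
          have "(\<Sum>B\<in>W. recip_weight B * ln (real (prod_mset B))) \<le> H' * ((\<Sum>p\<in>F. 1 / real p) ^ n / fact n)"
            unfolding W_def H'_def Suc using assms(1) F a by (intro H2[rule_format]) auto
          then show ?thesis using Suc by (simp add: lF)
        qed
      qed (use assms in \<open>auto simp: E_def\<close>)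
      finally have "yb ^ m * (\<Sum>B\<in>{B. (A, B) \<in> close_pairs \<kappa> C0 j m}. recip_weight B) \<le>
          yb ^ m * (C0 * E * (l ^ m / fact m + (if m = 0 then 0 else H' * (l ^ (m - 1) / fact (m - 1)))))"
        using y by (intro mult_left_mono) auto
      also have "\<dots> = C0 * E * (yb ^ m * (l ^ m / fact m) + (if m = 0 then 0 else H' * (yb ^ m * (l ^ (m - 1) / fact (m - 1)))))"
        by (simp add: algebra_simps)
      also have "\<dots> \<le> C0 * E * (exp (yb * \<Lambda>) / sqrt (real m + 1) + H' * (2 * exp (yb * \<Lambda>) / sqrt (real m + 1)))"
      proof (intro mult_left_mono add_mono)
        have el: "exp (yb * l) \<le> exp (yb * \<Lambda>)" using l y by simp
        have loc: "yb ^ i * (l ^ i / fact i) \<le> exp (yb * \<Lambda>) / sqrt (real i + 1)" for i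
        proof -
          have "yb ^ i * (l ^ i / fact i) \<le> yb ^ i * ((1 / yb) ^ i * exp (yb * l) / sqrt (real i + 1))"
            using y l by (intro mult_left_mono power_div_fact_le) auto
          also have "\<dots> = exp (yb * l) / sqrt (real i + 1)" using y by (simp add: power_one_over)
          also have "\<dots> \<le> exp (yb * \<Lambda>) / sqrt (real i + 1)" using el by (intro divide_right_mono) auto
          finally show ?thesis .
        qed
        show "yb ^ m * (l ^ m / fact m) \<le> exp (yb * \<Lambda>) / sqrt (real m + 1)" by (rule loc)
        show "(if m = 0 then 0 else H' * (yb ^ m * (l ^ (m - 1) / fact (m - 1)))) \<le> H' * (2 * exp (yb * \<Lambda>) / sqrt (real m + 1))"
        proof (cases m)
          case 0
          then show ?thesis using H' by simp
        next
          case (Suc i)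
          have "yb ^ m * (l ^ i / fact i) = yb * (yb ^ i * (l ^ i / fact i))" by (simp add: Suc)
          also have "\<dots> \<le> 1 * (exp (yb * \<Lambda>) / sqrt (real i + 1))"
            using y l by (intro mult_mono loc) auto
          also have "\<dots> \<le> 2 * exp (yb * \<Lambda>) / sqrt (real m + 1)"
          proof -
            have "sqrt (real m + 1) \<le> sqrt (4 * (real i + 1))" unfolding Suc by (intro real_sqrt_le_mono) auto
            also have "\<dots> = 2 * sqrt (real i + 1)" by (simp only: real_sqrt_mult real_sqrt_four)
            finally show ?thesis by (simp add: divide_simps mult.commute)
          qed
          finally have "H' * (yb ^ m * (l ^ i / fact i)) \<le> H' * (2 * exp (yb * \<Lambda>) / sqrt (real m + 1))"
            using H' by (intro mult_left_mono) auto
          moreover have "m \<noteq> 0" "m - 1 = i" using Suc by auto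
          ultimately show ?thesis by (simp only: if_False)
        qed
      qed (use assms in \<open>auto simp: E_def\<close>)
      also have "\<dots> = X / sqrt (real m + 1)" by (simp add: X_def add_divide_distrib[symmetric] algebra_simps)
      finally show ?thesis .
    qed
    have "(\<Sum>m\<le>n. (yb\<^sup>2) ^ m * close_sum \<kappa> C0 j m)
        \<le> (\<Sum>m\<le>n. (yb * \<Lambda>) ^ m / fact m * (X / sqrt (real m + 1)))"
    proof (rule sum_mono)
      fix m
      have cp: "close_pairs \<kappa> C0 j m = Sigma (multisets_of_size F m) (\<lambda>A. {B. (A, B) \<in> close_pairs \<kappa> C0 j m})"
        by (auto simp: close_pairs_def F_def)
      have fs: "finite {B. (A, B) \<in> close_pairs \<kappa> C0 j m}" for A
        by (rule finite_subset[OF _ finms[of m]]) (auto simp: close_pairs_def F_def)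
      have "close_sum \<kappa> C0 j m =
        (\<Sum>(A,B)\<in>Sigma (multisets_of_size F m) (\<lambda>A. {B. (A, B) \<in> close_pairs \<kappa> C0 j m}). recip_weight A * recip_weight B)"
        by (rule arg_cong[OF cp])
      also have "\<dots> = (\<Sum>A\<in>multisets_of_size F m. \<Sum>B\<in>{B. (A, B) \<in> close_pairs \<kappa> C0 j m}. recip_weight A * recip_weight B)"
        using finms fs by (intro sum.Sigma[symmetric]) auto
      also have "\<dots> = (\<Sum>A\<in>multisets_of_size F m. recip_weight A * (\<Sum>B\<in>{B. (A, B) \<in> close_pairs \<kappa> C0 j m}. recip_weight B))"
        by (simp add: sum_distrib_left)
      finally have "(yb\<^sup>2) ^ m * close_sum \<kappa> C0 j m =
        yb ^ m * (\<Sum>A\<in>multisets_of_size F m. recip_weight A * (yb ^ m * (\<Sum>B\<in>{B. (A, B) \<in> close_pairs \<kappa> C0 j m}. recip_weight B)))"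
        by (simp add: sum_distrib_left power_mult_distrib power2_eq_square mult_ac)
      also have "\<dots> \<le> yb ^ m * (\<Sum>A\<in>multisets_of_size F m. recip_weight A * (X / sqrt (real m + 1)))"
        using y by (intro mult_left_mono sum_mono inner recip_weight_nonneg) auto
      also have "\<dots> = yb ^ m * (l ^ m / fact m) * (X / sqrt (real m + 1))"
        by (simp only: sum_distrib_right[symmetric] hm mult.assoc)
      also have "\<dots> \<le> yb ^ m * (\<Lambda> ^ m / fact m) * (X / sqrt (real m + 1))"
        using y l X0 by (intro mult_right_mono mult_left_mono divide_right_mono power_mono) auto
      finally show "(yb\<^sup>2) ^ m * close_sum \<kappa> C0 j m \<le>
        (yb * \<Lambda>) ^ m / fact m * (X / sqrt (real m + 1))" by (simp add: power_mult_distrib)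
    qed
    also have "\<dots> = X * (\<Sum>m\<le>n. (yb * \<Lambda>) ^ m / fact m / sqrt (real m + 1))"
      by (simp add: sum_distrib_left mult_ac)
    also have "\<dots> \<le> X * (exp (yb * \<Lambda>) / sqrt (yb * \<Lambda>))"
      using X0 y l beta_bounds unfolding \<Lambda>_def
      by (intro mult_left_mono sum_poisson_over_sqrt_le mult_pos_pos add_nonneg_pos divide_nonneg_pos) auto
    also have "\<dots> \<le> X * (exp (yb * \<Lambda>) / (sqrt yb * sqrt (real j + 1)))"
    proof (intro mult_left_mono divide_left_mono X0)
      have "yb * (real j + 1) \<le> yb * \<Lambda>"
        unfolding \<Lambda>_def using y real_le_over_beta[of j] by (intro mult_left_mono) auto
      then show "sqrt yb * sqrt (real j + 1) \<le> sqrt (yb * \<Lambda>)"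
        by (simp add: real_sqrt_mult[symmetric])
      show "0 < sqrt (yb * \<Lambda>) * (sqrt yb * sqrt (real j + 1))"
        using y beta_bounds unfolding \<Lambda>_def
        by (intro mult_pos_pos) (auto intro!: mult_pos_pos add_nonneg_pos)
    qed auto
    also have "\<dots> = C0 * (1 + 2 * H') / sqrt yb * (E * (exp (yb * \<Lambda>) * exp (yb * \<Lambda>))) / sqrt (real j + 1)"
      by (simp add: X_def mult_ac)
    also have "E * (exp (yb * \<Lambda>) * exp (yb * \<Lambda>)) = exp (4 * yb) * exp ((2 * yb - 1) * (real j / beta))"
      unfolding E_def \<Lambda>_def exp_add[symmetric] by (simp add: algebra_simps)
    finally show "(\<Sum>m\<le>n. (yb\<^sup>2) ^ m * close_sum \<kappa> C0 j m)
        \<le> C0 * (1 + 2 * H') * exp (4 * yb) / sqrt yb * exp ((2 * yb - 1) * (real j / beta)) / sqrt (real j + 1)"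
      by (simp add: mult_ac)
  qed
qed

section \<open>Gcd sums over ballot multisets\<close>

text \<open>Take the first block whose cutoff reaches the larger of the two products (or the last block). Then all primes
  involved lie below that cutoff, and by Mertens' second theorem the logarithm of the products is at least of the
  order \<open>exp (j / beta)\<close>.\<close>
lemma scale_exists:
  assumes "\<kappa> \<ge> 1"
  shows "\<exists>C>0. \<forall>k m A B. A \<in> multisets_of_size (first_blocks k) m \<and> B \<in> multisets_of_size (first_blocks k) m \<and>
     prod_mset A < \<kappa> * prod_mset B \<and> prod_mset B < \<kappa> * prod_mset A \<longrightarrow>
     (\<exists>j\<le>k. (A, B) \<in> close_pairs \<kappa> C j m)"
proof -
  obtain M where M: "M > 0" "\<And>n. n \<ge> 2 \<Longrightarrow> \<bar>prime_recip_sum n - ln (ln (real n))\<bar> \<le> M"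
    using mertens_second by blast
  define C where "C = exp (1 / beta + M) * (1 + ln (real \<kappa>))"
  have lk: "ln (real \<kappa>) \<ge> 0" using assms by simp
  have C1: "C \<ge> 1"
  proof -
    have "1 * 1 \<le> C" unfolding C_def using lk M(1) beta_bounds by (intro mult_mono) auto
    then show ?thesis by simp
  qed
  show ?thesis
  proof (intro exI[of _ C] conjI allI impI)
    show "C > 0" using C1 by simp
    fix k m A B
    assume AB: "A \<in> multisets_of_size (first_blocks k) m \<and> B \<in> multisets_of_size (first_blocks k) m \<and>
     prod_mset A < \<kappa> * prod_mset B \<and> prod_mset B < \<kappa> * prod_mset A"
    then have sub: "set_mset A \<subseteq> first_blocks k" "set_mset B \<subseteq> first_blocks k"
      and sz: "size A = m" "size B = m" by (auto simp: multisets_of_size_def)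
    define N where "N = max (prod_mset A) (prod_mset B)"
    have pos: "prod_mset A > 0" "prod_mset B > 0"
      using sub by (auto intro!: prod_mset_primes_pos)
    have N1: "N \<ge> 1" using pos by (simp add: N_def)
    have "\<exists>j\<le>k. set_mset A \<subseteq> first_blocks j \<and> set_mset B \<subseteq> first_blocks j \<and> (\<forall>i<j. cutoff i < N)"
    proof (cases "N \<le> cutoff k")
      case False
      then have "\<forall>i<k. cutoff i < N" using cutoff_mono[of _ k] by (meson less_imp_le not_le order.trans)
      then show ?thesis using sub by blast
    next
      case True
      define j where "j = (LEAST j. N \<le> cutoff j)"
      have j: "N \<le> cutoff j" "j \<le> k" "\<forall>i<j. cutoff i < N"
        unfolding j_def using True by (auto intro: LeastI Least_le dest: not_less_Least simp: not_le[symmetric])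
      have "p \<in> first_blocks j" if "p \<in># A \<or> p \<in># B" for p
      proof -
        have "p dvd prod_mset A \<or> p dvd prod_mset B" using that dvd_prod_mset by blast
        then have "p \<le> N" using pos unfolding N_def by (auto dest!: dvd_imp_le)
        then show ?thesis using j(1) that sub by auto
      qed
      then show ?thesis using j(2,3) by blast
    qed
    then obtain j where j: "j \<le> k" "set_mset A \<subseteq> first_blocks j" "set_mset B \<subseteq> first_blocks j" "\<forall>i<j. cutoff i < N"
      by blast
    have lB: "ln (real (prod_mset B)) \<ge> 0" using pos by simp
    have "exp (real j / beta) \<le> C * (1 + ln (real (prod_mset B)))"
    proof (cases j)
      case 0
      have "1 * 1 \<le> C * (1 + ln (real (prod_mset B)))" using C1 lB by (intro mult_mono) auto
      then show ?thesis using 0 by simp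
    next
      case (Suc i)
      then have "\<not> prime_recip_sum N \<le> tau i" using j(4) by (auto simp: cutoff_iff)
      then have SN: "prime_recip_sum N > real i / beta" using tau_ge[of i] by linarith
      have "N \<ge> 2"
      proof (rule ccontr)
        assume "\<not> N \<ge> 2"
        then have "N = Suc 0" using N1 by auto
        then have "0 > real i / beta" using SN by simp
        then show False using beta_bounds by (simp add: divide_less_0_iff)
      qed
      then have "ln (ln (real N)) \<ge> real i / beta - M" using SN M(2)[of N] by (auto simp: abs_le_iff)
      moreover have "ln (real N) > 0" using \<open>N \<ge> 2\<close> by simp
      ultimately have lnN: "exp (real i / beta - M) \<le> ln (real N)" by (subst (asm) ln_ge_iff) auto
      have "prod_mset B \<le> \<kappa> * prod_mset B" using assms by simp
      then have "N \<le> \<kappa> * prod_mset B" using AB unfolding N_def by auto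
      then have "real N \<le> real \<kappa> * real (prod_mset B)" by (metis of_nat_le_iff of_nat_mult)
      then have "ln (real N) \<le> ln (real \<kappa> * real (prod_mset B))"
        using \<open>N \<ge> 2\<close> by (intro ln_mono) auto
      also have "\<dots> = ln (real \<kappa>) + ln (real (prod_mset B))" using assms pos by (intro ln_mult_pos) auto
      also have "\<dots> \<le> (1 + ln (real \<kappa>)) * (1 + ln (real (prod_mset B)))"
        using lk lB by (simp add: algebra_simps)
      finally have "exp (1 / beta + M) * exp (real i / beta - M) \<le>
          exp (1 / beta + M) * ((1 + ln (real \<kappa>)) * (1 + ln (real (prod_mset B))))"
        using lnN by (intro mult_left_mono) auto
      moreover have "exp (1 / beta + M) * exp (real i / beta - M) = exp (real j / beta)"
        by (simp add: exp_add[symmetric] Suc add_divide_distrib)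
      ultimately show ?thesis by (simp add: C_def mult.assoc)
    qed
    then show "\<exists>j\<le>k. (A, B) \<in> close_pairs \<kappa> C j m"
      using j AB sz unfolding close_pairs_def multisets_of_size_def by blast
  qed
qed

text \<open>What the ballot condition at level \<open>j\<close> leaves for the common part of two ballot multisets if their
  remainders have \<open>m\<close> elements, all in the first \<open>j\<close> blocks.\<close>
definition common_parts :: "nat \<Rightarrow> nat \<Rightarrow> nat \<Rightarrow> nat multiset set" where
  "common_parts k j m = {D \<in> multisets_of_size (first_blocks k) (k - m).
      size (filter_mset (\<lambda>p. p \<in> first_blocks j) D) \<le> j - m}"

lemma finite_common_parts: "finite (common_parts k j m)"
  unfolding common_parts_def using finite_multisets_of_size[of "first_blocks k" "k - m"] by simp

text \<open>Split \<open>D\<close> into its part in the first \<open>j\<close> blocks and the rest. The rest has at least \<open>k - j\<close> elements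
  and is estimated by the local bound with parameter \<^const>\<open>beta\<close>. If the first part has \<open>h\<close> elements less
  than the ballot condition permits, there is a factor \<open>(1 / beta) ^ h\<close>, and \<open>yb\<^sup>2 \<le> beta\<close> allows replacing
  it by \<open>(1 / yb\<^sup>2) ^ h\<close>; after that the sum over the first part is an exponential series.\<close>
lemma sum_common_parts_le:
  "\<exists>C>0. \<forall>k j m. m \<le> j \<and> j \<le> k \<longrightarrow> (\<Sum>D\<in>common_parts k j m. recip_weight D) \<le>
     C * (exp 1 / beta) ^ (k - j) * (1 / yb\<^sup>2) ^ j * (yb\<^sup>2) ^ m * exp (yb\<^sup>2 * (real j / beta)) / sqrt (real (k - j) + 1)"
proof (intro exI[of _ "exp 3 * exp 2"] conjI allI impI)
  fix k j m :: nat assume mjk: "m \<le> j \<and> j \<le> k"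
  note y = yfun_beta(1,2)
  have "yb\<^sup>2 > 0" using y by simp
  then have y2: "0 < yb\<^sup>2" "yb\<^sup>2 \<le> beta" "yb\<^sup>2 \<le> 1" using y yfun_beta(3) beta_bounds by linarith+
  define F where "F = first_blocks j"
  define G where "G = first_blocks k - first_blocks j"
  have fin: "finite F" "finite G" by (auto simp: F_def G_def)
  define l1 where "l1 = prime_recip_sum (cutoff j)"
  define l2 where "l2 = prime_recip_sum (cutoff k) - prime_recip_sum (cutoff j)"
  have l1: "(\<Sum>p\<in>F. 1 / real p) = l1" "0 \<le> l1" "l1 \<le> real j / beta + 2"
    using block_sum_bounds[of j] sum_block[of j] unfolding F_def l1_def by auto
  have l2: "(\<Sum>p\<in>G. 1 / real p) = l2" unfolding G_def l2_def using mjk by (intro sum_recip_block_diff) auto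
  have l2b: "0 \<le> l2" "beta * l2 \<le> real (k - j) + 3"
  proof -
    show "0 \<le> l2" unfolding l2[symmetric] by (intro sum_nonneg) auto
    have half: "(1/2::real) ^ j \<le> 1" "(1/2::real) ^ k \<ge> 0" by (auto intro: power_le_one)
    have "tau k - (tau j - (1/2) ^ j) \<le> real (k - j) / beta + 3"
    proof -
      have "real (k - j) / beta = real k / beta - real j / beta"
        using mjk by (simp add: of_nat_diff diff_divide_distrib)
      then show ?thesis using half unfolding tau_def by linarith
    qed
    then have "l2 \<le> real (k - j) / beta + 3"
      using prime_recip_sum_cutoff_le[of k] prime_recip_sum_cutoff_ge[of j] unfolding l2_def by linarith
    then have "beta * l2 \<le> beta * (real (k - j) / beta + 3)" using beta_bounds by (intro mult_left_mono) auto
    also have "\<dots> = real (k - j) + 3 * beta" using beta_bounds by (simp add: algebra_simps)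
    also have "\<dots> \<le> real (k - j) + 3" using beta_bounds by simp
    finally show "beta * l2 \<le> real (k - j) + 3" .
  qed
  define X where "X = (\<lambda>i. (\<lambda>(A,B). A + B) ` (multisets_of_size F i \<times> multisets_of_size G (k - m - i)))"
  have "common_parts k j m \<subseteq> (\<Union>i\<le>j-m. X i)"
  proof
    fix D assume D: "D \<in> common_parts k j m"
    define A where "A = filter_mset (\<lambda>p. p \<in> F) D"
    define B where "B = filter_mset (\<lambda>p. p \<notin> F) D"
    have DAB: "D = A + B" by (simp add: A_def B_def multiset_partition[symmetric])
    have "size D = k - m" using D unfolding common_parts_def multisets_of_size_def by simp
    then have sz: "size A + size B = k - m" using arg_cong[OF DAB, of size] by simp
    have sz2: "size A \<le> j - m" using D unfolding common_parts_def A_def F_def by simp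
    have sz3: "set_mset D \<subseteq> first_blocks k"
      using D unfolding common_parts_def multisets_of_size_def by simp
    have "A \<in> multisets_of_size F (size A)" by (auto simp: multisets_of_size_def A_def)
    moreover have "B \<in> multisets_of_size G (k - m - size A)"
      using sz sz3 unfolding multisets_of_size_def B_def F_def G_def by auto
    ultimately show "D \<in> (\<Union>i\<le>j-m. X i)" using DAB sz2 unfolding X_def by blast
  qed
  moreover have finX: "finite (X i)" for i
    unfolding X_def using fin by (intro finite_imageI finite_cartesian_product finite_multisets_of_size)
  ultimately have "(\<Sum>D\<in>common_parts k j m. recip_weight D) \<le> (\<Sum>D\<in>(\<Union>i\<le>j-m. X i). recip_weight D)"
    by (intro sum_mono2 recip_weight_nonneg) auto
  also have "\<dots> \<le> (\<Sum>i\<le>j-m. \<Sum>D\<in>X i. recip_weight D)"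
    using finX by (intro sum_UN_le recip_weight_nonneg) auto
  also have "\<dots> = (\<Sum>i\<le>j-m. (l1 ^ i / fact i) * (l2 ^ (k - m - i) / fact (k - m - i)))"
  proof (intro sum.cong refl)
    fix i
    have "(\<Sum>D\<in>X i. recip_weight D) = (\<Sum>A\<in>multisets_of_size F i. recip_weight A) * (\<Sum>B\<in>multisets_of_size G (k - m - i). recip_weight B)"
      unfolding X_def by (rule sum_poisson_weight_product[of _ F _ G]) (auto simp: multisets_of_size_def F_def G_def)
    then show "(\<Sum>D\<in>X i. recip_weight D) = (l1 ^ i / fact i) * (l2 ^ (k - m - i) / fact (k - m - i))"
      by (simp only: sum_poisson_weight_multisets_of_size[OF fin(1)] sum_poisson_weight_multisets_of_size[OF fin(2)] l1(1) l2)
  qed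
  also have "\<dots> \<le> (\<Sum>i\<le>j-m. (yb\<^sup>2 * l1) ^ i / fact i *
     (exp 3 * (exp 1 / beta) ^ (k - j) * (1 / yb\<^sup>2) ^ j * (yb\<^sup>2) ^ m / sqrt (real (k - j) + 1)))"
  proof (rule sum_mono)
    fix i assume "i \<in> {..j-m}"
    then have i: "i \<le> j - m" by simp
    define n where "n = k - m - i"
    \<comment> \<open>The slack in the ballot condition at level \<open>j\<close>.\<close>
    define h where "h = j - m - i"
    have nh: "n = (k - j) + h" "j = h + m + i" using i mjk by (auto simp: n_def h_def)
    have "l2 ^ n / fact n \<le> (1 / beta) ^ n * exp (beta * l2) / sqrt (real n + 1)"
      using l2b beta_bounds by (intro power_div_fact_le) auto
    also have "\<dots> \<le> (1 / beta) ^ n * exp (real (k - j) + 3) / sqrt (real (k - j) + 1)"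
      using l2b beta_bounds nh by (intro frac_le mult_left_mono mult_nonneg_nonneg real_sqrt_le_mono) auto
    also have "(1 / beta) ^ n = (1 / beta) ^ (k - j) * (1 / beta) ^ h" by (simp add: nh(1) power_add)
    also have "(1 / beta) ^ (k - j) * (1 / beta) ^ h * exp (real (k - j) + 3) / sqrt (real (k - j) + 1) \<le>
        (1 / beta) ^ (k - j) * (1 / yb\<^sup>2) ^ h * exp (real (k - j) + 3) / sqrt (real (k - j) + 1)"
      using y2 beta_bounds
      by (intro divide_right_mono mult_right_mono mult_left_mono power_mono divide_left_mono) auto
    finally have b: "l2 ^ n / fact n \<le> (1 / beta) ^ (k - j) * (1 / yb\<^sup>2) ^ h * exp (real (k - j) + 3) / sqrt (real (k - j) + 1)" .
    have "(l1 ^ i / fact i) * (l2 ^ n / fact n) \<le> (l1 ^ i / fact i) *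
        ((1 / beta) ^ (k - j) * (1 / yb\<^sup>2) ^ h * exp (real (k - j) + 3) / sqrt (real (k - j) + 1))"
      using l1 by (intro mult_left_mono b) auto
    also have "\<dots> = (yb\<^sup>2 * l1) ^ i / fact i *
     (exp 3 * (exp 1 / beta) ^ (k - j) * (1 / yb\<^sup>2) ^ j * (yb\<^sup>2) ^ m / sqrt (real (k - j) + 1))"
    proof -
      have e1: "exp (real (k - j) + 3) = exp 3 * exp 1 ^ (k - j)"
        by (simp add: exp_add exp_of_nat_mult[symmetric])
      have e3: "(1 / yb\<^sup>2) ^ j = (1 / yb\<^sup>2) ^ h * (1 / yb\<^sup>2) ^ m * (1 / yb\<^sup>2) ^ i" by (simp add: nh(2) power_add)
      have e4: "(1 / yb\<^sup>2) ^ a * (yb\<^sup>2) ^ a = 1" for a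
        using y(1) by (simp add: power_divide)
      have "(1 / yb\<^sup>2) ^ j * (yb\<^sup>2) ^ m * (yb\<^sup>2) ^ i =
          (1 / yb\<^sup>2) ^ h * ((1 / yb\<^sup>2) ^ m * (yb\<^sup>2) ^ m) * ((1 / yb\<^sup>2) ^ i * (yb\<^sup>2) ^ i)"
        unfolding e3 by (simp only: mult_ac)
      then have e2: "(1 / yb\<^sup>2) ^ h = (1 / yb\<^sup>2) ^ j * (yb\<^sup>2) ^ m * (yb\<^sup>2) ^ i"
        unfolding e4 by simp
      show ?thesis unfolding e1 e2 by (simp add: power_mult_distrib power_divide mult_ac)
    qed
    finally show "(l1 ^ i / fact i) * (l2 ^ (k - m - i) / fact (k - m - i)) \<le> (yb\<^sup>2 * l1) ^ i / fact i *
     (exp 3 * (exp 1 / beta) ^ (k - j) * (1 / yb\<^sup>2) ^ j * (yb\<^sup>2) ^ m / sqrt (real (k - j) + 1))"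
      unfolding n_def .
  qed
  also have "\<dots> = (\<Sum>i\<le>j-m. (yb\<^sup>2 * l1) ^ i / fact i) *
     (exp 3 * (exp 1 / beta) ^ (k - j) * (1 / yb\<^sup>2) ^ j * (yb\<^sup>2) ^ m / sqrt (real (k - j) + 1))"
    by (rule sum_distrib_right[symmetric])
  also have "\<dots> \<le> (exp 2 * exp (yb\<^sup>2 * (real j / beta))) *
     (exp 3 * (exp 1 / beta) ^ (k - j) * (1 / yb\<^sup>2) ^ j * (yb\<^sup>2) ^ m / sqrt (real (k - j) + 1))"
  proof (intro mult_right_mono)
    have "(\<Sum>i\<le>j-m. (yb\<^sup>2 * l1) ^ i / fact i) \<le> exp (yb\<^sup>2 * l1)"
      using y2 l1 by (intro sum_power_div_fact_le) auto
    also have "yb\<^sup>2 * l1 \<le> yb\<^sup>2 * (real j / beta + 2)" using y2 l1 by (intro mult_left_mono) auto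
    also have "\<dots> \<le> 2 + yb\<^sup>2 * (real j / beta)" using y2 by (simp add: distrib_left)
    finally show "(\<Sum>i\<le>j-m. (yb\<^sup>2 * l1) ^ i / fact i) \<le> exp 2 * exp (yb\<^sup>2 * (real j / beta))"
      by (simp add: exp_add)
  qed (use y2 beta_bounds in \<open>auto intro!: mult_nonneg_nonneg divide_nonneg_nonneg\<close>)
  finally show "(\<Sum>D\<in>common_parts k j m. recip_weight D) \<le>
     exp 3 * exp 2 * (exp 1 / beta) ^ (k - j) * (1 / yb\<^sup>2) ^ j * (yb\<^sup>2) ^ m * exp (yb\<^sup>2 * (real j / beta)) / sqrt (real (k - j) + 1)"
    by (simp add: mult_ac)
qed auto

text \<open>The equation \<open>ffun beta = Qfun beta\<close> in the form in which it makes all scales contribute equally.\<close>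
lemma beta_identity: "exp ((yb\<^sup>2 + 2 * yb - 1) / beta) / yb\<^sup>2 = exp 1 / beta"
proof -
  note y = yfun_beta
  have "beta = yb * (1 + yb)" using yfun_eq[OF beta_bounds(1)] by simp
  then have lnb: "ln beta = ln yb + ln (1 + yb)" using y by (metis add_pos_pos ln_mult_pos zero_less_one)
  have "beta * ln beta - beta + 1 = 2 * beta * ln (1 + yb) - yb\<^sup>2"
    using eta_eq_ffun eta_eq_Qfun by simp
  then have "beta * ln beta - beta + 1 = 2 * beta * (ln beta - ln yb) - yb\<^sup>2" using lnb by simp
  then have "yb\<^sup>2 + 2 * yb - 1 = beta * (1 - ln beta + 2 * ln yb)"
    using y(3) by (simp add: algebra_simps)
  then have "(yb\<^sup>2 + 2 * yb - 1) / beta = 1 - ln beta + 2 * ln yb" using beta_bounds by simp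
  moreover have "exp (1 - ln beta + 2 * ln yb) = exp 1 / exp (ln beta) * (exp (ln yb))\<^sup>2"
    by (simp only: exp_add exp_diff exp_double)
  moreover have "exp (ln yb) = yb" "exp (ln beta) = beta" using y(1) beta_bounds(1) by auto
  ultimately have "exp ((yb\<^sup>2 + 2 * yb - 1) / beta) = exp 1 / beta * yb\<^sup>2" by (simp only:)
  then show ?thesis using y(1) by simp
qed

abbreviation close_ballot_pairs :: "nat \<Rightarrow> nat \<Rightarrow> (nat multiset \<times> nat multiset) set" where
  "close_ballot_pairs \<kappa> k \<equiv> {(M,M'). M \<in> bins.ballot k k \<and> M' \<in> bins.ballot k k \<and>
      prod_mset M < \<kappa> * prod_mset M' \<and> prod_mset M' < \<kappa> * prod_mset M}"

text \<open>Each pair is assigned to the scale \<open>j\<close> of its remainders. The common parts at scale \<open>j\<close> contribute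
  \<open>(exp 1 / beta) ^ (k - j)\<close>, the remainders the missing power by \<open>beta_identity\<close>, and the two square roots
  saved keep the sum over \<open>j\<close> bounded.\<close>
lemma sum_close_gcd_le:
  assumes "\<kappa> \<ge> 1"
  shows "\<exists>C>0. \<forall>k. (\<Sum>(M,M')\<in>close_ballot_pairs \<kappa> k.
      gcd_weight M M') \<le> C * (exp 1 / beta) ^ k"
proof -
  obtain C0 where C0: "C0 > 0" "\<And>k m A B. A \<in> multisets_of_size (first_blocks k) m \<Longrightarrow> B \<in> multisets_of_size (first_blocks k) m \<Longrightarrow>
     prod_mset A < \<kappa> * prod_mset B \<Longrightarrow> prod_mset B < \<kappa> * prod_mset A \<Longrightarrow>
     \<exists>j\<le>k. (A, B) \<in> close_pairs \<kappa> C0 j m"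
    using scale_exists[OF assms] by meson
  from sum_close_pairs_le[OF assms C0(1)] obtain CP where CP: "CP > 0 \<and> (\<forall>j n.
     (\<Sum>m\<le>n. (yb\<^sup>2) ^ m * close_sum \<kappa> C0 j m)
      \<le> CP * exp ((2 * yb - 1) * (real j / beta)) / sqrt (real j + 1))" ..
  from sum_common_parts_le obtain CD where CD: "CD > 0 \<and> (\<forall>k j m. m \<le> j \<and> j \<le> k \<longrightarrow> (\<Sum>D\<in>common_parts k j m. recip_weight D) \<le>
     CD * (exp 1 / beta) ^ (k - j) * (1 / yb\<^sup>2) ^ j * (yb\<^sup>2) ^ m * exp (yb\<^sup>2 * (real j / beta)) / sqrt (real (k - j) + 1))" ..
  show ?thesis
  proof (intro exI[of _ "CD * CP * 8"] conjI allI)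
    show "CD * CP * 8 > 0" using CP CD by simp
    fix k
    define P where "P = close_ballot_pairs \<kappa> k"
    define w where "w = (\<lambda>(D,A,B). recip_weight D * recip_weight A * recip_weight B)"
    have w0: "w x \<ge> 0" for x by (auto simp: w_def case_prod_unfold intro!: mult_nonneg_nonneg recip_weight_nonneg)
    define R where "R = (\<lambda>j m. common_parts k j m \<times> close_pairs \<kappa> C0 j m)"
    have fcp: "finite (close_pairs \<kappa> C0 j m)" for j m
      by (rule finite_subset[of _ "multisets_of_size (first_blocks j) m \<times> multisets_of_size (first_blocks j) m"])
         (auto simp: close_pairs_def intro!: finite_cartesian_product finite_multisets_of_size)
    have fR: "finite (R j m)" for j m unfolding R_def using finite_common_parts fcp by blast
    have "P \<subseteq> bins.ballot k k \<times> bins.ballot k k" by (auto simp: P_def)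
    then have finP: "finite P" by (rule finite_subset) (auto intro: bins.finite_ballot)
    have "(\<Sum>(M,M')\<in>P. gcd_weight M M')
      \<le> (\<Sum>(D,A,B)\<in>(\<Union>j\<le>k. \<Union>m\<le>j. R j m). recip_weight D * recip_weight A * recip_weight B)"
    proof (rule sum_pairs_le)
      show "finite (\<Union>j\<le>k. \<Union>m\<le>j. R j m)" using fR by auto
      fix M M' assume MM: "(M, M') \<in> P"
      then have M: "set_mset M \<subseteq> first_blocks k" "size M = k" "\<forall>i\<le>k. size (filter_mset (\<lambda>p. p \<in> first_blocks i) M) \<le> i"
        and M': "set_mset M' \<subseteq> first_blocks k" "size M' = k"
        by (auto simp: P_def bins.ballot_def multisets_of_size_def)
      show primes: "(\<forall>p\<in>#M. prime p) \<and> (\<forall>p\<in>#M'. prime p)" using M M' by auto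
      define D where "D = M \<inter># M'"
      define A where "A = M - M'"
      define B where "B = M' - M"
      have dec: "M = D + A" "M' = D + B" by (auto simp: D_def A_def B_def multiset_eq_iff)
      define m where "m = size A"
      have szB: "size B = m" using dec M(2) M'(2) unfolding m_def by (metis add_left_cancel size_union)
      have szD: "size D = k - m" using dec(1) M(2) unfolding m_def by auto
      have sub: "set_mset A \<subseteq> first_blocks k" "set_mset B \<subseteq> first_blocks k" "set_mset D \<subseteq> first_blocks k"
        using M(1) M'(1) unfolding dec by auto
      have posD: "prod_mset D > 0" using sub by (intro prod_mset_primes_pos) auto
      have "prod_mset D * prod_mset A < \<kappa> * (prod_mset D * prod_mset B)" "prod_mset D * prod_mset B < \<kappa> * (prod_mset D * prod_mset A)"
        using MM unfolding P_def dec by auto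
      then have cmp: "prod_mset A < \<kappa> * prod_mset B" "prod_mset B < \<kappa> * prod_mset A"
        using posD by (simp_all add: mult.left_commute)
      obtain j where j: "j \<le> k" "(A, B) \<in> close_pairs \<kappa> C0 j m"
        using C0(2)[of A k m B] sub szB cmp unfolding multisets_of_size_def m_def by blast
      have "filter_mset (\<lambda>p. p \<in> first_blocks j) A = A"
        using j(2) by (auto simp: close_pairs_def multisets_of_size_def filter_mset_eq_conv)
      then have "size (filter_mset (\<lambda>p. p \<in> first_blocks j) D) + m \<le> j"
        using M(3) j(1) unfolding dec m_def by (metis filter_union_mset size_union)
      then have "m \<le> j" "D \<in> common_parts k j m"
        using sub szD unfolding common_parts_def multisets_of_size_def by auto
      then show "(M \<inter># M', M - M', M' - M) \<in> (\<Union>j\<le>k. \<Union>m\<le>j. R j m)"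
        using j unfolding R_def D_def[symmetric] A_def[symmetric] B_def[symmetric] by blast
    qed (rule finP)
    also have "\<dots> = (\<Sum>x\<in>(\<Union>j\<le>k. \<Union>m\<le>j. R j m). w x)" by (simp add: w_def)
    also have "\<dots> \<le> (\<Sum>j\<le>k. \<Sum>x\<in>(\<Union>m\<le>j. R j m). w x)" using fR w0 by (intro sum_UN_le) auto
    also have "\<dots> \<le> (\<Sum>j\<le>k. \<Sum>m\<le>j. \<Sum>x\<in>R j m. w x)" using fR w0 by (intro sum_mono sum_UN_le) auto
    also have "\<dots> \<le> (\<Sum>j\<le>k. CD * CP * (exp 1 / beta) ^ k * (1 / (sqrt (real j + 1) * sqrt (real (k - j) + 1))))"
    proof (rule sum_mono)
      fix j assume "j \<in> {..k}"
      then have j: "j \<le> k" by simp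
      define Y where "Y = CD * (exp 1 / beta) ^ (k - j) * (1 / yb\<^sup>2) ^ j * exp (yb\<^sup>2 * (real j / beta)) / sqrt (real (k - j) + 1)"
      have Y0: "Y \<ge> 0" unfolding Y_def using CD beta_bounds yfun_beta(1)
        by (intro divide_nonneg_nonneg mult_nonneg_nonneg) auto
      have "(\<Sum>m\<le>j. \<Sum>x\<in>R j m. w x) \<le> (\<Sum>m\<le>j. Y * ((yb\<^sup>2) ^ m * close_sum \<kappa> C0 j m))"
      proof (rule sum_mono)
        fix m assume "m \<in> {..j}"
        then have m: "m \<le> j" by simp
        have "(\<Sum>x\<in>R j m. w x) = (\<Sum>D\<in>common_parts k j m. recip_weight D) * close_sum \<kappa> C0 j m"
          unfolding R_def w_def sum_product sum.cartesian_product by (intro sum.cong refl) (auto simp: mult.assoc)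
        also have "\<dots> \<le> (Y * (yb\<^sup>2) ^ m) * close_sum \<kappa> C0 j m"
        proof (intro mult_right_mono)
          have "(\<Sum>D\<in>common_parts k j m. recip_weight D) \<le> CD * (exp 1 / beta) ^ (k - j) * (1 / yb\<^sup>2) ^ j * (yb\<^sup>2) ^ m * exp (yb\<^sup>2 * (real j / beta)) / sqrt (real (k - j) + 1)"
            using CD m j by blast
          then show "(\<Sum>D\<in>common_parts k j m. recip_weight D) \<le> Y * (yb\<^sup>2) ^ m" by (simp add: Y_def mult_ac)
          show "0 \<le> close_sum \<kappa> C0 j m"
            by (intro sum_nonneg) (auto intro!: mult_nonneg_nonneg recip_weight_nonneg)
        qed
        finally show "(\<Sum>x\<in>R j m. w x) \<le> Y * ((yb\<^sup>2) ^ m * close_sum \<kappa> C0 j m)"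
          by (simp only: mult.assoc)
      qed
      also have "\<dots> = Y * (\<Sum>m\<le>j. (yb\<^sup>2) ^ m * close_sum \<kappa> C0 j m)"
        by (rule sum_distrib_left[symmetric])
      also have "\<dots> \<le> Y * (CP * exp ((2 * yb - 1) * (real j / beta)) / sqrt (real j + 1))"
        using CP Y0 by (intro mult_left_mono) blast
      also have "\<dots> = CD * CP * ((exp 1 / beta) ^ (k - j) * ((1 / yb\<^sup>2) ^ j * (exp (yb\<^sup>2 * (real j / beta)) * exp ((2 * yb - 1) * (real j / beta)))))
          * (1 / (sqrt (real j + 1) * sqrt (real (k - j) + 1)))"
        by (simp add: Y_def mult_ac)
      also have "(1 / yb\<^sup>2) ^ j * (exp (yb\<^sup>2 * (real j / beta)) * exp ((2 * yb - 1) * (real j / beta))) = (exp 1 / beta) ^ j"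
      proof -
        have "exp (yb\<^sup>2 * (real j / beta)) * exp ((2 * yb - 1) * (real j / beta)) = exp (real j * ((yb\<^sup>2 + 2 * yb - 1) / beta))"
          unfolding exp_add[symmetric] by (simp add: add_divide_distrib[symmetric] diff_divide_distrib[symmetric] algebra_simps)
        also have "\<dots> = exp ((yb\<^sup>2 + 2 * yb - 1) / beta) ^ j" by (rule exp_of_nat_mult)
        finally show ?thesis unfolding beta_identity[symmetric] by (simp add: power_divide)
      qed
      also have "(exp 1 / beta) ^ (k - j) * (exp 1 / beta) ^ j = (exp 1 / beta) ^ k"
        using j by (simp flip: power_add)
      finally show "(\<Sum>m\<le>j. \<Sum>x\<in>R j m. w x) \<le> CD * CP * (exp 1 / beta) ^ k * (1 / (sqrt (real j + 1) * sqrt (real (k - j) + 1)))" .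
    qed
    also have "\<dots> = CD * CP * (exp 1 / beta) ^ k * (\<Sum>j\<le>k. 1 / (sqrt (real j + 1) * sqrt (real (k - j) + 1)))"
      by (rule sum_distrib_left[symmetric])
    also have "\<dots> \<le> CD * CP * (exp 1 / beta) ^ k * 8"
      using CD CP beta_bounds by (intro mult_left_mono sum_inverse_sqrt_convolution_le) auto
    finally show "(\<Sum>(M,M')\<in>close_ballot_pairs \<kappa> k.
      gcd_weight M M') \<le> CD * CP * 8 * (exp 1 / beta) ^ k"
      unfolding P_def by (simp add: mult_ac)
  qed
qed

text \<open>Without the comparability condition one loses \<open>exp (k / beta)\<close>, which is the order of \<open>ln N\<close>. That is
  affordable for pairs with distinct large primes, and Rankin's trick with \<open>yb\<close> is enough.\<close>
lemma sum_all_gcd_le: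
  "\<exists>C>0. \<forall>k. (\<Sum>(M,M')\<in>bins.ballot k k \<times> bins.ballot k k.
      gcd_weight M M') \<le>
      C * (exp 1 / beta) ^ k * exp (real k / beta)"
proof (intro exI[of _ "exp 6"] conjI allI)
  fix k
  note y = yfun_beta
  define F where "F = first_blocks k"
  have fin: "finite F" by (simp add: F_def)
  define l where "l = prime_recip_sum (cutoff k)"
  have l: "(\<Sum>p\<in>F. 1 / real p) = l" "0 \<le> l" "l \<le> real k / beta + 2"
    using block_sum_bounds[of k] sum_block[of k] unfolding F_def l_def by auto
  define w where "w = (\<lambda>(D,A,B). recip_weight D * recip_weight A * recip_weight B)"
  have w0: "w x \<ge> 0" for x by (auto simp: w_def case_prod_unfold intro!: mult_nonneg_nonneg recip_weight_nonneg)
  define R where "R = (\<lambda>m. multisets_of_size F (k - m) \<times> multisets_of_size F m \<times> multisets_of_size F m)"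
  have fR: "finite (R m)" for m unfolding R_def using fin by (intro finite_cartesian_product finite_multisets_of_size)
  have "(\<Sum>(M,M')\<in>bins.ballot k k \<times> bins.ballot k k.
      gcd_weight M M')
      \<le> (\<Sum>(D,A,B)\<in>(\<Union>m\<le>k. R m). recip_weight D * recip_weight A * recip_weight B)"
  proof (rule sum_pairs_le)
    show "finite (\<Union>m\<le>k. R m)" using fR by auto
    show "finite (bins.ballot k k \<times> bins.ballot k k)" by (intro finite_cartesian_product bins.finite_ballot)
    fix M M' assume MM: "(M, M') \<in> bins.ballot k k \<times> bins.ballot k k"
    then have M: "set_mset M \<subseteq> F" "size M = k" "set_mset M' \<subseteq> F" "size M' = k"
      by (auto simp: bins.ballot_def multisets_of_size_def F_def)
    show "(\<forall>p\<in>#M. prime p) \<and> (\<forall>p\<in>#M'. prime p)" using M by (auto simp: F_def)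
    define D where "D = M \<inter># M'"
    define A where "A = M - M'"
    define B where "B = M' - M"
    have dec: "M = D + A" "M' = D + B" by (auto simp: D_def A_def B_def multiset_eq_iff)
    have "size B = size A" using dec M(2,4) by (metis add_left_cancel size_union)
    moreover have "size D = k - size A" "size A \<le> k" using dec(1) M(2) by auto
    moreover have "set_mset A \<subseteq> F" "set_mset B \<subseteq> F" "set_mset D \<subseteq> F"
      using M(1,3) unfolding dec by auto
    ultimately show "(M \<inter># M', M - M', M' - M) \<in> (\<Union>m\<le>k. R m)"
      unfolding R_def D_def[symmetric] A_def[symmetric] B_def[symmetric] multisets_of_size_def by auto
  qed
  also have "\<dots> = (\<Sum>x\<in>(\<Union>m\<le>k. R m). w x)" by (simp add: w_def)
  also have "\<dots> \<le> (\<Sum>m\<le>k. \<Sum>x\<in>R m. w x)" using fR w0 by (intro sum_UN_le) auto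
  also have "\<dots> \<le> (\<Sum>m\<le>k. (1 / yb\<^sup>2) ^ k * exp (yb\<^sup>2 * l) * exp (yb * l) * ((yb * l) ^ m / fact m))"
  proof (rule sum_mono)
    fix m assume "m \<in> {..k}"
    then have m: "m \<le> k" by simp
    have "(\<Sum>x\<in>R m. w x) = (\<Sum>D\<in>multisets_of_size F (k - m). \<Sum>A\<in>multisets_of_size F m.
        \<Sum>B\<in>multisets_of_size F m. recip_weight D * recip_weight A * recip_weight B)"
      unfolding R_def w_def sum.cartesian_product by simp
    also have "\<dots> = (\<Sum>D\<in>multisets_of_size F (k - m). recip_weight D) *
        ((\<Sum>A\<in>multisets_of_size F m. recip_weight A) * (\<Sum>B\<in>multisets_of_size F m. recip_weight B))"
      by (simp only: sum_distrib_left[symmetric] sum_distrib_right[symmetric] mult.assoc)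
    also have "\<dots> = (l ^ (k - m) / fact (k - m)) * ((l ^ m / fact m) * (l ^ m / fact m))"
      by (simp only: sum_poisson_weight_multisets_of_size[OF fin] l(1))
    also have "\<dots> = (1 / yb\<^sup>2) ^ k * (((yb\<^sup>2 * l) ^ (k - m) / fact (k - m)) * ((yb * l) ^ m / fact m) * ((yb * l) ^ m / fact m))"
    proof -
      have "(yb\<^sup>2) ^ k = (yb\<^sup>2) ^ (k - m) * (yb ^ m * yb ^ m)"
      proof -
        have "yb ^ m * yb ^ m = (yb\<^sup>2) ^ m" by (simp add: power2_eq_square power_mult_distrib)
        then show ?thesis using m by (simp flip: power_add)
      qed
      moreover have "(1 / yb\<^sup>2) ^ k * (yb\<^sup>2) ^ k = 1" using y(1) by (simp add: power_mult_distrib[symmetric])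
      ultimately have e: "1 = (1 / yb\<^sup>2) ^ k * ((yb\<^sup>2) ^ (k - m) * (yb ^ m * yb ^ m))" by simp
      have "(l ^ (k - m) / fact (k - m)) * ((l ^ m / fact m) * (l ^ m / fact m)) =
        ((1 / yb\<^sup>2) ^ k * ((yb\<^sup>2) ^ (k - m) * (yb ^ m * yb ^ m))) * ((l ^ (k - m) / fact (k - m)) * ((l ^ m / fact m) * (l ^ m / fact m)))"
        unfolding e[symmetric] by simp
      then show ?thesis by (simp add: power_mult_distrib mult_ac)
    qed
    also have "\<dots> \<le> (1 / yb\<^sup>2) ^ k * (exp (yb\<^sup>2 * l) * exp (yb * l) * ((yb * l) ^ m / fact m))"
    proof (intro mult_left_mono mult_right_mono mult_mono)
      have *: "\<mu> ^ n / fact n \<le> exp \<mu>" if "\<mu> \<ge> 0" for \<mu> :: real and n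
      proof -
        have "\<mu> ^ n / fact n \<le> (\<Sum>i\<le>n. \<mu> ^ i / fact i)" using that by (intro member_le_sum) auto
        also have "\<dots> \<le> exp \<mu>" using that by (rule sum_power_div_fact_le)
        finally show ?thesis .
      qed
      show "(yb\<^sup>2 * l) ^ (k - m) / fact (k - m) \<le> exp (yb\<^sup>2 * l)" "(yb * l) ^ m / fact m \<le> exp (yb * l)"
        using y(1) l(2) by (auto intro!: *)
    qed (use y(1) l(2) in auto)
    finally show "(\<Sum>x\<in>R m. w x) \<le> (1 / yb\<^sup>2) ^ k * exp (yb\<^sup>2 * l) * exp (yb * l) * ((yb * l) ^ m / fact m)"
      by (simp only: mult.assoc)
  qed
  also have "\<dots> = (1 / yb\<^sup>2) ^ k * exp (yb\<^sup>2 * l) * exp (yb * l) * (\<Sum>m\<le>k. (yb * l) ^ m / fact m)"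
    by (rule sum_distrib_left[symmetric])
  also have "\<dots> \<le> (1 / yb\<^sup>2) ^ k * exp (yb\<^sup>2 * l) * exp (yb * l) * exp (yb * l)"
    using y(1) l(2) by (intro mult_left_mono sum_power_div_fact_le) auto
  also have "\<dots> = (1 / yb\<^sup>2) ^ k * exp ((yb\<^sup>2 + 2 * yb) * l)"
    by (simp add: exp_add[symmetric] algebra_simps)
  also have "\<dots> \<le> (1 / yb\<^sup>2) ^ k * (exp 6 * exp (real k * ((yb\<^sup>2 + 2 * yb) / beta)))"
  proof (intro mult_left_mono)
    have "(yb\<^sup>2 + 2 * yb) * l \<le> (yb\<^sup>2 + 2 * yb) * (real k / beta + 2)" using y(1) l(3) by (intro mult_left_mono) auto
    also have "\<dots> = (yb\<^sup>2 + 2 * yb) * 2 + real k * ((yb\<^sup>2 + 2 * yb) / beta)"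
    proof -
      have "a * (b / c + 2) = a * 2 + b * (a / c)" for a b c :: real by (simp add: distrib_left)
      then show ?thesis .
    qed
    also have "\<dots> \<le> 6 + real k * ((yb\<^sup>2 + 2 * yb) / beta)"
      using y beta_bounds by (simp add: algebra_simps)
    finally show "exp ((yb\<^sup>2 + 2 * yb) * l) \<le> exp 6 * exp (real k * ((yb\<^sup>2 + 2 * yb) / beta))"
      by (simp flip: exp_add)
  qed (use y(1) in auto)
  also have "\<dots> = exp 6 * (exp 1 / beta) ^ k * exp (real k / beta)"
  proof -
    have "(yb\<^sup>2 + 2 * yb) / beta = (yb\<^sup>2 + 2 * yb - 1) / beta + 1 / beta" by (simp add: diff_divide_distrib)
    then have "exp (real k * ((yb\<^sup>2 + 2 * yb) / beta)) = exp ((yb\<^sup>2 + 2 * yb - 1) / beta) ^ k * exp (real k / beta)"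
      by (simp add: distrib_left exp_add exp_of_nat_mult[symmetric])
    then show ?thesis unfolding beta_identity[symmetric] by (simp add: power_divide)
  qed
  finally show "(\<Sum>(M,M')\<in>bins.ballot k k \<times> bins.ballot k k.
      gcd_weight M M') \<le>
      exp 6 * (exp 1 / beta) ^ k * exp (real k / beta)" .
qed simp

section \<open>Test vectors and their mass\<close>

text \<open>A test vector may be given as an image measure; the map \<open>f\<close> can take a value several times.\<close>
lemma T_le_weighted_family:
  assumes "finite I" "\<And>i. i \<in> I \<Longrightarrow> f i \<in> {1..N}" "\<And>i. i \<in> I \<Longrightarrow> w i \<ge> 0" "(\<Sum>i\<in>I. w i) > 0"
  shows "T N \<le> real N * (\<Sum>i\<in>I. \<Sum>j\<in>I. real (gcd (f i) (f j)) / sqrt (real (f i) * real (f j)) * w i * w j)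
     / (\<Sum>i\<in>I. w i)\<^sup>2"
proof -
  define s where "s = (\<Sum>i\<in>I. w i)"
  define K where "K = (\<lambda>m n. real (gcd m n) / sqrt (real m * real n))"
  define c where "c = (\<lambda>n\<in>{1..N}. (\<Sum>i\<in>{i\<in>I. f i = n}. w i) / s)"
  have s: "s > 0" using assms(4) by (simp add: s_def)
  have fI: "f ` I \<subseteq> {1..N}" using assms(2) by auto
  have c0: "c n \<ge> 0" if "n \<in> {1..N}" for n
    using that s assms(3) unfolding c_def by (auto intro!: divide_nonneg_nonneg sum_nonneg)
  have "(\<Sum>n\<in>{1..N}. \<bar>c n\<bar>) = (\<Sum>n\<in>{1..N}. c n)" using c0 by (intro sum.cong) auto
  also have "\<dots> = (\<Sum>n\<in>{1..N}. \<Sum>i\<in>{i\<in>I. f i = n}. w i) / s" by (simp add: c_def sum_divide_distrib)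
  also have "(\<Sum>n\<in>{1..N}. \<Sum>i\<in>{i\<in>I. f i = n}. w i) = s"
    unfolding s_def using assms(1) fI by (intro sum.group) auto
  finally have "(\<Sum>n\<in>{1..N}. \<bar>c n\<bar>) = 1" using s by simp
  moreover have "c \<in> {1..N} \<rightarrow>\<^sub>E {0..}" using c0 by (auto simp: PiE_iff c_def)
  ultimately have c: "c \<in> simplex_vecs N" by (simp add: simplex_vecs_def)
  have grp: "(\<Sum>n\<in>{1..N}. h n * c n) = (\<Sum>i\<in>I. h (f i) * w i) / s" for h :: "nat \<Rightarrow> real"
  proof -
    have "(\<Sum>n\<in>{1..N}. h n * c n) = (\<Sum>n\<in>{1..N}. \<Sum>i\<in>{i\<in>I. f i = n}. h (f i) * w i) / s"
      unfolding sum_divide_distrib c_def by (intro sum.cong refl) (simp add: sum_distrib_left sum_divide_distrib)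
    also have "(\<Sum>n\<in>{1..N}. \<Sum>i\<in>{i\<in>I. f i = n}. h (f i) * w i) = (\<Sum>i\<in>I. h (f i) * w i)"
      using assms(1) fI by (intro sum.group) auto
    finally show ?thesis .
  qed
  have "(\<Sum>m\<in>{1..N}. \<Sum>n\<in>{1..N}. K m n * c m * c n) = (\<Sum>m\<in>{1..N}. (\<Sum>n\<in>{1..N}. K m n * c n) * c m)"
    by (simp add: sum_distrib_left sum_distrib_right mult_ac)
  also have "\<dots> = (\<Sum>m\<in>{1..N}. ((\<Sum>j\<in>I. K m (f j) * w j) / s) * c m)" unfolding grp ..
  also have "\<dots> = (\<Sum>i\<in>I. ((\<Sum>j\<in>I. K (f i) (f j) * w j) / s) * w i) / s" by (rule grp)
  also have "\<dots> = (\<Sum>i\<in>I. \<Sum>j\<in>I. K (f i) (f j) * w i * w j) / s\<^sup>2"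
    by (simp add: sum_distrib_left sum_distrib_right sum_divide_distrib power2_eq_square mult_ac)
  finally have "(INF c\<in>simplex_vecs N. \<Sum>m\<in>{1..N}. \<Sum>n\<in>{1..N}. K m n * c m * c n) \<le>
      (\<Sum>i\<in>I. \<Sum>j\<in>I. K (f i) (f j) * w i * w j) / s\<^sup>2"
    using cINF_lower[OF bdd_below_T c] unfolding K_def by simp
  then have "real N * (INF c\<in>simplex_vecs N. \<Sum>m\<in>{1..N}. \<Sum>n\<in>{1..N}. K m n * c m * c n) \<le>
      real N * ((\<Sum>i\<in>I. \<Sum>j\<in>I. K (f i) (f j) * w i * w j) / s\<^sup>2)" by (intro mult_left_mono) auto
  then show ?thesis unfolding T_def K_def s_def by simp
qed

lemma T_le_N: "N \<ge> 1 \<Longrightarrow> T N \<le> real N"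
  using T_le_weighted_family[of "{()}" "\<lambda>_. 1" N "\<lambda>_. 1"] by simp

abbreviation tilted_weight :: "nat multiset \<Rightarrow> real" where
  "tilted_weight \<equiv> poisson_weight tilted"

lemma tilted_weight_bounds: "0 \<le> tilted_weight M" "tilted_weight M \<le> recip_weight M"
  by (intro poisson_weight_nonneg poisson_weight_mono tilted_bounds conjI)+

definition ballot_mass :: "nat \<Rightarrow> real" where
  "ballot_mass k = (\<Sum>M\<in>bins.ballot k k. tilted_weight M)"

lemma ballot_mass_eq: "ballot_mass k = (1 / beta) ^ k * real (Suc k) ^ k / (real (Suc k) * fact k)"
  unfolding ballot_mass_def using bins.sum_poisson_weight_ballot[of k k] by simp

text \<open>Stirling's formula in the closed form for the mass; the exponent 3 is the price of fixing the size and of the ballot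
  condition.\<close>
lemma ballot_mass_ge:
  assumes "k \<ge> 1"
  shows "(ballot_mass k)\<^sup>2 \<ge> ((exp 1 / beta) ^ k)\<^sup>2 / ((exp 1)\<^sup>2 * (real k + 1) ^ 3)"
proof -
  define q where "q = real k + 1"
  have q: "q > 0" "real (Suc k) = q" by (auto simp: q_def)
  have "fact k \<le> exp 1 * sqrt (real k) * real k ^ k / exp (real k)" by (rule fact_le_stirling[OF assms])
  also have "\<dots> \<le> exp 1 * sqrt q * q ^ k / exp (real k)"
    unfolding q_def by (intro divide_right_mono mult_mono mult_left_mono power_mono) auto
  finally have f: "q * fact k \<le> q * (exp 1 * sqrt q * q ^ k / exp (real k))"
    using q by (intro mult_left_mono) auto
  have "(1 / beta) ^ k * q ^ k / (q * (exp 1 * sqrt q * q ^ k / exp (real k))) \<le> ballot_mass k"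
    unfolding ballot_mass_eq q(2) using f q beta_bounds
    by (intro divide_left_mono mult_pos_pos) (auto intro!: mult_pos_pos)
  moreover have "(1 / beta) ^ k * q ^ k / (q * (exp 1 * sqrt q * q ^ k / exp (real k))) =
      (exp 1 / beta) ^ k / (exp 1 * (q * sqrt q))"
    using q(1) by (simp add: power_divide exp_of_nat_mult[symmetric] field_simps)
  ultimately have "(exp 1 / beta) ^ k / (exp 1 * (q * sqrt q)) \<le> ballot_mass k" by simp
  then have "((exp 1 / beta) ^ k / (exp 1 * (q * sqrt q)))\<^sup>2 \<le> (ballot_mass k)\<^sup>2"
    using q beta_bounds by (intro power_mono) auto
  moreover have "((exp 1 / beta) ^ k / (exp 1 * (q * sqrt q)))\<^sup>2 = ((exp 1 / beta) ^ k)\<^sup>2 / ((exp 1)\<^sup>2 * q ^ 3)"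
    using q by (simp add: power_divide power_mult_distrib power2_eq_square power3_eq_cube)
  ultimately show ?thesis by (simp add: q_def)
qed

lemma ln_cutoff_le:
  "\<exists>C>0. \<forall>k. ln (real (cutoff k)) \<le> C * exp (real k / beta) \<and>
     (\<Sum>p\<in>first_blocks k. ln (real p) / real p) \<le> C * exp (real k / beta)"
proof -
  obtain M where M: "M > 0" "\<And>n. n \<ge> 2 \<Longrightarrow> \<bar>prime_recip_sum n - ln (ln (real n))\<bar> \<le> M"
    using mertens_second by blast
  obtain C where C: "C > 0"
    "\<And>n. n \<ge> 1 \<Longrightarrow> \<bar>ln_prime_sum n - ln (real n)\<bar> \<le> C"
    using mertens_first by blast
  show ?thesis
  proof (intro exI[of _ "exp (2 + M) + C"] conjI allI)
    show "exp (2 + M) + C > 0" using C(1) by (intro add_pos_pos) auto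
    fix k
    have e1: "exp (real k / beta) \<ge> 1" using beta_bounds by simp
    have "C * 1 \<le> C * exp (real k / beta)" using C(1) e1 by (intro mult_left_mono) auto
    then have Ce: "C \<le> C * exp (real k / beta)" by simp
    have l: "ln (real (cutoff k)) \<le> exp (2 + M) * exp (real k / beta)"
    proof (cases "cutoff k \<ge> 2")
      case False
      then have "cutoff k = 0 \<or> cutoff k = 1" by auto
      then show ?thesis by auto
    next
      case True
      then have "ln (ln (real (cutoff k))) \<le> real k / beta + 2 + M"
        using M(2)[OF True] block_sum_bounds(2)[of k] by (auto simp: abs_le_iff)
      then have "exp (ln (ln (real (cutoff k)))) \<le> exp (real k / beta + 2 + M)" by (subst exp_le_cancel_iff)
      then show ?thesis using True by (simp add: exp_add mult_ac)
    qed
    then show "ln (real (cutoff k)) \<le> (exp (2 + M) + C) * exp (real k / beta)"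
      using Ce C(1) distrib_right[of "exp (2 + M)" C "exp (real k / beta)"] by linarith
    show "(\<Sum>p\<in>first_blocks k. ln (real p) / real p) \<le> (exp (2 + M) + C) * exp (real k / beta)"
    proof (cases "cutoff k \<ge> 1")
      case False
      then have "cutoff k = 0" by simp
      then have e: "first_blocks k = {}" by (auto simp: first_blocks_def)
      show ?thesis unfolding e using C(1) by (auto intro!: mult_nonneg_nonneg add_nonneg_nonneg)
    next
      case True
      then have "(\<Sum>p\<in>first_blocks k. ln (real p) / real p) \<le> ln (real (cutoff k)) + C"
        using C(2)[OF True] unfolding first_blocks_def abs_le_iff by linarith
      then show ?thesis using l Ce distrib_right[of "exp (2 + M)" C "exp (real k / beta)"] by linarith
    qed
  qed
qed

text \<open>Size-biasing marks one prime; removing it leaves a multiset of size \<open>k - 1\<close> that satisfies the ballot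
  condition, and the closed form for the size \<open>k - 1\<close> is at most twice that for the size \<open>k\<close>.\<close>
lemma first_moment_le:
  assumes "k \<ge> 1"
  shows "(\<Sum>M\<in>bins.ballot k k. tilted_weight M * ln (real (prod_mset M))) \<le>
    2 * (\<Sum>p\<in>first_blocks k. ln (real p) / real p) * ballot_mass k"
proof -
  have bl: "set_mset M \<subseteq> first_blocks k" if "M \<in> bins.ballot k k" for M
    using that unfolding bins.ballot_def multisets_of_size_def by blast
  have "(\<Sum>M\<in>bins.ballot k k. tilted_weight M * ln (real (prod_mset M))) =
    (\<Sum>M\<in>bins.ballot k k. tilted_weight M * (\<Sum>p\<in>#M. ln (real p)))"
  proof (intro sum.cong refl)
    fix M assume "M \<in> bins.ballot k k"
    from bl[OF this] have "p > 0" if "p \<in># M" for p using that by (auto dest!: subsetD intro: prime_gt_0_nat)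
    then show "tilted_weight M * ln (real (prod_mset M)) = tilted_weight M * (\<Sum>p\<in>#M. ln (real p))"
      by (subst ln_prod_mset) auto
  qed
  also have "\<dots> = (\<Sum>p\<in>first_blocks k. ln (real p) * tilted p * (\<Sum>M\<in>{M. add_mset p M \<in> bins.ballot k k}. tilted_weight M))"
    by (intro sum_additive_poisson_weight bins.finite_ballot finite_first_blocks bl)
  also have "\<dots> \<le> (\<Sum>p\<in>first_blocks k. (ln (real p) / real p) * (2 * ballot_mass k))"
  proof (rule sum_mono)
    fix p assume p: "p \<in> first_blocks k"
    then have p1: "p \<ge> 1" using prime_ge_1_nat by simp
    have "(\<Sum>M\<in>{M. add_mset p M \<in> bins.ballot k k}. tilted_weight M) \<le> (\<Sum>M\<in>bins.ballot k (k - 1). tilted_weight M)"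
    proof (intro sum_mono2 bins.finite_ballot tilted_weight_bounds)
      show "{M. add_mset p M \<in> bins.ballot k k} \<subseteq> bins.ballot k (k - 1)"
      proof
        fix M assume "M \<in> {M. add_mset p M \<in> bins.ballot k k}"
        then have M: "set_mset M \<subseteq> first_blocks k" "Suc (size M) = k"
            "\<forall>i\<le>k. size (filter_mset (\<lambda>a. a \<in> first_blocks i) (add_mset p M)) \<le> i"
          unfolding bins.ballot_def multisets_of_size_def by auto
        have "size (filter_mset (\<lambda>a. a \<in> first_blocks i) M) \<le> i" if "i \<le> k" for i
        proof -
          have "size (filter_mset (\<lambda>a. a \<in> first_blocks i) M) \<le> size (filter_mset (\<lambda>a. a \<in> first_blocks i) (add_mset p M))"
            by (intro size_mset_mono multiset_filter_mono) auto
          then show ?thesis using M(3) that by (meson order.trans)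
        qed
        then show "M \<in> bins.ballot k (k - 1)"
          using M(1,2) unfolding bins.ballot_def multisets_of_size_def by auto
      qed
    qed
    also have "\<dots> \<le> 2 * ballot_mass k"
    proof -
      obtain n where n: "k = Suc n" using assms by (cases k) auto
      define q where "q = real (Suc k)"
      have q: "q > 0" "q - real n = 2" "real k \<le> q" by (auto simp: q_def n)
      have "(\<Sum>M\<in>bins.ballot k (k - 1). tilted_weight M) = (1 / beta) ^ n * 2 * q ^ n / (q * fact n)"
        using bins.sum_poisson_weight_ballot[of n k] q(2) by (simp add: n q_def)
      also have "\<dots> = 2 * ((1 / beta) ^ n * q ^ n / (q * fact k)) * real k"
        using q(1) by (simp add: n field_simps del: of_nat_Suc)
      also have "\<dots> \<le> 2 * ((1 / beta) ^ n * q ^ n / (q * fact k)) * ((1 / beta) * q)"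
      proof (intro mult_left_mono)
        have "1 * q \<le> (1 / beta) * q" using beta_bounds q by (intro mult_right_mono) auto
        then show "real k \<le> (1 / beta) * q" using q by linarith
      qed (use q beta_bounds in auto)
      also have "\<dots> = 2 * ballot_mass k" unfolding ballot_mass_eq q_def[symmetric] by (simp add: n)
      finally show ?thesis .
    qed
    finally have "(ln (real p) * tilted p) * (\<Sum>M\<in>{M. add_mset p M \<in> bins.ballot k k}. tilted_weight M) \<le>
        (ln (real p) * tilted p) * (2 * ballot_mass k)"
      using p1 tilted_bounds by (intro mult_left_mono mult_nonneg_nonneg) auto
    also have "\<dots> \<le> (ln (real p) * (1 / real p)) * (2 * ballot_mass k)"
      using p1 tilted_bounds tilted_weight_bounds unfolding ballot_mass_def
      by (intro mult_right_mono mult_left_mono mult_nonneg_nonneg sum_nonneg) auto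
    finally show "ln (real p) * tilted p * (\<Sum>M\<in>{M. add_mset p M \<in> bins.ballot k k}. tilted_weight M) \<le>
        (ln (real p) / real p) * (2 * ballot_mass k)" by simp
  qed
  also have "\<dots> = (\<Sum>p\<in>first_blocks k. ln (real p) / real p) * (2 * ballot_mass k)"
    by (rule sum_distrib_right[symmetric])
  also have "\<dots> = 2 * (\<Sum>p\<in>first_blocks k. ln (real p) / real p) * ballot_mass k" by simp
  finally show ?thesis .
qed

lemma gcd_times_large_primes:
  fixes M M' :: "nat multiset"
  assumes "\<And>a. a \<in># M + M' \<Longrightarrow> prime a" "prime p" "prime q" "p \<notin># M + M'" "q \<notin># M + M'"
  shows "gcd (p * prod_mset M) (q * prod_mset M') = (if p = q then p else 1) * gcd (prod_mset M) (prod_mset M')"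
proof -
  have "gcd (prod_mset (add_mset p M)) (prod_mset (add_mset q M')) = prod_mset (add_mset p M \<inter># add_mset q M')"
    using assms by (intro gcd_prod_mset_primes) auto
  moreover have "gcd (prod_mset M) (prod_mset M') = prod_mset (M \<inter># M')"
    using assms by (intro gcd_prod_mset_primes) auto
  moreover have "add_mset p M \<inter># add_mset q M' = (if p = q then add_mset p (M \<inter># M') else M \<inter># M')"
    using assms(4,5) by (auto simp: multiset_eq_iff not_in_iff)
  ultimately show ?thesis by auto
qed

section \<open>The upper bound for T\<close>

lemma prime_window_ge:
  "\<exists>C>0. \<forall>n0 n1. 1 \<le> n0 \<and> n0 \<le> n1 \<longrightarrow>
     (\<Sum>p\<in>primes_le n1 - primes_le n0. ln (real p) / real p) \<ge> ln (real n1) - ln (real n0) - C"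
proof -
  obtain C where C: "C > 0"
    "\<And>n. n \<ge> 1 \<Longrightarrow> \<bar>ln_prime_sum n - ln (real n)\<bar> \<le> C"
    using mertens_first by blast
  show ?thesis
  proof (intro exI[of _ "2 * C"] conjI allI impI)
    fix n0 n1 :: nat assume n: "1 \<le> n0 \<and> n0 \<le> n1"
    then have "(\<Sum>p\<in>primes_le n1 - primes_le n0. ln (real p) / real p) =
        ln_prime_sum n1 - ln_prime_sum n0"
      by (intro sum_diff) auto
    moreover have "1 \<le> n0" "1 \<le> n1" using n by auto
    ultimately show "(\<Sum>p\<in>primes_le n1 - primes_le n0. ln (real p) / real p) \<ge> ln (real n1) - ln (real n0) - 2 * C"
      using C(2)[of n0] C(2)[of n1] unfolding abs_le_iff by linarith
  qed (use C in simp)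
qed

text \<open>Here \<open>\<kappa>\<close> is so large that the window \<open>(N / (\<kappa> r), N / r]\<close> always contains primes with
  \<open>\<Sum> ln p / p \<ge> 1\<close>, and \<open>K0\<close> so large that the blocks reach only up to a small power of \<open>N\<close>.\<close>
lemma T_upper_parametric:
  "\<exists>K0\<ge>1. \<exists>C>0. \<forall>N k. N \<ge> 3 \<and> k \<ge> 1 \<and> K0 * exp (real k / beta) \<le> ln (real N) \<longrightarrow>
     T N \<le> C * ln (real N) * (beta / exp 1) ^ k * (real k + 1) ^ 3"
proof -
  obtain CL where CL: "CL > 0" "\<And>n0 n1. 1 \<le> n0 \<Longrightarrow> n0 \<le> n1 \<Longrightarrow>
     (\<Sum>p\<in>primes_le n1 - primes_le n0. ln (real p) / real p) \<ge> ln (real n1) - ln (real n0) - CL"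
    using prime_window_ge by blast
  obtain CW where CW: "CW > 0" "\<And>K n0 n1. K \<ge> 1 \<Longrightarrow> real n1 \<le> K * (real n0 + 1) \<Longrightarrow>
     (\<Sum>p\<in>primes_le n1 - primes_le n0. ln (real p) / real p) \<le> ln K + CW"
    using sum_ln_over_prime_window by blast
  define \<kappa> where "\<kappa> = nat \<lceil>exp (CL + 2)\<rceil>"
  have "exp (CL + 2) \<le> real \<kappa>" unfolding \<kappa>_def by linarith
  moreover have "exp (CL + 2) \<ge> 1" using CL by simp
  ultimately have \<kappa>r: "real \<kappa> \<ge> 1" "real \<kappa> \<ge> exp (CL + 2)" by linarith+
  then have \<kappa>: "\<kappa> \<ge> 1" "ln (real \<kappa>) \<ge> CL + 2" by (auto simp: ln_ge_iff)
  from sum_close_gcd_le[OF \<kappa>(1)] obtain CA where CA: "CA > 0 \<and> (\<forall>k. (\<Sum>(M,M')\<in>close_ballot_pairs \<kappa> k.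
      gcd_weight M M') \<le> CA * (exp 1 / beta) ^ k)" ..
  from sum_all_gcd_le obtain CB where CB: "CB > 0 \<and> (\<forall>k. (\<Sum>(M,M')\<in>bins.ballot k k \<times> bins.ballot k k.
      gcd_weight M M') \<le>
      CB * (exp 1 / beta) ^ k * exp (real k / beta))" ..
  from ln_cutoff_le obtain CC where CC: "CC > 0 \<and> (\<forall>k. ln (real (cutoff k)) \<le> CC * exp (real k / beta) \<and>
     (\<Sum>p\<in>first_blocks k. ln (real p) / real p) \<le> CC * exp (real k / beta))" ..
  define CQ where "CQ = ln (real \<kappa>) + CW"
  have CQ: "CQ > 0" unfolding CQ_def using \<kappa>(2) CL(1) CW(1) by linarith
  \<comment> \<open>The term \<open>8 * CC\<close> serves Markov's inequality below, and \<open>2 * ln \<kappa>\<close> the room between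
    the blocks and the large primes.\<close>
  define K0 where "K0 = 8 * CC + 2 * ln (real \<kappa>) + 1"
  define C where "C = real \<kappa> * (CQ\<^sup>2 * CB + CQ * CA) * (4 * (exp 1)\<^sup>2)"
  show ?thesis
  proof (rule exI[of _ K0], rule conjI[rotated], rule exI[of _ C], intro conjI allI impI)
    show "K0 \<ge> 1" unfolding K0_def using CC \<kappa>(2) CL(1) by linarith
    show "C > 0" unfolding C_def using \<kappa>r CQ CA CB by (intro mult_pos_pos add_pos_pos) auto
    fix N k assume "N \<ge> 3 \<and> k \<ge> 1 \<and> K0 * exp (real k / beta) \<le> ln (real N)"
    then have N: "N \<ge> 3" and k: "k \<ge> 1" and big: "K0 * exp (real k / beta) \<le> ln (real N)" by auto
    define e where "e = exp (real k / beta)"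
    have e1: "e \<ge> 1" unfolding e_def using beta_bounds by simp
    have lk0: "ln (real \<kappa>) \<ge> 0" using \<kappa>(2) CL(1) by linarith
    have big2: "8 * (CC * e) \<le> ln (real N)" "2 * (CC * e) + 2 * ln (real \<kappa>) \<le> ln (real N)" "e \<le> ln (real N)"
    proof -
      have 1: "K0 * e = 8 * (CC * e) + 2 * (ln (real \<kappa>) * e) + e" by (simp add: K0_def algebra_simps)
      have 2: "ln (real \<kappa>) * e \<ge> ln (real \<kappa>) * 1" using e1 lk0 by (intro mult_left_mono) auto
      have 3: "CC * e \<ge> 0" using CC e1 by simp
      show "8 * (CC * e) \<le> ln (real N)" "2 * (CC * e) + 2 * ln (real \<kappa>) \<le> ln (real N)" "e \<le> ln (real N)"
        using 1 2 3 e1 lk0 big unfolding e_def[symmetric] by linarith+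
    qed
    have lnN1: "ln (real N) \<ge> 1" by (rule ln_ge_1[OF N])

    define E where "E = {M \<in> bins.ballot k k. (prod_mset M)\<^sup>2 \<le> N}"
    define Q where "Q = (\<lambda>M. primes_le (N div prod_mset M) - primes_le (N div (\<kappa> * prod_mset M)))"
    define a where "a = (\<lambda>p::nat. ln (real p) / real p)"
    define qs where "qs = (\<lambda>M. \<Sum>p\<in>Q M. a p)"
    have finE: "finite E" unfolding E_def using bins.finite_ballot by simp
    have finQ: "finite (Q M)" for M by (simp add: Q_def)
    have EM: "set_mset M \<subseteq> first_blocks k" if "M \<in> bins.ballot k k" for M
      using that unfolding bins.ballot_def multisets_of_size_def by blast
    have rpos: "prod_mset M \<ge> 1" if "M \<in> bins.ballot k k" for M
    proof -
      have "prod_mset M > 0" using EM[OF that] by (intro prod_mset_primes_pos) auto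
      then show ?thesis by simp
    qed

    \<comment> \<open>Markov's inequality: by the first moment bound, the \<open>M\<close> with \<open>prod_mset M > sqrt N\<close> carry at most half of
      the ballot mass.\<close>
    have half: "(\<Sum>M\<in>E. tilted_weight M) \<ge> ballot_mass k / 2"
    proof -
      define B where "B = bins.ballot k k - E"
      have finB: "finite B" unfolding B_def using bins.finite_ballot by simp
      have "(\<Sum>M\<in>B. tilted_weight M) * (ln (real N) / 2) \<le> (\<Sum>M\<in>B. tilted_weight M * ln (real (prod_mset M)))"
        unfolding sum_distrib_right
      proof (intro sum_mono mult_left_mono tilted_weight_bounds)
        fix M assume M: "M \<in> B"
        then have "N < (prod_mset M)\<^sup>2" by (auto simp: B_def E_def)
        then have "real N \<le> real ((prod_mset M)\<^sup>2)" by (intro of_nat_mono less_imp_le)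
        then have "real N \<le> (real (prod_mset M))\<^sup>2" by simp
        then have "ln (real N) \<le> ln ((real (prod_mset M))\<^sup>2)" using N by (intro ln_mono) auto
        also have "\<dots> = 2 * ln (real (prod_mset M))" using rpos[of M] M by (simp add: B_def ln_realpow)
        finally show "ln (real N) / 2 \<le> ln (real (prod_mset M))" by simp
      qed
      also have "\<dots> \<le> (\<Sum>M\<in>bins.ballot k k. tilted_weight M * ln (real (prod_mset M)))"
        using rpos bins.finite_ballot tilted_weight_bounds
        by (intro sum_mono2 mult_nonneg_nonneg) (auto simp: B_def)
      also have "\<dots> \<le> 2 * (\<Sum>p\<in>first_blocks k. ln (real p) / real p) * ballot_mass k" by (rule first_moment_le[OF k])
      also have "\<dots> \<le> 2 * (CC * e) * ballot_mass k"
        using CC unfolding e_def ballot_mass_def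
        by (intro mult_right_mono mult_left_mono sum_nonneg tilted_weight_bounds) auto
      also have "\<dots> \<le> (ln (real N) / 4) * ballot_mass k"
        using big2(1) unfolding ballot_mass_def by (intro mult_right_mono sum_nonneg tilted_weight_bounds) linarith
      finally have "(\<Sum>M\<in>B. tilted_weight M) * (ln (real N) / 2) \<le> (ballot_mass k / 2) * (ln (real N) / 2)"
        by (simp add: mult.commute)
      then have "(\<Sum>M\<in>B. tilted_weight M) \<le> ballot_mass k / 2"
        using lnN1 by (subst (asm) mult_le_cancel_right) auto
      moreover have "(\<Sum>M\<in>B. tilted_weight M) = ballot_mass k - (\<Sum>M\<in>E. tilted_weight M)"
        unfolding B_def ballot_mass_def using bins.finite_ballot by (intro sum_diff) (auto simp: E_def)
      ultimately show ?thesis by linarith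
    qed
    have D0: "ballot_mass k > 0" unfolding ballot_mass_eq using beta_bounds by simp

    \<comment> \<open>The window for the large prime lies above every prime of the blocks, so that prime never divides
      the other factor of either integer.\<close>
    have cofactor: "1 \<le> N div (\<kappa> * prod_mset M)" "cutoff k \<le> N div (\<kappa> * prod_mset M)" if M: "M \<in> E" for M
    proof -
      define r where "r = prod_mset M"
      have r: "r \<ge> 1" "r\<^sup>2 \<le> N" using M rpos unfolding r_def E_def by auto
      define t where "t = max 1 (cutoff k)"
      have t1: "t \<ge> 1" by (simp add: t_def)
      have "ln (real t) \<le> CC * e"
      proof (cases "cutoff k \<ge> 1")
        case True
        then show ?thesis using CC unfolding t_def e_def by (simp add: max_def)
      next
        case False
        then show ?thesis using CC e1 by (simp add: t_def max_def)
      qed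
      then have le: "ln (real t) + ln (real \<kappa>) \<le> ln (real N) / 2" using big2(2) by linarith
      have tk: "real t > 0" "real \<kappa> > 0" using t1 \<kappa>(1) by auto
      have gen: "ln ((x * y)\<^sup>2) \<le> z" if "x > 0" "y > 0" "ln x + ln y \<le> z / 2" for x y z :: real
        using that by (simp add: ln_realpow ln_mult)
      have "ln ((real t * real \<kappa>)\<^sup>2) \<le> ln (real N)" by (rule gen[OF tk le])
      then have "(real t * real \<kappa>)\<^sup>2 \<le> real N" using tk N by (subst (asm) ln_le_cancel_iff) auto
      then have "real ((t * \<kappa>)\<^sup>2) \<le> real N" by simp
      then have "(t * \<kappa>)\<^sup>2 \<le> N" by (rule of_nat_le_iff[THEN iffD1])
      then have "(t * \<kappa>)\<^sup>2 * r\<^sup>2 \<le> N * N" by (rule mult_mono[OF _ r(2)]) simp_all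
      then have "(t * \<kappa> * r)\<^sup>2 \<le> N\<^sup>2" by (simp only: power_mult_distrib power2_eq_square[of N])
      then have "t * \<kappa> * r \<le> N" by (rule power2_le_imp_le) simp
      then have "t \<le> N div (\<kappa> * r)" using r \<kappa> by (simp add: less_eq_div_iff_mult_less_eq mult.assoc)
      then show "1 \<le> N div (\<kappa> * prod_mset M)" "cutoff k \<le> N div (\<kappa> * prod_mset M)"
        unfolding r_def t_def by auto
    qed
    have Qp: "prime p" "p * prod_mset M \<le> N" "N < \<kappa> * (p * prod_mset M)" "cutoff k < p" "p \<le> N" "p \<ge> 1"
      if M: "M \<in> E" and p: "p \<in> Q M" for M p
    proof -
      have r: "prod_mset M \<ge> 1" using M rpos by (auto simp: E_def)
      show "prime p" using p by (simp add: Q_def)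
      show p1: "p \<ge> 1" using p by (simp add: Q_def)
      have "p \<le> N div prod_mset M" using p by (simp add: Q_def)
      then show le: "p * prod_mset M \<le> N" using r by (simp add: less_eq_div_iff_mult_less_eq)
      have gt: "N div (\<kappa> * prod_mset M) < p" using p by (auto simp: Q_def)
      then show "N < \<kappa> * (p * prod_mset M)"
        using r \<kappa> by (simp add: div_less_iff_less_mult mult_ac)
      show "cutoff k < p" using gt cofactor(2)[OF M] by linarith
      have "p * 1 \<le> p * prod_mset M" using r by (intro mult_left_mono) auto
      then show "p \<le> N" using le by linarith
    qed
    have a0: "a p \<ge> 0" if "p \<ge> 1" for p using that by (simp add: a_def)
    have qs_ge: "qs M \<ge> 1" if M: "M \<in> E" for M
    proof -
      define r where "r = prod_mset M"
      have r: "r \<ge> 1" using M rpos unfolding r_def E_def by auto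
      define n0 n1 where "n0 = N div (\<kappa> * r)" and "n1 = N div r"
      have n0: "n0 \<ge> 1" using cofactor(1)[OF M] by (simp add: n0_def r_def)
      have n01: "n0 \<le> n1" unfolding n0_def n1_def using r \<kappa> by (intro div_le_mono2) auto
      have "real n0 \<le> real N / real (\<kappa> * r)" unfolding n0_def by (rule of_nat_div_le_of_nat)
      then have b0: "ln (real n0) \<le> ln (real N / real (\<kappa> * r))" using n0 by (intro ln_mono) auto
      have "N < (n1 + 1) * r" unfolding n1_def using dividend_less_times_div[of r N] r by (simp add: mult.commute)
      also have "\<dots> \<le> (2 * n1) * r" using n0 n01 by (intro mult_right_mono) auto
      finally have "real N \<le> real (2 * n1 * r)" by (intro of_nat_mono) auto
      then have "real N / real r \<le> 2 * real n1" using r by (simp add: divide_le_eq)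
      then have "ln (real N / real r) \<le> ln (2 * real n1)" using r N by (intro ln_mono) auto
      also have "\<dots> = ln 2 + ln (real n1)" using n0 n01 by (intro ln_mult_pos) auto
      finally have b1: "ln (real N / real r) - ln 2 \<le> ln (real n1)" by linarith
      have "ln (real N / real r) = ln (real \<kappa> * (real N / real (\<kappa> * r)))" using r \<kappa> by simp
      also have "\<dots> = ln (real \<kappa>) + ln (real N / real (\<kappa> * r))" using r \<kappa> N by (intro ln_mult_pos) auto
      finally have b2: "ln (real N / real r) = ln (real \<kappa>) + ln (real N / real (\<kappa> * r))" .
      have "ln 2 \<le> (1::real)" using ln_le_minus_one[of "2::real"] by simp
      then have "1 \<le> ln (real n1) - ln (real n0) - CL" using b0 b1 b2 \<kappa>(2) by linarith
      also have "\<dots> \<le> (\<Sum>p\<in>primes_le n1 - primes_le n0. ln (real p) / real p)" using n0 n01 by (rule CL(2))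
      also have "\<dots> = qs M" by (simp add: qs_def Q_def a_def n0_def n1_def r_def)
      finally show ?thesis .
    qed
    have qs_le: "qs M \<le> CQ" if M: "M \<in> E" for M
    proof -
      define r where "r = prod_mset M"
      have r: "r \<ge> 1" using M rpos unfolding r_def E_def by auto
      define n0 n1 where "n0 = N div (\<kappa> * r)" and "n1 = N div r"
      have "N < (n0 + 1) * (\<kappa> * r)"
        unfolding n0_def using dividend_less_times_div[of "\<kappa> * r" N] r \<kappa> by (simp add: mult.commute)
      then have "real N \<le> real ((n0 + 1) * (\<kappa> * r))" by (intro of_nat_mono) auto
      also have "real ((n0 + 1) * (\<kappa> * r)) = real \<kappa> * (real n0 + 1) * real r"
        unfolding of_nat_mult of_nat_add of_nat_1 by (simp only: mult_ac)
      finally have "real N / real r \<le> real \<kappa> * (real n0 + 1)" using r by (subst pos_divide_le_eq) auto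
      moreover have "real n1 \<le> real N / real r" unfolding n1_def by (rule of_nat_div_le_of_nat)
      ultimately have "real n1 \<le> real \<kappa> * (real n0 + 1)" by linarith
      from CW(2)[OF \<kappa>r(1) this] show ?thesis by (simp add: qs_def Q_def a_def n0_def n1_def r_def CQ_def)
    qed

    \<comment> \<open>The test vector puts weight \<open>w (M, p)\<close> on the integer \<open>p * prod_mset M\<close>, which lies in \<open>(N/\<kappa>, N]\<close>.\<close>
    define I where "I = Sigma E Q"
    define f where "f = (\<lambda>(M,p). p * prod_mset M :: nat)"
    define w where "w = (\<lambda>(M,p). tilted_weight M * a p)"
    have finI: "finite I" unfolding I_def using finE finQ by auto
    have mass: "(\<Sum>i\<in>I. w i) \<ge> ballot_mass k / 2"
    proof -
      have "(\<Sum>i\<in>I. w i) = (\<Sum>M\<in>E. \<Sum>p\<in>Q M. tilted_weight M * a p)"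
        unfolding I_def w_def by (rule sum.Sigma[symmetric]) (use finE finQ in blast)+
      also have "\<dots> = (\<Sum>M\<in>E. tilted_weight M * qs M)"
        unfolding qs_def by (intro sum.cong refl sum_distrib_left[symmetric])
      finally have "(\<Sum>i\<in>I. w i) = (\<Sum>M\<in>E. tilted_weight M * qs M)" .
      moreover have "(\<Sum>M\<in>E. tilted_weight M * 1) \<le> (\<Sum>M\<in>E. tilted_weight M * qs M)"
        by (intro sum_mono mult_left_mono qs_ge tilted_weight_bounds)
      ultimately show ?thesis using half by simp
    qed
    have w0: "w i \<ge> 0" if i0: "i \<in> I" for i
    proof -
      obtain M p where i: "i = (M, p)" "M \<in> E" "p \<in> Q M" using i0 by (auto simp: I_def)
      show ?thesis unfolding i w_def using a0 Qp(6)[OF i(2,3)] tilted_weight_bounds by auto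
    qed
    have fN: "f i \<in> {1..N}" "real N \<le> real \<kappa> * real (f i)" if i0: "i \<in> I" for i
    proof -
      obtain M p where i: "i = (M, p)" "M \<in> E" "p \<in> Q M" using i0 by (auto simp: I_def)
      note q = Qp[OF i(2,3)]
      have "prod_mset M \<ge> 1" using i(2) rpos by (auto simp: E_def)
      then have "p * prod_mset M \<ge> 1 * 1" using q(6) by (intro mult_mono) auto
      then show "f i \<in> {1..N}" using q(2) by (simp add: i f_def)
      have "real N \<le> real (\<kappa> * (p * prod_mset M))" using q(3) by (intro of_nat_mono) auto
      then show "real N \<le> real \<kappa> * real (f i)" by (simp add: i f_def)
    qed
    have s0: "(\<Sum>i\<in>I. w i) > 0" using mass D0 by linarith

    \<comment> \<open>Distinct large primes contribute the gcd of the small parts only. Equal ones add a factor \<open>p\<close>, but force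
      the two small parts to have comparable size.\<close>
    define close where "close = (\<lambda>M M'. prod_mset M < \<kappa> * prod_mset M' \<and> prod_mset M' < \<kappa> * prod_mset M)"
    define g where "g = (\<lambda>M M'. real (gcd (prod_mset M) (prod_mset M')))"
    have pair: "(\<Sum>p\<in>Q M. \<Sum>q\<in>Q M'. real (gcd (p * prod_mset M) (q * prod_mset M')) * a p * a q) \<le>
        g M M' * (CQ\<^sup>2 + (if close M M' then CQ * ln (real N) else 0))" if M: "M \<in> E" "M' \<in> E" for M M'
    proof -
      have g0: "g M M' \<ge> 0" by (simp add: g_def)
      have primes: "prime b" if "b \<in># M + M'" for b
        using that EM[of M] EM[of M'] M by (auto simp: E_def)
      have notin: "p \<notin># M + M'" if "cutoff k < p" for p
        using that EM[of M] EM[of M'] M by (auto simp: E_def)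
      have "(\<Sum>p\<in>Q M. \<Sum>q\<in>Q M'. real (gcd (p * prod_mset M) (q * prod_mset M')) * a p * a q) \<le>
        (\<Sum>p\<in>Q M. \<Sum>q\<in>Q M'. g M M' * (a p * a q) + (if p = q then g M M' * (ln (real N) * a p) else 0))"
      proof (intro sum_mono)
        fix p q assume p: "p \<in> Q M" and q: "q \<in> Q M'"
        note P = Qp[OF M(1) p] note P' = Qp[OF M(2) q]
        have G: "gcd (p * prod_mset M) (q * prod_mset M') = (if p = q then p else 1) * gcd (prod_mset M) (prod_mset M')"
          using primes P(1) P'(1) notin P(4) P'(4) by (intro gcd_times_large_primes) auto
        have Gr: "real (gcd (p * prod_mset M) (q * prod_mset M')) = (if p = q then real p else 1) * g M M'"
          unfolding G g_def by simp
        have aa: "0 \<le> a p * a q" using a0 P(6) P'(6) by simp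
        show "real (gcd (p * prod_mset M) (q * prod_mset M')) * a p * a q \<le>
            g M M' * (a p * a q) + (if p = q then g M M' * (ln (real N) * a p) else 0)"
        proof (cases "p = q")
          case False
          then show ?thesis unfolding Gr by simp
        next
          case True
          have "real p * a p = ln (real p)" using P(6) by (simp add: a_def)
          also have "\<dots> \<le> ln (real N)" using P(5,6) by (intro ln_mono) auto
          finally have "g M M' * (real p * a p * a p) \<le> g M M' * (ln (real N) * a p)"
            using g0 a0 P(6) by (intro mult_left_mono mult_right_mono) auto
          moreover have "0 \<le> g M M' * (a p * a q)" using g0 aa by simp
          moreover have "real p * g M M' * a p * a q = g M M' * (real p * a p * a p)"
            using True by (simp only: mult_ac)
          ultimately show ?thesis unfolding Gr if_P[OF True] by linarith
        qed
      qed
      also have "\<dots> = g M M' * (qs M * qs M') + (\<Sum>p\<in>Q M. if p \<in> Q M' then g M M' * (ln (real N) * a p) else 0)"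
      proof -
        have "(\<Sum>p\<in>Q M. \<Sum>q\<in>Q M'. g M M' * (a p * a q)) = g M M' * (qs M * qs M')"
          unfolding qs_def unfolding sum_product unfolding sum_distrib_left ..
        moreover have "(\<Sum>q\<in>Q M'. if p = q then X else 0) = (if p \<in> Q M' then X else 0)" for p and X :: real
          using finQ by simp
        ultimately show ?thesis by (simp only: sum.distrib)
      qed
      also have "\<dots> \<le> g M M' * CQ\<^sup>2 + g M M' * (if close M M' then CQ * ln (real N) else 0)"
      proof (intro add_mono mult_left_mono g0)
        have "qs M * qs M' \<le> CQ * CQ"
          using qs_le[OF M(1)] qs_le[OF M(2)] qs_ge[OF M(1)] qs_ge[OF M(2)] CQ by (intro mult_mono) auto
        then show "qs M * qs M' \<le> CQ\<^sup>2" by (simp add: power2_eq_square)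
        show "(\<Sum>p\<in>Q M. if p \<in> Q M' then g M M' * (ln (real N) * a p) else 0) \<le>
            g M M' * (if close M M' then CQ * ln (real N) else 0)"
        proof (cases "close M M'")
          case True
          have "(\<Sum>p\<in>Q M. if p \<in> Q M' then g M M' * (ln (real N) * a p) else 0) \<le>
              (\<Sum>p\<in>Q M. g M M' * (ln (real N) * a p))"
            using g0 lnN1 a0 Qp(6)[OF M(1)] by (intro sum_mono) auto
          also have "\<dots> = g M M' * (ln (real N) * qs M)" by (simp add: qs_def sum_distrib_left)
          also have "\<dots> \<le> g M M' * (ln (real N) * CQ)"
            using g0 lnN1 qs_le[OF M(1)] by (intro mult_left_mono) auto
          finally show ?thesis using True by (simp add: mult_ac)
        next
          case False
          have "p \<notin> Q M'" if p: "p \<in> Q M" for p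
          proof
            assume p': "p \<in> Q M'"
            note P = Qp[OF M(1) p] note P' = Qp[OF M(2) p']
            have "p * prod_mset M' < p * (\<kappa> * prod_mset M)" using order.strict_trans1[OF P'(2) P(3)] by (simp only: mult_ac)
            moreover have "p * prod_mset M < p * (\<kappa> * prod_mset M')" using order.strict_trans1[OF P(2) P'(3)] by (simp only: mult_ac)
            ultimately have "close M M'" unfolding close_def by simp
            then show False using False by simp
          qed
          then show ?thesis using False by (simp add: sum.neutral)
        qed
      qed
      finally show ?thesis by (simp add: distrib_left)
    qed
    have form: "(\<Sum>i\<in>I. \<Sum>j\<in>I. real (gcd (f i) (f j)) * w i * w j) \<le>
        (CQ\<^sup>2 * CB + CQ * CA) * ln (real N) * (exp 1 / beta) ^ k"
    proof -
      have IS: "(\<Sum>i\<in>I. h i) = (\<Sum>M\<in>E. \<Sum>p\<in>Q M. h (M, p))" for h :: "nat multiset \<times> nat \<Rightarrow> real"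
      proof -
        have "(\<Sum>M\<in>E. \<Sum>p\<in>Q M. h (M, p)) = (\<Sum>(M,p)\<in>Sigma E Q. h (M, p))"
          by (rule sum.Sigma) (use finE finQ in blast)+
        then show ?thesis by (simp add: I_def)
      qed
      have "(\<Sum>i\<in>I. \<Sum>j\<in>I. real (gcd (f i) (f j)) * w i * w j) = (\<Sum>M\<in>E. \<Sum>p\<in>Q M. \<Sum>M'\<in>E. \<Sum>q\<in>Q M'.
          real (gcd (p * prod_mset M) (q * prod_mset M')) * (tilted_weight M * a p) * (tilted_weight M' * a q))"
        unfolding IS by (simp add: f_def w_def)
      also have "\<dots> = (\<Sum>M\<in>E. \<Sum>M'\<in>E. \<Sum>p\<in>Q M. \<Sum>q\<in>Q M'.
          real (gcd (p * prod_mset M) (q * prod_mset M')) * (tilted_weight M * a p) * (tilted_weight M' * a q))"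
        by (intro sum.cong refl sum.swap)
      also have "\<dots> = (\<Sum>M\<in>E. \<Sum>M'\<in>E. (tilted_weight M * tilted_weight M') *
          (\<Sum>p\<in>Q M. \<Sum>q\<in>Q M'. real (gcd (p * prod_mset M) (q * prod_mset M')) * a p * a q))"
        unfolding sum_distrib_left by (intro sum.cong refl) (simp only: mult_ac)
      also have "\<dots> \<le> (\<Sum>M\<in>E. \<Sum>M'\<in>E. (recip_weight M * recip_weight M') *
          (g M M' * (CQ\<^sup>2 + (if close M M' then CQ * ln (real N) else 0))))"
      proof (intro sum_mono mult_mono pair)
        fix M M' assume M: "M \<in> E" "M' \<in> E"
        show "tilted_weight M \<le> recip_weight M" "tilted_weight M' \<le> recip_weight M'" by (rule tilted_weight_bounds)+
        show "0 \<le> (\<Sum>p\<in>Q M. \<Sum>q\<in>Q M'. real (gcd (p * prod_mset M) (q * prod_mset M')) * a p * a q)"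
          using a0 Qp(6)[OF M(1)] Qp(6)[OF M(2)] by (intro sum_nonneg mult_nonneg_nonneg) auto
      qed (auto intro!: recip_weight_nonneg tilted_weight_bounds mult_nonneg_nonneg)
      also have "\<dots> = (\<Sum>M\<in>E. \<Sum>M'\<in>E. CQ\<^sup>2 * (g M M' * recip_weight M * recip_weight M') +
          (if close M M' then CQ * ln (real N) * (g M M' * recip_weight M * recip_weight M') else 0))"
        by (intro sum.cong refl) (auto simp: algebra_simps)
      also have "\<dots> = (\<Sum>(M,M')\<in>E\<times>E. CQ\<^sup>2 * (g M M' * recip_weight M * recip_weight M') +
          (if close M M' then CQ * ln (real N) * (g M M' * recip_weight M * recip_weight M') else 0))"
        by (rule sum.cartesian_product)
      also have "\<dots> = CQ\<^sup>2 * (\<Sum>(M,M')\<in>E\<times>E. g M M' * recip_weight M * recip_weight M') +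
          CQ * ln (real N) * (\<Sum>(M,M')\<in>{(M,M')\<in>E\<times>E. close M M'}. g M M' * recip_weight M * recip_weight M')"
      proof -
        have fE: "finite (E \<times> E)" using finE by simp
        have "(\<Sum>(M,M')\<in>E\<times>E. (if close M M' then CQ * ln (real N) * (g M M' * recip_weight M * recip_weight M') else 0)) =
          (\<Sum>x\<in>E\<times>E. if case x of (M,M') \<Rightarrow> close M M' then (case x of (M,M') \<Rightarrow> CQ * ln (real N) * (g M M' * recip_weight M * recip_weight M')) else 0)"
          by (intro sum.cong refl) auto
        also have "\<dots> = (\<Sum>x\<in>{x\<in>E\<times>E. case x of (M,M') \<Rightarrow> close M M'}. case x of (M,M') \<Rightarrow> CQ * ln (real N) * (g M M' * recip_weight M * recip_weight M'))"
          by (rule sum.inter_filter[symmetric]) (rule fE)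
        also have "{x\<in>E\<times>E. case x of (M,M') \<Rightarrow> close M M'} = {(M,M')\<in>E\<times>E. close M M'}" by auto
        finally show ?thesis
          by (simp add: case_prod_unfold sum.distrib sum_distrib_left)
      qed
      also have "\<dots> \<le> CQ\<^sup>2 * (CB * (exp 1 / beta) ^ k * ln (real N)) + CQ * ln (real N) * (CA * (exp 1 / beta) ^ k)"
      proof (intro add_mono mult_left_mono)
        have "(\<Sum>(M,M')\<in>E\<times>E. g M M' * recip_weight M * recip_weight M') \<le>
            (\<Sum>(M,M')\<in>bins.ballot k k \<times> bins.ballot k k. g M M' * recip_weight M * recip_weight M')"
        proof (intro sum_mono2)
          show "finite (bins.ballot k k \<times> bins.ballot k k)" by (intro finite_cartesian_product bins.finite_ballot)
          show "E \<times> E \<subseteq> bins.ballot k k \<times> bins.ballot k k" by (auto simp: E_def)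
        qed (auto simp: g_def intro!: mult_nonneg_nonneg recip_weight_nonneg)
        also have "\<dots> \<le> CB * (exp 1 / beta) ^ k * exp (real k / beta)" unfolding g_def using CB by blast
        also have "\<dots> \<le> CB * (exp 1 / beta) ^ k * ln (real N)"
          using CB beta_bounds big2(3) unfolding e_def by (intro mult_left_mono) auto
        finally show "(\<Sum>(M,M')\<in>E\<times>E. g M M' * recip_weight M * recip_weight M') \<le> CB * (exp 1 / beta) ^ k * ln (real N)" .
        define P where "P = close_ballot_pairs \<kappa> k"
        have "(\<Sum>(M,M')\<in>{(M,M')\<in>E\<times>E. close M M'}. g M M' * recip_weight M * recip_weight M') \<le>
           (\<Sum>(M,M')\<in>P. g M M' * recip_weight M * recip_weight M')"
        proof (intro sum_mono2)
          show "finite P"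
            by (rule finite_subset[of _ "bins.ballot k k \<times> bins.ballot k k"])
               (auto simp: P_def intro!: finite_cartesian_product bins.finite_ballot)
          show "{(M,M')\<in>E\<times>E. close M M'} \<subseteq> P" by (auto simp: E_def P_def close_def)
        qed (auto simp: g_def intro!: mult_nonneg_nonneg recip_weight_nonneg)
        also have "\<dots> \<le> CA * (exp 1 / beta) ^ k" unfolding g_def P_def using CA by blast
        finally show "(\<Sum>(M,M')\<in>{(M,M')\<in>E\<times>E. close M M'}. g M M' * recip_weight M * recip_weight M') \<le> CA * (exp 1 / beta) ^ k" .
      qed (use CQ lnN1 in auto)
      also have "\<dots> = (CQ\<^sup>2 * CB + CQ * CA) * ln (real N) * (exp 1 / beta) ^ k" by (simp add: algebra_simps)
      finally show ?thesis .
    qed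
    have "real N * (\<Sum>i\<in>I. \<Sum>j\<in>I. real (gcd (f i) (f j)) / sqrt (real (f i) * real (f j)) * w i * w j) \<le>
        real \<kappa> * (\<Sum>i\<in>I. \<Sum>j\<in>I. real (gcd (f i) (f j)) * w i * w j)"
      unfolding sum_distrib_left
    proof (intro sum_mono)
      fix i j assume ij: "i \<in> I" "j \<in> I"
      have fp: "real (f i) > 0" "real (f j) > 0" using fN(1)[OF ij(1)] fN(1)[OF ij(2)] by auto
      have "(real N)\<^sup>2 \<le> (real \<kappa> * real (f i)) * (real \<kappa> * real (f j))"
        unfolding power2_eq_square using fN(2)[OF ij(1)] fN(2)[OF ij(2)] by (intro mult_mono) auto
      also have "\<dots> = (real \<kappa> * sqrt (real (f i) * real (f j)))\<^sup>2"
        using fp by (simp add: power_mult_distrib power2_eq_square mult_ac)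
      finally have "real N \<le> real \<kappa> * sqrt (real (f i) * real (f j))" by (rule power2_le_imp_le) simp
      then have "real N / sqrt (real (f i) * real (f j)) \<le> real \<kappa>"
        using fp by (subst pos_divide_le_eq) auto
      then have "real N / sqrt (real (f i) * real (f j)) * (real (gcd (f i) (f j)) * w i * w j) \<le>
          real \<kappa> * (real (gcd (f i) (f j)) * w i * w j)"
        using w0[OF ij(1)] w0[OF ij(2)] by (intro mult_right_mono) auto
      then show "real N * (real (gcd (f i) (f j)) / sqrt (real (f i) * real (f j)) * w i * w j) \<le>
          real \<kappa> * (real (gcd (f i) (f j)) * w i * w j)" by simp
    qed
    also have "\<dots> \<le> real \<kappa> * ((CQ\<^sup>2 * CB + CQ * CA) * ln (real N) * (exp 1 / beta) ^ k)"
      by (intro mult_left_mono form) auto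
    finally have num: "real N * (\<Sum>i\<in>I. \<Sum>j\<in>I. real (gcd (f i) (f j)) / sqrt (real (f i) * real (f j)) * w i * w j) \<le>
        real \<kappa> * ((CQ\<^sup>2 * CB + CQ * CA) * ln (real N) * (exp 1 / beta) ^ k)" .
    define z where "z = (exp 1 / beta) ^ k"
    have z: "z > 0" unfolding z_def using beta_bounds by simp
    define c where "c = (real k + 1) ^ 3"
    have c: "c > 0" by (simp add: c_def)
    have den: "(\<Sum>i\<in>I. w i)\<^sup>2 \<ge> z\<^sup>2 / (4 * (exp 1)\<^sup>2 * c)"
    proof -
      have "z\<^sup>2 / (4 * (exp 1)\<^sup>2 * c) = z\<^sup>2 / ((exp 1)\<^sup>2 * c) / 4" by simp
      also have "\<dots> \<le> (ballot_mass k)\<^sup>2 / 4"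
        unfolding z_def c_def by (intro divide_right_mono ballot_mass_ge[OF k]) auto
      also have "\<dots> = (ballot_mass k / 2)\<^sup>2" by (simp add: power_divide)
      also have "\<dots> \<le> (\<Sum>i\<in>I. w i)\<^sup>2" using mass D0 by (intro power_mono) auto
      finally show ?thesis .
    qed
    have "T N \<le> real N * (\<Sum>i\<in>I. \<Sum>j\<in>I. real (gcd (f i) (f j)) / sqrt (real (f i) * real (f j)) * w i * w j) / (\<Sum>i\<in>I. w i)\<^sup>2"
      by (intro T_le_weighted_family finI fN w0 s0)
    also have "\<dots> \<le> real \<kappa> * ((CQ\<^sup>2 * CB + CQ * CA) * ln (real N) * z) / (z\<^sup>2 / (4 * (exp 1)\<^sup>2 * c))"
    proof (rule frac_le)
      show "0 < z\<^sup>2 / (4 * (exp 1)\<^sup>2 * c)" using z c by simp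
      show "0 \<le> real \<kappa> * ((CQ\<^sup>2 * CB + CQ * CA) * ln (real N) * z)"
        using CQ CA CB lnN1 z by (intro mult_nonneg_nonneg add_nonneg_nonneg) auto
    qed (use num den in \<open>simp_all only: z_def\<close>)
    also have "\<dots> = C * ln (real N) * (1 / z) * c"
      unfolding C_def using z c by (simp add: power2_eq_square)
    also have "1 / z = (beta / exp 1) ^ k" by (simp add: z_def power_divide)
    finally show "T N \<le> C * ln (real N) * (beta / exp 1) ^ k * (real k + 1) ^ 3" unfolding c_def .
  qed
qed

text \<open>Choose \<open>k\<close> maximal with \<open>K0 * exp (k / beta) \<le> ln N\<close>; then \<open>(beta / exp 1) ^ k\<close> is
  \<open>(ln N) powr (eta - 1)\<close> up to a constant.\<close>
lemma T_upper_large: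
  "\<exists>N0\<ge>3. \<exists>K>0. \<forall>N\<ge>N0. T N \<le> K * (ln (real N) powr eta * (ln (ln (real N))) ^ 3)"
proof -
  from T_upper_parametric obtain K0 C where K0: "K0 \<ge> 1" and C: "C > 0" and
    TC: "\<And>N k. N \<ge> 3 \<Longrightarrow> k \<ge> 1 \<Longrightarrow> K0 * exp (real k / beta) \<le> ln (real N) \<Longrightarrow>
     T N \<le> C * ln (real N) * (beta / exp 1) ^ k * (real k + 1) ^ 3" by blast
  define N0 where "N0 = nat \<lceil>exp (K0 * exp (1 / beta) + exp 1)\<rceil> + 3"
  define D where "D = exp (1 - ln beta) * K0 powr (1 - eta)"
  show ?thesis
  proof (intro exI[of _ N0] conjI exI[of _ "8 * C * D"] allI impI)
    show "N0 \<ge> 3" by (simp add: N0_def)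
    show "8 * C * D > 0" using C K0 by (simp add: D_def)
    fix N assume NN: "N \<ge> N0"
    then have N3: "N \<ge> 3" by (simp add: N0_def)
    have "exp (K0 * exp (1 / beta) + exp 1) \<le> real N0" unfolding N0_def by linarith
    then have "exp (K0 * exp (1 / beta) + exp 1) \<le> real N" using NN by linarith
    then have lnN: "K0 * exp (1 / beta) + exp 1 \<le> ln (real N)" using N3 by (subst ln_ge_iff) auto
    define Lg where "Lg = ln (real N)"
    have "K0 * exp (1 / beta) > 0" using K0 by simp
    then have Lg: "Lg \<ge> exp 1" "Lg \<ge> K0 * exp (1 / beta)" using lnN exp_gt_zero[of "1::real"] unfolding Lg_def by linarith+
    have Lg0: "Lg > 0" using Lg(1) by (meson exp_gt_zero less_le_trans)
    have lnb: "ln beta \<le> 0" using beta_bounds by simp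
    have L1: "ln Lg \<ge> 1" using Lg(1) Lg0 by (simp add: ln_ge_iff)
    define u where "u = ln (Lg / K0)"
    have u: "u = ln Lg - ln K0" unfolding u_def using Lg0 K0 by (simp add: ln_div)
    have "exp (1 / beta) \<le> Lg / K0" using Lg(2) K0 by (simp add: field_simps)
    then have ub: "u \<ge> 1 / beta" unfolding u_def using Lg0 K0 by (simp add: ln_ge_iff)
    define k where "k = nat \<lfloor>beta * u\<rfloor>"
    have bu: "beta * u \<ge> 1" using ub beta_bounds by (simp add: field_simps)
    have k: "k \<ge> 1" "real k \<le> beta * u" "real k \<ge> beta * u - 1" unfolding k_def using bu by linarith+
    have "exp (real k / beta) \<le> exp u" using k(2) beta_bounds by (simp add: field_simps)
    then have "K0 * exp (real k / beta) \<le> K0 * exp u" using K0 by (intro mult_left_mono) auto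
    also have "\<dots> = Lg" unfolding u_def using Lg0 K0 by simp
    finally have "T N \<le> C * Lg * (beta / exp 1) ^ k * (real k + 1) ^ 3"
      unfolding Lg_def by (intro TC N3 k(1))
    also have "\<dots> \<le> C * Lg * (D * Lg powr (eta - 1)) * (2 * ln Lg) ^ 3"
    proof (intro mult_mono mult_left_mono)
      have "(beta / exp 1) ^ k = exp (real k * (ln beta - 1))"
        using beta_bounds by (simp add: exp_of_nat_mult exp_diff)
      also have "\<dots> \<le> exp ((beta * u - 1) * (ln beta - 1))"
        using k(3) lnb by (intro iffD2[OF exp_le_cancel_iff] mult_right_mono_neg) auto
      also have "(beta * u - 1) * (ln beta - 1) = (1 - ln beta) + (eta - 1) * u"
        unfolding eta_eq_Qfun by (simp add: algebra_simps)
      also have "\<dots> = (1 - ln beta) + (1 - eta) * ln K0 + (eta - 1) * ln Lg"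
        unfolding u by (simp add: algebra_simps)
      also have "exp \<dots> = D * Lg powr (eta - 1)"
        unfolding D_def using K0 Lg0 by (simp add: exp_add powr_def)
      finally show "(beta / exp 1) ^ k \<le> D * Lg powr (eta - 1)" .
      have "ln K0 \<ge> 0" using K0 by simp
      moreover have "beta * u \<le> 1 * u"
        using beta_bounds ub by (intro mult_right_mono) (auto intro: order.trans[rotated])
      ultimately have "real k + 1 \<le> 2 * ln Lg" using k(2) u L1 by linarith
      then show "(real k + 1) ^ 3 \<le> (2 * ln Lg) ^ 3" by (intro power_mono) auto
    qed (use C Lg0 beta_bounds in \<open>auto simp: D_def\<close>)
    also have "\<dots> = 8 * C * D * ((Lg * Lg powr (eta - 1)) * (ln Lg) ^ 3)"
      by (simp add: power_mult_distrib mult_ac)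
    also have "Lg * Lg powr (eta - 1) = Lg powr eta"
      using Lg0 by (simp add: powr_diff)
    finally show "T N \<le> 8 * C * D * (ln (real N) powr eta * (ln (ln (real N))) ^ 3)" unfolding Lg_def .
  qed
qed

lemma ln_3_gt_1: "ln 3 > (1::real)"
proof -
  have "ln (3::real) = ln (3/2) + ln 2" by (simp add: ln_div)
  moreover have "ln (3/2) \<ge> (2/5::real)" using ln_ge_pade[of "3/2"] by simp
  moreover have "ln 2 \<ge> (2/3::real)" using ln_ge_pade[of 2] by simp
  ultimately show ?thesis by linarith
qed

lemma T_upper_bound:
  "\<exists>K>0. \<forall>N::nat. N \<ge> 3 \<longrightarrow> 1 / 2 * T N \<le> K * (ln (real N) powr eta * (ln (ln (real N))) ^ 3)"
proof -
  from T_upper_large obtain N0 K where N0: "N0 \<ge> 3" and K: "K > 0" and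
    TK: "\<And>N. N \<ge> N0 \<Longrightarrow> T N \<le> K * (ln (real N) powr eta * (ln (ln (real N))) ^ 3)" by blast
  define d where "d = (ln (ln (3::real))) ^ 3"
  have l3: "ln (ln (3::real)) > 0" using ln_3_gt_1 by simp
  have d: "d > 0" unfolding d_def using l3 by simp
  show ?thesis
  proof (intro exI[of _ "K + real N0 / d"] conjI allI impI)
    show "K + real N0 / d > 0" using K d by (intro add_pos_nonneg) auto
    fix N :: nat assume N: "N \<ge> 3"
    define R where "R = ln (real N) powr eta * (ln (ln (real N))) ^ 3"
    have "ln 3 \<le> ln (real N)" using N by simp
    then have "ln (ln 3) \<le> ln (ln (real N))" using ln_3_gt_1 N by (intro ln_mono) auto
    then have "d \<le> (ln (ln (real N))) ^ 3" unfolding d_def using l3 by (intro power_mono) auto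
    moreover have "1 \<le> ln (real N) powr eta" using ln_ge_1[OF N] eta_nonneg by (simp add: ge_one_powr_ge_zero)
    ultimately have "1 * d \<le> R" unfolding R_def using d by (intro mult_mono) auto
    then have R: "d \<le> R" "R > 0" using d by auto
    have "T N \<le> (K + real N0 / d) * R"
    proof (cases "N \<ge> N0")
      case True
      then have "T N \<le> K * R" using TK unfolding R_def by blast
      also have "\<dots> \<le> (K + real N0 / d) * R" using R d by (intro mult_right_mono) auto
      finally show ?thesis .
    next
      case False
      have "T N \<le> real N0" using T_le_N[of N] N False by linarith
      also have "\<dots> = real N0 / d * d" using d by simp
      also have "\<dots> \<le> (K + real N0 / d) * R" using R d K by (intro mult_mono) auto
      finally show ?thesis .
    qed
    moreover define X where "X = (K + real N0 / d) * R"
    moreover have "(K + real N0 / d) * R \<ge> 0" using K d R by (intro mult_nonneg_nonneg add_nonneg_nonneg) auto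
    ultimately show "1 / 2 * T N \<le> (K + real N0 / d) * (ln (real N) powr eta * (ln (ln (real N))) ^ 3)"
      unfolding R_def[symmetric] X_def[symmetric] by simp
  qed
qed

theorem theorem1p1:
  shows "(\<exists>K>0. \<forall>N::nat. N \<ge> 3 \<longrightarrow> ln (real N) powr eta \<le> K * V N) \<and>
    (\<forall>N::nat. N \<ge> 3 \<longrightarrow> V N \<le> 1 / 2 * T N) \<and>
    (\<exists>K>0. \<forall>N::nat. N \<ge> 3 \<longrightarrow>
       1 / 2 * T N \<le> K * (ln (real N) powr eta * (ln (ln (real N))) ^ 3))"
  using V_lower_bound V_le_half_T T_upper_bound by blast

end
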